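(* Let $d\ge2$ be an integer, let $T$ be the $d$-ary rooted tree, and let $\mathcal M(d)=\langle m_1,\dots,m_d\rangle\subset\mathrm{Aut}(T)$, where $$m_1=(1,\dots,1,m_1)(0\,1\cdots d-1),\quad m_2=(1,\dots,1,m_2,1)(0\,1\cdots d-2),\ \dots,\ m_{d-1}=(1,m_{d-1},1,\dots,1)(0\,1),\quad m_d=(m_1,m_2,\dots,m_d).$$ Then $\mathcal M(d)$ is amenable.
   Context: The $d$-ary rooted tree $T$ has as vertices the finite words over $\{0,1,\dots,d-1\}$ (root = empty word), each word $u$ joined by edges to the words $uk$, $0\le k\le d-1$. Notation: $g=(g_0,\dots,g_{d-1})\sigma$ with $g_i\in\mathrm{Aut}(T)$ and $\sigma$ a permutation of $\{0,\dots,d-1\}$ denotes the automorphism $g(zw)=\sigma(z)\,g_{\sigma(z)}(w)$ for a letter $z$ and word $w$ (first apply $\sigma$ to the first letter, then the $g_i$'s on the subtrees); trivial $\sigma$ is omitted, and $1$ is the identity. Explicitly, for $1\le i\le d-1$, $m_i$ has the cycle $(0\,1\cdots d-i)$ as permutation and the entry $m_i$ in the coordinate indexed by $d-i$, all other entries being $1$. $\mathcal M(d)$ is considered as a discrete group. *)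

theory Defs
  imports "HOL-Algebra.Algebra" "HOL-Combinatorics.Cycles" Complex_Main
begin

text \<open>
  Von Neumann's definition: there is a finitely additive probability measure, defined on
  all subsets of the group, which is invariant under left translations.
\<close>

definition amenable :: "('a, 'b) monoid_scheme \<Rightarrow> bool" where
  "amenable G \<longleftrightarrow> group G \<and>
     (\<exists>\<mu> :: 'a set \<Rightarrow> real.
        (\<forall>A \<subseteq> carrier G. 0 \<le> \<mu> A) \<and>
        \<mu> (carrier G) = 1 \<and>
        (\<forall>A \<subseteq> carrier G. \<forall>B \<subseteq> carrier G. A \<inter> B = {} \<longrightarrow> \<mu> (A \<union> B) = \<mu> A + \<mu> B) \<and>
        (\<forall>g \<in> carrier G. \<forall>A \<subseteq> carrier G. \<mu> (g <#\<^bsub>G\<^esub> A) = \<mu> A))"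

definition tree_words :: "nat \<Rightarrow> nat list set" where
  "tree_words d = lists {..<d}"

definition tree_adj :: "nat \<Rightarrow> nat list \<Rightarrow> nat list \<Rightarrow> bool" where
  "tree_adj d u v \<longleftrightarrow> u \<in> tree_words d \<and> v \<in> tree_words d \<and>
     (\<exists>k<d. v = u @ [k] \<or> u = v @ [k])"

text \<open>
  As in \<^const>\<open>BijGroup\<close>, automorphisms are extensional functions on the vertex set, and the
  product of \<open>g\<close> and \<open>f\<close> is the composition \<open>g \<circ> f\<close>.
\<close>

definition tree_auts :: "nat \<Rightarrow> (nat list \<Rightarrow> nat list) set" where
  "tree_auts d = {f \<in> Bij (tree_words d). f [] = [] \<and>
     (\<forall>u \<in> tree_words d. \<forall>v \<in> tree_words d. tree_adj d (f u) (f v) \<longleftrightarrow> tree_adj d u v)}"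

definition Aut_tree :: "nat \<Rightarrow> (nat list \<Rightarrow> nat list) monoid" where
  "Aut_tree d = (BijGroup (tree_words d))\<lparr>carrier := tree_auts d\<rparr>"

text \<open>
  \<open>wreath d g \<sigma>\<close> is the automorphism \<open>(g\<^sub>0, \<dots>, g\<^bsub>d-1\<^esub>)\<sigma>\<close>: the coordinate used below the
  letter \<open>z\<close> is the one indexed by \<open>\<sigma> z\<close>, not by \<open>z\<close>.
\<close>

definition wreath ::
  "nat \<Rightarrow> (nat \<Rightarrow> nat list \<Rightarrow> nat list) \<Rightarrow> (nat \<Rightarrow> nat) \<Rightarrow> nat list \<Rightarrow> nat list" where
  "wreath d g \<sigma> =
     (\<lambda>u \<in> tree_words d. case u of [] \<Rightarrow> [] | z # w \<Rightarrow> \<sigma> z # g (\<sigma> z) w)"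

text \<open>
  The coordinates of \<open>m\<^sub>d = (m\<^sub>1, \<dots>, m\<^sub>d)\<close> are indexed by \<open>0, \<dots>, d - 1\<close>, so
  the coordinate \<open>z\<close> is \<open>m\<^bsub>z+1\<^esub>\<close>.
  The list \<open>[0..<Suc (d - i)]\<close> stands for the cycle \<open>(0 1 \<dots> d-i)\<close>, mapping \<open>0\<close> to \<open>1\<close> and so on.
  The self-referential definition of the generators in the group is recovered below as
  \<open>mother_gen_wreath\<close> and \<open>mother_gen_last\<close>.
\<close>

fun mother_act :: "nat \<Rightarrow> nat \<Rightarrow> nat list \<Rightarrow> nat list" where
  "mother_act d i [] = []"
| "mother_act d i (z # w) =
     (if i = d then z # mother_act d (z + 1) w
      else let y = cycle_of_list [0..<Suc (d - i)] z
           in y # (if y = d - i then mother_act d i w else w))"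

definition mother_gen :: "nat \<Rightarrow> nat \<Rightarrow> nat list \<Rightarrow> nat list" where
  "mother_gen d i = restrict (mother_act d i) (tree_words d)"

definition mother_group :: "nat \<Rightarrow> (nat list \<Rightarrow> nat list) monoid" where
  "mother_group d = (Aut_tree d)\<lparr>carrier := generate (Aut_tree d) (mother_gen d ` {1..d})\<rparr>"

lemma tree_words_simps [simp]:
  "[] \<in> tree_words d"
  "z # w \<in> tree_words d \<longleftrightarrow> z < d \<and> w \<in> tree_words d"
  "u @ v \<in> tree_words d \<longleftrightarrow> u \<in> tree_words d \<and> v \<in> tree_words d"
  by (auto simp: tree_words_def)

lemma mother_gen_wreath:
  assumes "1 \<le> i" "i \<le> d - 1"
  shows "mother_gen d i =
    wreath d (\<lambda>k. if k = d - i then mother_gen d i else \<one>\<^bsub>Aut_tree d\<^esub>)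
      (cycle_of_list [0..<Suc (d - i)])"
proof -
  have "i \<noteq> d" using assms by auto
  then show ?thesis
    by (auto simp: fun_eq_iff wreath_def mother_gen_def Aut_tree_def BijGroup_def Let_def
        restrict_def simp del: upt_Suc split: list.splits)
qed

lemma mother_gen_last: "mother_gen d d = wreath d (\<lambda>k. mother_gen d (k + 1)) id"
  by (auto simp: fun_eq_iff wreath_def mother_gen_def restrict_def split: list.splits)

lemma subgroup_tree_auts: "subgroup (tree_auts d) (BijGroup (tree_words d))"
proof -
  let ?W = "tree_words d"
  interpret B: group "BijGroup ?W" by (rule group_BijGroup)
  show ?thesis
  proof (rule B.subgroupI)
    show "tree_auts d \<subseteq> carrier (BijGroup ?W)"
      by (auto simp: tree_auts_def BijGroup_def)
    have "(\<lambda>x\<in>?W. x) \<in> tree_auts d"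
      using id_Bij by (auto simp: tree_auts_def)
    then show "tree_auts d \<noteq> {}" by auto
  next
    fix f assume f: "f \<in> tree_auts d"
    then have fB: "f \<in> Bij ?W" and f0: "f [] = []"
      and adj: "\<And>u v. u \<in> ?W \<Longrightarrow> v \<in> ?W \<Longrightarrow> tree_adj d (f u) (f v) = tree_adj d u v"
      by (auto simp: tree_auts_def)
    have inj: "inj_on f ?W" and im: "f ` ?W = ?W" using fB by (auto simp: Bij_def bij_betw_def)
    let ?g = "\<lambda>x\<in>?W. inv_into ?W f x"
    have mem: "inv_into ?W f x \<in> ?W" if "x \<in> ?W" for x
      using that im by (simp add: inv_into_into)
    have can: "f (inv_into ?W f x) = x" if "x \<in> ?W" for x
      using that im by (simp add: f_inv_into_f)
    have "?g [] = []"
      using inv_into_f_f[OF inj, of "[]"] f0 by simp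
    moreover have "tree_adj d (?g u) (?g v) = tree_adj d u v" if "u \<in> ?W" "v \<in> ?W" for u v
      using adj[OF mem[OF that(1)] mem[OF that(2)]] that by (simp add: can)
    ultimately have "?g \<in> tree_auts d"
      using restrict_inv_into_Bij[OF fB] by (simp add: tree_auts_def)
    then show "inv\<^bsub>BijGroup ?W\<^esub> f \<in> tree_auts d"
      using inv_BijGroup[OF fB] by simp
  next
    fix f g assume fg: "f \<in> tree_auts d" "g \<in> tree_auts d"
    then have B: "f \<in> Bij ?W" "g \<in> Bij ?W" by (auto simp: tree_auts_def)
    have mem: "g x \<in> ?W" if "x \<in> ?W" for x
      using Bij_imp_funcset[OF B(2)] that by auto
    have "compose ?W f g \<in> tree_auts d"
      using fg compose_Bij[OF B] mem by (simp add: tree_auts_def compose_eq)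
    then show "f \<otimes>\<^bsub>BijGroup ?W\<^esub> g \<in> tree_auts d"
      using B by (simp add: BijGroup_def)
  qed
qed

lemma group_Aut_tree: "group (Aut_tree d)"
  unfolding Aut_tree_def by (rule group.subgroup_imp_group[OF group_BijGroup subgroup_tree_auts])

lemma cycle_lt: "0 < n \<Longrightarrow> n \<le> d \<Longrightarrow> cycle_of_list [0..<n] z < d \<longleftrightarrow> z < d"
proof -
  assume "0 < n" "n \<le> d"
  have "cycle_of_list [0..<n] permutes {..<d}"
    by (rule permutes_subset[OF cycle_permutes]) (use \<open>n \<le> d\<close> in auto)
  then show ?thesis by (metis lessThan_iff permutes_in_image)
qed

lemma mother_act_closed:
  "1 \<le> i \<Longrightarrow> i \<le> d \<Longrightarrow> mother_act d i u \<in> tree_words d \<longleftrightarrow> u \<in> tree_words d"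
proof (induction u arbitrary: i)
  case (Cons z w)
  show ?case
  proof (cases "i = d")
    case True
    then show ?thesis using Cons.IH[of "z + 1"] by auto
  next
    case False
    then show ?thesis using Cons.IH[of i] Cons.prems cycle_lt[of "Suc (d - i)" d z]
      by (auto simp: Let_def simp del: upt_Suc)
  qed
qed simp

lemma mother_act_inj: "mother_act d i u = mother_act d i v \<Longrightarrow> u = v"
proof (induction u arbitrary: i v)
  case Nil
  then show ?case by (cases v) (auto simp: Let_def split: if_splits)
next
  case (Cons z w)
  have "inj (cycle_of_list [0..<Suc (d - i)])"
    using cycle_permutes permutes_inj by blast
  then show ?case using Cons
    by (cases v) (auto simp: Let_def inj_eq simp del: upt_Suc split: if_splits)
qed

lemma mother_act_surj:
  "1 \<le> i \<Longrightarrow> i \<le> d \<Longrightarrow> v \<in> tree_words d \<Longrightarrow> \<exists>u. mother_act d i u = v"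
proof (induction v arbitrary: i)
  case Nil
  show ?case by (rule exI[of _ "[]"]) simp
next
  case (Cons y v)
  show ?case
  proof (cases "i = d")
    case True
    obtain u where "mother_act d (y + 1) u = v" using Cons.IH[of "y + 1"] Cons.prems by auto
    then show ?thesis using True by (intro exI[of _ "y # u"]) simp
  next
    case False
    obtain z where z: "cycle_of_list [0..<Suc (d - i)] z = y"
      using cycle_permutes permutes_surj by (metis surjD)
    obtain u where "mother_act d i u = v" using Cons by auto
    then show ?thesis using False z
      by (intro exI[of _ "z # (if y = d - i then u else v)"]) (simp add: Let_def del: upt_Suc)
  qed
qed

lemma mother_act_snoc: "\<exists>k'. mother_act d i (u @ [k]) = mother_act d i u @ [k']"
  by (induction u arbitrary: i) (auto simp: Let_def simp del: upt_Suc)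

lemma mother_gen_in_Aut_tree:
  assumes "i \<in> {1..d}"
  shows "mother_gen d i \<in> carrier (Aut_tree d)"
proof -
  let ?W = "tree_words d" and ?m = "mother_act d i"
  have i: "1 \<le> i" "i \<le> d" using assms by auto
  note cl = mother_act_closed[OF i]
  have "bij_betw ?m ?W ?W"
    unfolding bij_betw_def
    using cl mother_act_inj mother_act_surj[OF i] by (fastforce intro: inj_onI simp: image_iff)
  then have "mother_gen d i \<in> Bij ?W"
    by (simp add: Bij_def mother_gen_def cong: bij_betw_cong)
  moreover have ext: "(\<exists>k<d. ?m v = ?m u @ [k]) \<longleftrightarrow> (\<exists>k<d. v = u @ [k])"
    if uv: "u \<in> ?W" "v \<in> ?W" for u v
  proof
    assume "\<exists>k<d. v = u @ [k]"
    then obtain k where k: "v = u @ [k]" by auto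
    obtain k' where "?m v = ?m u @ [k']" using mother_act_snoc k by blast
    moreover from this have "k' < d" using cl[of v] uv by simp
    ultimately show "\<exists>k<d. ?m v = ?m u @ [k]" by auto
  next
    assume "\<exists>k<d. ?m v = ?m u @ [k]"
    then obtain k where k: "?m v = ?m u @ [k]" by auto
    then obtain v' l where v: "v = v' @ [l]" by (cases v rule: rev_cases) auto
    then have "?m v' = ?m u" using mother_act_snoc[of d i v' l] k by auto
    then have "v = u @ [l]" using mother_act_inj v by blast
    then show "\<exists>k<d. v = u @ [k]" using uv by auto
  qed
  have "tree_adj d (mother_gen d i u) (mother_gen d i v) = tree_adj d u v"
    if "u \<in> ?W" "v \<in> ?W" for u v
    using ext[OF that] ext[OF that(2,1)] that cl
    unfolding tree_adj_def mother_gen_def by (simp add: ex_disj_distrib conj_disj_distribL)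
  ultimately show ?thesis
    by (simp add: Aut_tree_def tree_auts_def) (simp add: mother_gen_def)
qed

lemma group_mother_group: "group (mother_group d)"
  unfolding mother_group_def
  by (rule group.subgroup_imp_group[OF group_Aut_tree], rule group.generate_is_subgroup[OF group_Aut_tree])
    (use mother_gen_in_Aut_tree in auto)

end

theory Submission
  imports Defs "HOL-Analysis.Analysis"
begin

text \<open>
  The group \<open>G = mother_group d\<close> acts on the set \<open>C\<close> of eventually constant infinite words.
  Functions on \<open>C\<close> that depend logarithmically on the length of the preperiod have arbitrarily
  small energy, because a generator changes this length for only linearly many words of each
  length; so the Schreier graph is recurrent. Choosing a random finite subset of \<open>C\<close> independently
  at each point with probability \<open>sin\<^sup>2 (\<pi> a / 2)\<close>, where \<open>a\<close> is such a function, gives in the limit a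
  \<open>G\<close>-invariant mean on the finite subsets of \<open>C\<close> that is concentrated on the supersets of each
  finite set (extensive amenability, after Juschenko, Nekrashevych and de la Salle). Consequently,
  if a cocycle on \<open>G \<times> C\<close> with values in an amenable group is finitely supported for each group
  element, then \<open>G\<close> is amenable as soon as the kernel of the cocycle is.

  This is used twice. The germ of \<open>g \<in> G\<close> at a point of \<open>C\<close> is determined by the two tails and a
  power of \<open>m\<^sub>d\<close>; this power is a cocycle with values in a cyclic group, supported at finitely many
  points since \<open>m\<^sub>d\<close> has a single singular point. An element of its kernel \<open>H0\<close> changes the tails of
  only finitely many points, so the change of tail is a finitely supported integer cocycle on \<open>H0\<close>.
  The elements of the second kernel \<open>H1\<close> have trivial germs everywhere, so they act on prefixes of
  bounded length only and \<open>H1\<close> is locally finite.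
\<close>

section \<open>Means\<close>

text \<open>The constant words are joined by germs in a graph that is a line with one loop at its
  end: \<open>gen i\<close> leads from the word \<open>a a a ...\<close> with
  \<open>a = d - i - 1\<close> to the next constant word, and \<open>gen d\<close> fixes the last
  one. Contracting the line by \<open>path\<close> leaves the loop, so the germs at
  \<open>000...\<close> are generated by one element. The order of the two cocycles is forced:
  \<open>gen d\<close> changes the tails of infinitely many points (a run of \<open>d - 1\<close>, a
  letter \<open>z < d - 1\<close>, then the constant word moved by \<open>gen (z + 1)\<close>), so
  the change of tail becomes finitely supported only on \<open>H0\<close>. The linear count of words
  whose preperiod changes comes from the two nested runs in \<open>gen d\<close>; it is the
  borderline at which the sum of \<open>1 / (k + 1)\<close> still diverges, whence the harmonic
  numbers in the cutoff. The squared sine serves two purposes: a point with \<open>a = 1\<close> is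
  chosen with probability 1, and the square roots of the weights are unit vectors, so that an l2
  bound on \<open>a\<close> controls the change of the whole distribution.\<close>

definition mean_on :: "'a set \<Rightarrow> (('a \<Rightarrow> real) \<Rightarrow> real) \<Rightarrow> bool" where
  "mean_on A m \<longleftrightarrow>
     (\<forall>f l u. (\<forall>x\<in>A. l \<le> f x \<and> f x \<le> u) \<longrightarrow> l \<le> m f \<and> m f \<le> u) \<and>
     (\<forall>f g. bounded (f ` A) \<longrightarrow> bounded (g ` A) \<longrightarrow> m (\<lambda>x. f x + g x) = m f + m g)"

lemma mean_onI:
  assumes "\<And>f l u. (\<And>x. x \<in> A \<Longrightarrow> l \<le> f x \<and> f x \<le> u) \<Longrightarrow> l \<le> m f \<and> m f \<le> u"
    and "\<And>f g. bounded (f ` A) \<Longrightarrow> bounded (g ` A) \<Longrightarrow> m (\<lambda>x. f x + g x) = m f + m g"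
  shows "mean_on A m"
  using assms unfolding mean_on_def by blast

lemma mean_on_bounds:
  assumes "mean_on A m" "\<And>x. x \<in> A \<Longrightarrow> l \<le> f x \<and> f x \<le> u"
  shows "l \<le> m f \<and> m f \<le> u"
  using assms unfolding mean_on_def by blast

lemma mean_on_add:
  assumes "mean_on A m" "bounded (f ` A)" "bounded (g ` A)"
  shows "m (\<lambda>x. f x + g x) = m f + m g"
  using assms unfolding mean_on_def by blast

lemma bounded_image_real: "bounded (f ` A) \<longleftrightarrow> (\<exists>B::real. \<forall>x\<in>A. - B \<le> f x \<and> f x \<le> B)"
  unfolding bounded_iff by (simp add: abs_le_iff minus_le_iff conj_commute)

lemma mean_on_const:
  assumes "mean_on A m" "\<And>x. x \<in> A \<Longrightarrow> f x = c"
  shows "m f = c"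
  using mean_on_bounds[OF assms(1), of c f c] assms(2) by auto

lemma bounded_image_diff:
  fixes f g :: "'a \<Rightarrow> real"
  assumes "bounded (f ` A)" "bounded (g ` A)"
  shows "bounded ((\<lambda>x. f x - g x) ` A)"
  using bounded_minus_comp[OF assms] .

lemma mean_on_diff:
  assumes m: "mean_on A m" and b: "bounded (f ` A)" "bounded (g ` A)"
  shows "m (\<lambda>x. f x - g x) = m f - m g"
  using mean_on_add[OF m bounded_image_diff[OF b] b(2)] by simp

text \<open>A mean is a functional on total functions, and its dependence on the values on
  \<open>A\<close> alone has to be derived: the difference vanishes on \<open>A\<close>, so its mean
  is squeezed to 0.\<close>

lemma mean_on_cong:
  assumes m: "mean_on A m" and b: "bounded (g ` A)" and eq: "\<And>x. x \<in> A \<Longrightarrow> f x = g x"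
  shows "m f = m g"
proof -
  have "f ` A = g ` A" using eq by auto
  then have "m (\<lambda>x. f x - g x) = m f - m g" by (intro mean_on_diff[OF m]) (use b in auto)
  moreover have "m (\<lambda>x. f x - g x) = 0" using mean_on_const[OF m] eq by simp
  ultimately show ?thesis by simp
qed

lemma mean_on_mono_set:
  assumes m: "mean_on A m" and sub: "A \<subseteq> B"
  shows "mean_on B m"
proof (rule mean_onI)
  fix f :: "'a \<Rightarrow> real" and l u assume "\<And>x. x \<in> B \<Longrightarrow> l \<le> f x \<and> f x \<le> u"
  then show "l \<le> m f \<and> m f \<le> u" using mean_on_bounds[OF m] sub by blast
next
  fix f g :: "'a \<Rightarrow> real" assume "bounded (f ` B)" "bounded (g ` B)"
  then show "m (\<lambda>x. f x + g x) = m f + m g"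
    using mean_on_add[OF m] bounded_subset[OF _ image_mono[OF sub]] by blast
qed

lemma mean_on_eval: "a \<in> A \<Longrightarrow> mean_on A (\<lambda>f. f a)"
  by (rule mean_onI) auto

lemma bounded_image_mean:
  assumes k: "\<And>a. a \<in> A \<Longrightarrow> mean_on B (k a)" and b: "bounded (f ` B)"
  shows "bounded ((\<lambda>a. k a f) ` A)"
proof -
  obtain C where "\<forall>x\<in>B. - C \<le> f x \<and> f x \<le> C" using b unfolding bounded_image_real by blast
  then have "\<forall>a\<in>A. - C \<le> k a f \<and> k a f \<le> C" using mean_on_bounds[OF k] by blast
  then show ?thesis unfolding bounded_image_real by blast
qed

text \<open>Random choices made one after the other: \<open>m\<close> chooses \<open>a\<close>, then
  \<open>k a\<close> chooses a point.\<close>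

lemma mean_on_bind:
  assumes m: "mean_on A m" and k: "\<And>a. a \<in> A \<Longrightarrow> mean_on B (k a)"
  shows "mean_on B (\<lambda>f. m (\<lambda>a. k a f))"
proof (rule mean_onI)
  fix f :: "'b \<Rightarrow> real" and l u assume "\<And>x. x \<in> B \<Longrightarrow> l \<le> f x \<and> f x \<le> u"
  then show "l \<le> m (\<lambda>a. k a f) \<and> m (\<lambda>a. k a f) \<le> u"
    by (intro mean_on_bounds[OF m] mean_on_bounds[OF k])
next
  fix f g :: "'b \<Rightarrow> real" assume b: "bounded (f ` B)" "bounded (g ` B)"
  have bk: "bounded ((\<lambda>a. k a f) ` A)" "bounded ((\<lambda>a. k a g) ` A)"
    using bounded_image_mean[where k = k and A = A] k b by auto
  have "m (\<lambda>a. k a (\<lambda>x. f x + g x)) = m (\<lambda>a. k a f + k a g)"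
    by (rule mean_on_cong[OF m]) (use bounded_plus_comp[OF bk] mean_on_add[OF k b] in auto)
  also have "\<dots> = m (\<lambda>a. k a f) + m (\<lambda>a. k a g)"
    using mean_on_add[OF m] bk by simp
  finally show "m (\<lambda>a. k a (\<lambda>x. f x + g x)) = m (\<lambda>a. k a f) + m (\<lambda>a. k a g)" .
qed

lemma mean_on_map:
  assumes "mean_on A m" "\<And>a. a \<in> A \<Longrightarrow> p a \<in> B"
  shows "mean_on B (\<lambda>f. m (\<lambda>a. f (p a)))"
  by (rule mean_on_bind[OF assms(1)]) (use assms(2) in \<open>simp add: mean_on_eval\<close>)

definition average :: "'a set \<Rightarrow> ('a \<Rightarrow> real) \<Rightarrow> real" where
  "average A f = (\<Sum>x\<in>A. f x) / card A"

lemma mean_on_average: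
  assumes "finite A" "A \<noteq> {}" "A \<subseteq> B"
  shows "mean_on B (average A)"
proof (rule mean_on_mono_set[OF _ assms(3)], rule mean_onI)
  have c: "card A > 0" using assms by (simp add: card_gt_0_iff)
  fix f :: "'a \<Rightarrow> real" and l u assume *: "\<And>x. x \<in> A \<Longrightarrow> l \<le> f x \<and> f x \<le> u"
  have "card A * l \<le> sum f A" "sum f A \<le> card A * u"
    using sum_bounded_below[of A l f] sum_bounded_above[of A f u] * by auto
  then show "l \<le> average A f \<and> average A f \<le> u"
    using c by (auto simp: average_def field_simps)
qed (simp add: average_def sum.distrib add_divide_distrib)

lemma average_reindex:
  assumes "inj_on p A"
  shows "average (p ` A) f = average A (\<lambda>x. f (p x))"
  using assms by (simp add: average_def sum.reindex card_image)

text \<open>A cluster point, in a product of compact intervals, of the evaluation functionals.\<close>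

lemma generalized_limit:
  obtains \<Lambda> :: "(nat \<Rightarrow> real) \<Rightarrow> real" where "\<And>N. mean_on {N..} \<Lambda>"
proof -
  let ?bd = "\<lambda>f :: nat \<Rightarrow> real. bounded (range f)"
  \<comment> \<open>The default 0 at unbounded sequences makes every coordinate bounded, so that all
    \<open>ev n\<close> lie in one compact product.\<close>
  define ev where "ev n f = (if ?bd f then f n else 0)" for n and f :: "nat \<Rightarrow> real"
  have "\<exists>C. \<forall>n. ev n f \<in> {-C..C}" for f
  proof (cases "?bd f")
    case True
    then obtain C where "\<forall>x\<in>UNIV. -C \<le> f x \<and> f x \<le> C" unfolding bounded_image_real by blast
    then show ?thesis using True by (auto simp: ev_def)
  qed (auto simp: ev_def intro: exI[of _ 0])
  then obtain C where C: "\<And>f n. ev n f \<in> {-C f..C f}" by metis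
  define K where "K = PiE UNIV (\<lambda>f. {-C f..C f})"
  have "compactin (product_topology (\<lambda>_. euclidean) UNIV) K"
    unfolding K_def compactin_PiE by simp
  then have "compact K" by (simp add: euclidean_product_topology)
  moreover have "eventually (\<lambda>x. x \<in> K) (filtermap ev sequentially)"
    using C by (simp add: K_def eventually_filtermap PiE_iff del: atLeastAtMost_iff)
  ultimately obtain L where L: "inf (nhds L) (filtermap ev sequentially) \<noteq> bot"
    unfolding compact_filter by (metis filtermap_bot_iff trivial_limit_sequentially)
  \<comment> \<open>\<open>L\<close> is a cluster point of \<open>ev\<close>, so it inherits every
    closed condition that holds from some index on.\<close>
  have cl: "P L" if "closed {x. P x}" "eventually (\<lambda>n. P (ev n)) sequentially" for P
  proof (rule ccontr)
    assume "\<not> P L"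
    then have "eventually (\<lambda>x. \<not> P x) (nhds L)"
      using that(1) eventually_nhds_in_open[of "- {x. P x}" L] by (auto simp: closed_def)
    moreover have "eventually P (filtermap ev sequentially)"
      using that(2) by (simp add: eventually_filtermap)
    ultimately have "eventually (\<lambda>x. False) (inf (nhds L) (filtermap ev sequentially))"
      unfolding eventually_inf by blast
    then show False using L by (simp add: trivial_limit_def)
  qed
  have cont: "continuous_on UNIV (\<lambda>x :: (nat \<Rightarrow> real) \<Rightarrow> real. x f)" for f
    by (rule continuous_on_product_coordinates)
  \<comment> \<open>The finitely many values before \<open>N\<close> do not affect boundedness, so
    the default value of \<open>ev\<close> does not occur for these functions.\<close>
  have bd: "?bd f" if b: "bounded (f ` {N..})" for f :: "nat \<Rightarrow> real" and N
  proof -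
    have "range f = f ` {..<N} \<union> f ` {N..}" unfolding image_Un[symmetric] by (rule arg_cong[where f = "image f"]) auto
    then show ?thesis using b finite_imp_bounded[of "f ` {..<N}"] by simp
  qed
  show thesis
  proof (rule that, rule mean_onI)
    fix N :: nat and f :: "nat \<Rightarrow> real" and l u
    assume *: "\<And>x. x \<in> {N..} \<Longrightarrow> l \<le> f x \<and> f x \<le> u"
    have b: "?bd f" by (rule bd[of _ N], unfold bounded_image_real, rule exI[of _ "\<bar>l\<bar> + \<bar>u\<bar>"])
        (use * in \<open>fastforce simp: atLeast_def\<close>)
    show "l \<le> L f \<and> L f \<le> u"
    proof (rule cl)
      show "closed {x. l \<le> x f \<and> x f \<le> u}"
        by (intro closed_Collect_conj closed_Collect_le continuous_intros cont)
      show "\<forall>\<^sub>F n in sequentially. l \<le> ev n f \<and> ev n f \<le> u"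
        using * b by (auto simp: ev_def eventually_sequentially)
    qed
  next
    fix N :: nat and f g :: "nat \<Rightarrow> real" assume "bounded (f ` {N..})" "bounded (g ` {N..})"
    then have b: "?bd f" "?bd g" using bd by auto
    show "L (\<lambda>x. f x + g x) = L f + L g"
    proof (rule cl)
      show "closed {x. x (\<lambda>x. f x + g x) = (x f + x g :: real)}"
        by (intro closed_Collect_eq continuous_intros cont)
    qed (use b bounded_plus_comp[OF b] in \<open>simp add: ev_def\<close>)
  qed
qed

lemma generalized_limit_null:
  assumes L: "\<And>N. mean_on {N..} \<Lambda>" and f: "f \<longlonglongrightarrow> 0"
  shows "\<Lambda> f = 0"
proof -
  have "\<bar>\<Lambda> f\<bar> \<le> e" if "e > 0" for e
  proof -
    obtain N where N: "\<And>n. n \<ge> N \<Longrightarrow> \<bar>f n\<bar> < e"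
      using LIMSEQ_D[OF f \<open>e > 0\<close>] by auto
    have "-e \<le> f n \<and> f n \<le> e" if "n \<in> {N..}" for n
      using N[of n] that by auto
    then have "-e \<le> \<Lambda> f \<and> \<Lambda> f \<le> e"
      using mean_on_bounds[OF L[of N]] by blast
    then show ?thesis by auto
  qed
  then show ?thesis by (meson abs_le_zero_iff dense_ge)
qed

text \<open>\<open>A\<close> is a subset of an ambient group, so that means on a subgroup and on
  kernels inside it refer to the same multiplication.\<close>

definition mean_inv :: "('g, 'm) monoid_scheme \<Rightarrow> 'g set \<Rightarrow> (('g \<Rightarrow> real) \<Rightarrow> real) \<Rightarrow> bool" where
  "mean_inv G A m \<longleftrightarrow> mean_on A m \<and>
     (\<forall>g\<in>A. \<forall>f. bounded (f ` A) \<longrightarrow> m (\<lambda>x. f (g \<otimes>\<^bsub>G\<^esub> x)) = m f)"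

lemma amenable_if_mean:
  assumes G: "group G" and m: "mean_inv G (carrier G) m"
  shows "amenable G"
proof -
  interpret group G by fact
  have mm: "mean_on (carrier G) m" using m by (simp add: mean_inv_def)
  have bd: "bounded (indicator A ` B :: real set)" for A B :: "'a set"
    unfolding bounded_image_real by (rule exI[of _ 1]) (simp add: indicator_def)
  define \<mu> where "\<mu> A = m (indicator A)" for A
  have "0 \<le> \<mu> A" for A
    unfolding \<mu>_def using mean_on_bounds[OF mm, of 0 "indicator A" 1] by (simp add: indicator_def)
  moreover have "\<mu> (carrier G) = 1"
    unfolding \<mu>_def by (rule mean_on_const[OF mm]) simp
  moreover have "\<mu> (A \<union> B) = \<mu> A + \<mu> B" if "A \<inter> B = {}" for A B
    unfolding \<mu>_def using mean_on_add[OF mm bd bd, of A B] that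
    by (simp add: indicator_add fun_eq_iff)
  moreover have "\<mu> (l_coset G g A) = \<mu> A" if "g \<in> carrier G" "A \<subseteq> carrier G" for g A
  proof -
    have "\<mu> (l_coset G g A) = m (\<lambda>x. indicator (l_coset G g A) (g \<otimes>\<^bsub>G\<^esub> x))"
      unfolding \<mu>_def using m bd that by (simp add: mean_inv_def)
    also have "\<dots> = \<mu> A"
      unfolding \<mu>_def
    proof (rule mean_on_cong[OF mm bd])
      fix x assume "x \<in> carrier G"
      then show "indicator (l_coset G g A) (g \<otimes>\<^bsub>G\<^esub> x) = indicator A x"
        using that unfolding indicator_def l_coset_def
        by (auto simp: subset_iff)
    qed
    finally show ?thesis .
  qed
  ultimately show ?thesis unfolding amenable_def using G by blast
qed

section \<open>An invariant mean on finite subsets\<close>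

text \<open>
  The expectation of \<open>f\<close> at a random subset of \<open>Q\<close> that contains \<open>x\<close> with probability \<open>sin\<^sup>2 (\<theta> x)\<close>,
  independently. The square roots of the weights are unit vectors, whose inner products are
  products of cosines; this makes the dependence on \<open>\<theta>\<close> easy to control.
\<close>

definition bern :: "('a \<Rightarrow> real) \<Rightarrow> 'a set \<Rightarrow> ('a set \<Rightarrow> real) \<Rightarrow> real" where
  "bern \<theta> Q f =
     (\<Sum>F\<in>Pow Q. ((\<Prod>x\<in>F. sin (\<theta> x)) * (\<Prod>x\<in>Q - F. cos (\<theta> x)))\<^sup>2 * f F)"

text \<open>Expand the product of \<open>cos (\<theta> x - \<eta> x)\<close> after the subtraction
  formula; \<open>F\<close> records the points at which the sine term is taken. For equal angles
  this says that the weights sum to 1.\<close>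

lemma bern_inner:
  fixes \<theta> \<eta> :: "'a \<Rightarrow> real"
  assumes "finite Q"
  shows "(\<Sum>F\<in>Pow Q. ((\<Prod>x\<in>F. sin (\<theta> x)) * (\<Prod>x\<in>Q - F. cos (\<theta> x))) *
      ((\<Prod>x\<in>F. sin (\<eta> x)) * (\<Prod>x\<in>Q - F. cos (\<eta> x)))) = (\<Prod>x\<in>Q. cos (\<theta> x - \<eta> x))"
proof -
  have "(\<Prod>x\<in>Q. cos (\<theta> x - \<eta> x)) = (\<Prod>x\<in>Q. sin (\<theta> x) * sin (\<eta> x) + cos (\<theta> x) * cos (\<eta> x))"
    by (rule prod.cong[OF refl]) (simp add: cos_diff)
  also have "\<dots> = (\<Sum>F\<in>Pow Q. (\<Prod>x\<in>F. sin (\<theta> x) * sin (\<eta> x)) *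
      (\<Prod>x\<in>Q - F. cos (\<theta> x) * cos (\<eta> x)))"
    by (rule prod_add[OF assms])
  finally show ?thesis by (simp add: prod.distrib mult_ac)
qed

lemma bern_const: "finite (Q :: 'a set) \<Longrightarrow> bern \<theta> Q (\<lambda>_. c) = c"
  using bern_inner[of Q \<theta> \<theta>] unfolding bern_def sum_distrib_right[symmetric]
  by (simp add: power2_eq_square)

text \<open>A set missing a point of \<open>E\<close> has weight 0, because of a factor
  \<open>cos (\<theta> x) = 0\<close>; so the random set contains \<open>E\<close> surely.\<close>

lemma mean_on_bern:
  assumes Q: "finite Q" "Q \<subseteq> U" and E: "E \<subseteq> Q" "\<And>x. x \<in> E \<Longrightarrow> cos (\<theta> x) = 0"
  shows "mean_on {F \<in> Fpow U. E \<subseteq> F} (bern \<theta> Q)"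
proof (rule mean_onI)
  have le: "bern \<theta> Q f \<le> bern \<theta> Q g"
    if "\<And>F. F \<in> {F \<in> Fpow U. E \<subseteq> F} \<Longrightarrow> f F \<le> g F" for f g
    unfolding bern_def
  proof (rule sum_mono)
    fix F assume F: "F \<in> Pow Q"
    let ?w = "(\<Prod>x\<in>F. sin (\<theta> x)) * (\<Prod>x\<in>Q - F. cos (\<theta> x))"
    show "?w\<^sup>2 * f F \<le> ?w\<^sup>2 * g F"
    proof (cases "E \<subseteq> F")
      case True
      then have "f F \<le> g F" using that[of F] F Q finite_subset[of F Q] by (auto simp: Fpow_def)
      then show ?thesis by (simp add: mult_left_mono)
    next
      case False
      then obtain x where "x \<in> Q - F" "cos (\<theta> x) = 0" using E by blast
      then have "(\<Prod>x\<in>Q - F. cos (\<theta> x)) = 0" using Q by (auto intro: prod_zero)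
      then show ?thesis by simp
    qed
  qed
  fix f :: "'a set \<Rightarrow> real" and l u assume "\<And>F. F \<in> {F \<in> Fpow U. E \<subseteq> F} \<Longrightarrow> l \<le> f F \<and> f F \<le> u"
  then show "l \<le> bern \<theta> Q f \<and> bern \<theta> Q f \<le> u"
    using le[of "\<lambda>_. l" f] le[of f "\<lambda>_. u"] bern_const[OF Q(1)] by auto
qed (simp add: bern_def sum.distrib distrib_left)

text \<open>A point of angle 0 is never chosen. This allows two angle functions with different
  supports to be compared on a common finite set.\<close>

lemma bern_extend:
  assumes "finite Q'" "Q \<subseteq> Q'" and z: "\<And>x. x \<in> Q' - Q \<Longrightarrow> \<theta> x = 0"
  shows "bern \<theta> Q' f = bern \<theta> Q f"
  unfolding bern_def
proof (rule sum.mono_neutral_cong_right)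
  show "\<forall>F\<in>Pow Q' - Pow Q. ((\<Prod>x\<in>F. sin (\<theta> x)) * (\<Prod>x\<in>Q' - F. cos (\<theta> x)))\<^sup>2 * f F = 0"
  proof
    fix F assume F: "F \<in> Pow Q' - Pow Q"
    then obtain x where "x \<in> F" "x \<in> Q' - Q" by blast
    then have "\<exists>x\<in>F. sin (\<theta> x) = 0" using z by force
    then have "(\<Prod>x\<in>F. sin (\<theta> x)) = 0"
      using F assms(1) finite_subset by (intro prod_zero) blast+
    then show "((\<Prod>x\<in>F. sin (\<theta> x)) * (\<Prod>x\<in>Q' - F. cos (\<theta> x)))\<^sup>2 * f F = 0" by simp
  qed
next
  fix F assume F: "F \<in> Pow Q"
  have "(\<Prod>x\<in>Q' - F. cos (\<theta> x)) = (\<Prod>x\<in>Q - F. cos (\<theta> x))"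
    using assms(1,2) F z by (intro prod.mono_neutral_right) force+
  then show "((\<Prod>x\<in>F. sin (\<theta> x)) * (\<Prod>x\<in>Q' - F. cos (\<theta> x)))\<^sup>2 * f F =
      ((\<Prod>x\<in>F. sin (\<theta> x)) * (\<Prod>x\<in>Q - F. cos (\<theta> x)))\<^sup>2 * f F" by simp
qed (use assms in auto)

lemma bern_image:
  assumes "inj_on p Q" and q: "\<And>x. x \<in> Q \<Longrightarrow> \<eta> (p x) = \<theta> x"
  shows "bern \<eta> (p ` Q) f = bern \<theta> Q (\<lambda>F. f (p ` F))"
proof -
  have "inj_on (image p) (Pow Q)" using assms(1) by (rule inj_on_image_Pow)
  then have "bern \<eta> (p ` Q) f = (\<Sum>F\<in>Pow Q.
      ((\<Prod>x\<in>p ` F. sin (\<eta> x)) * (\<Prod>x\<in>p ` Q - p ` F. cos (\<eta> x)))\<^sup>2 * f (p ` F))"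
    unfolding bern_def image_Pow_surj[OF refl, symmetric] by (simp add: sum.reindex)
  also have "\<dots> = bern \<theta> Q (\<lambda>F. f (p ` F))"
    unfolding bern_def
  proof (rule sum.cong[OF refl])
    fix F assume F: "F \<in> Pow Q"
    have i: "inj_on p F" "inj_on p (Q - F)" using assms(1) F by (auto simp: inj_on_def)
    have "p ` Q - p ` F = p ` (Q - F)" using assms(1) F by (simp add: inj_on_image_set_diff)
    moreover have "(\<Prod>x\<in>p ` F. sin (\<eta> x)) = (\<Prod>x\<in>F. sin (\<theta> x))"
      "(\<Prod>x\<in>p ` (Q - F). cos (\<eta> x)) = (\<Prod>x\<in>Q - F. cos (\<theta> x))"
      using F q by (auto simp: prod.reindex[OF i(1)] prod.reindex[OF i(2)] intro!: prod.cong)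
    ultimately show "((\<Prod>x\<in>p ` F. sin (\<eta> x)) * (\<Prod>x\<in>p ` Q - p ` F. cos (\<eta> x)))\<^sup>2 * f (p ` F) =
        ((\<Prod>x\<in>F. sin (\<theta> x)) * (\<Prod>x\<in>Q - F. cos (\<theta> x)))\<^sup>2 * f (p ` F)"
      by simp
  qed
  finally show ?thesis .
qed

lemma one_minus_prod_le:
  fixes c :: "'a \<Rightarrow> real"
  assumes "finite Q" "\<And>x. x \<in> Q \<Longrightarrow> \<bar>c x\<bar> \<le> 1"
  shows "1 - (\<Prod>x\<in>Q. c x) \<le> (\<Sum>x\<in>Q. 1 - c x)"
  using assms
proof (induction Q)
  case (insert y Q)
  let ?p = "\<Prod>x\<in>Q. c x"
  have "\<bar>?p\<bar> \<le> 1" unfolding abs_prod by (rule prod_le_1) (use insert in auto)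
  \<comment> \<open>From \<open>1 - c y * ?p = (1 - c y) + c y * (1 - ?p)\<close>, where
    \<open>1 - ?p\<close> is nonnegative.\<close>
  then have "c y * (1 - ?p) \<le> 1 * (1 - ?p)"
    using insert.prems[of y] by (intro mult_right_mono) auto
  then show ?case using insert by (simp add: algebra_simps)
qed simp

lemma one_minus_cos_le: "1 - cos (t :: real) \<le> t\<^sup>2 / 2"
proof -
  have "1 - cos t = 2 * (sin (t / 2))\<^sup>2" using cos_double_sin[of "t / 2"] by simp
  also have "(sin (t / 2))\<^sup>2 \<le> (t / 2)\<^sup>2"
    using abs_sin_x_le_abs_x[of "t / 2"] by (simp add: abs_le_square_iff[symmetric])
  finally show ?thesis by (simp add: power2_eq_square)
qed

text \<open>For the vectors \<open>v\<close> and \<open>w\<close> of signed square roots of the two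
  weight families, \<open>v\<^sup>2 - w\<^sup>2 = (v - w) * (v + w)\<close>, and Cauchy-Schwarz
  applies. The norm of \<open>v + w\<close> is at most 2; the squared norm of \<open>v - w\<close>
  is twice 1 minus a product of cosines, hence at most the squared l2 distance of the angles. The
  bound is independent of the size of \<open>Q\<close>.\<close>

lemma bern_close:
  fixes \<theta> \<eta> :: "'a \<Rightarrow> real"
  assumes Q: "finite Q" and f: "\<And>F. F \<subseteq> Q \<Longrightarrow> \<bar>f F\<bar> \<le> B"
  shows "\<bar>bern \<theta> Q f - bern \<eta> Q f\<bar> \<le> 2 * B * sqrt (\<Sum>x\<in>Q. (\<theta> x - \<eta> x)\<^sup>2)"
proof -
  define v where "v \<theta> F = (\<Prod>x\<in>F. sin (\<theta> x)) * (\<Prod>x\<in>Q - F. cos (\<theta> x))"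
    for \<theta> :: "'a \<Rightarrow> real" and F
  let ?p = "\<Prod>x\<in>Q. cos (\<theta> x - \<eta> x)"
  have inner: "(\<Sum>F\<in>Pow Q. v \<alpha> F * v \<beta> F) = (\<Prod>x\<in>Q. cos (\<alpha> x - \<beta> x))"
    for \<alpha> \<beta> :: "'a \<Rightarrow> real"
    using bern_inner[OF Q] by (simp add: v_def)
  have "\<bar>?p\<bar> \<le> 1" unfolding abs_prod by (rule prod_le_1) (auto simp: abs_le_iff)
  have "(\<Sum>F\<in>Pow Q. (v \<theta> F + v \<eta> F)\<^sup>2) = 2 + 2 * ?p"
    using inner[of \<theta> \<theta>] inner[of \<eta> \<eta>] inner[of \<theta> \<eta>]
    by (simp add: power2_eq_square algebra_simps sum.distrib flip: sum_distrib_left)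
  then have plus: "L2_set (\<lambda>F. v \<theta> F + v \<eta> F) (Pow Q) \<le> 2"
    using \<open>\<bar>?p\<bar> \<le> 1\<close> unfolding L2_set_def by (intro real_le_lsqrt) auto
  have "(\<Sum>F\<in>Pow Q. (v \<theta> F - v \<eta> F)\<^sup>2) = 2 * (1 - ?p)"
    using inner[of \<theta> \<theta>] inner[of \<eta> \<eta>] inner[of \<theta> \<eta>]
    by (simp add: power2_eq_square algebra_simps sum.distrib sum_subtractf flip: sum_distrib_left)
  also have "\<dots> \<le> 2 * (\<Sum>x\<in>Q. 1 - cos (\<theta> x - \<eta> x))"
    using one_minus_prod_le[OF Q, of "\<lambda>x. cos (\<theta> x - \<eta> x)"] by (simp add: abs_le_iff)
  also have "\<dots> \<le> 2 * (\<Sum>x\<in>Q. (\<theta> x - \<eta> x)\<^sup>2 / 2)"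
    by (intro mult_left_mono sum_mono one_minus_cos_le) auto
  finally have minus: "L2_set (\<lambda>F. v \<theta> F - v \<eta> F) (Pow Q) \<le> sqrt (\<Sum>x\<in>Q. (\<theta> x - \<eta> x)\<^sup>2)"
    unfolding L2_set_def by (simp add: sum_divide_distrib[symmetric])
  have B: "0 \<le> B" using f[of "{}"] by auto
  have "bern \<theta> Q f - bern \<eta> Q f = (\<Sum>F\<in>Pow Q. ((v \<theta> F)\<^sup>2 - (v \<eta> F)\<^sup>2) * f F)"
    by (simp add: bern_def v_def sum_subtractf left_diff_distrib)
  also have "\<bar>\<dots>\<bar> \<le> (\<Sum>F\<in>Pow Q. \<bar>v \<theta> F - v \<eta> F\<bar> * \<bar>v \<theta> F + v \<eta> F\<bar> * B)"
  proof (rule order_trans[OF sum_abs sum_mono])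
    fix F assume "F \<in> Pow Q"
    have "\<bar>((v \<theta> F)\<^sup>2 - (v \<eta> F)\<^sup>2) * f F\<bar> = \<bar>v \<theta> F - v \<eta> F\<bar> * \<bar>v \<theta> F + v \<eta> F\<bar> * \<bar>f F\<bar>"
      by (simp add: abs_mult[symmetric] power2_eq_square algebra_simps)
    also have "\<dots> \<le> \<bar>v \<theta> F - v \<eta> F\<bar> * \<bar>v \<theta> F + v \<eta> F\<bar> * B"
      using f[of F] \<open>F \<in> Pow Q\<close> by (intro mult_left_mono) auto
    finally show "\<bar>((v \<theta> F)\<^sup>2 - (v \<eta> F)\<^sup>2) * f F\<bar> \<le> \<bar>v \<theta> F - v \<eta> F\<bar> * \<bar>v \<theta> F + v \<eta> F\<bar> * B" .
  qed
  also have "\<dots> \<le> (sqrt (\<Sum>x\<in>Q. (\<theta> x - \<eta> x)\<^sup>2) * 2) * B"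
    unfolding sum_distrib_right[symmetric]
    by (rule mult_right_mono[OF order_trans[OF L2_set_mult_ineq mult_mono[OF minus plus]] B])
      (auto simp: L2_set_nonneg sum_nonneg)
  finally show ?thesis by (simp add: mult_ac)
qed

text \<open>The image under \<open>p\<close> of the random set is the random set for the angles
  moved by \<open>p\<close>. By \<open>bern_close\<close> the two expectations differ by a multiple
  of the l2 distance of the angles, which tends to 0; the generalized limit turns this into exact
  invariance.\<close>

lemma finite_subset_mean:
  fixes a :: "nat \<Rightarrow> 'a \<Rightarrow> real"
  assumes supp: "\<And>n. finite {x. a n x \<noteq> 0}" "\<And>n. {x. a n x \<noteq> 0} \<subseteq> U"
    and one: "\<And>x. x \<in> U \<Longrightarrow> \<forall>\<^sub>F n in sequentially. a n x = 1"
  obtains M where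
    "\<And>E. finite E \<Longrightarrow> E \<subseteq> U \<Longrightarrow> mean_on {F \<in> Fpow U. E \<subseteq> F} M"
    "\<And>p \<epsilon> f. bij_betw p U U \<Longrightarrow> \<epsilon> \<longlonglongrightarrow> 0 \<Longrightarrow>
       (\<And>n Q. finite Q \<Longrightarrow> Q \<subseteq> U \<Longrightarrow> (\<Sum>x\<in>Q. (a n (p x) - a n x)\<^sup>2) \<le> \<epsilon> n) \<Longrightarrow>
       bounded (f ` Fpow U) \<Longrightarrow> M (\<lambda>F. f (p ` F)) = M f"
proof -
  obtain L :: "(nat \<Rightarrow> real) \<Rightarrow> real" where L: "\<And>N. mean_on {N..} L" using generalized_limit by blast
  define S where "S n = {x. a n x \<noteq> 0}" for n
  \<comment> \<open>The factor \<open>pi / 2\<close> makes the cosine vanish where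
    \<open>a n x = 1\<close>.\<close>
  define \<theta> where "\<theta> n x = pi / 2 * a n x" for n x
  have S: "finite (S n)" "S n \<subseteq> U" for n using supp by (auto simp: S_def)
  define M where "M f = L (\<lambda>n. bern (\<theta> n) (S n) f)" for f
  have M: "mean_on {F \<in> Fpow U. E \<subseteq> F} M" if E: "finite E" "E \<subseteq> U" for E
  proof -
    have "\<forall>\<^sub>F n in sequentially. \<forall>x\<in>E. a n x = 1"
      using E one by (intro eventually_ball_finite) auto
    then obtain N where N: "\<And>n x. N \<le> n \<Longrightarrow> x \<in> E \<Longrightarrow> a n x = 1"
      unfolding eventually_sequentially by blast
    show ?thesis
      unfolding M_def
    proof (rule mean_on_bind[OF L[of N]])
      fix n assume n: "n \<in> {N..}"
      show "mean_on {F \<in> Fpow U. E \<subseteq> F} (bern (\<theta> n) (S n))"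
      proof (rule mean_on_bern[OF S])
        show "E \<subseteq> S n" using N n by (auto simp: S_def)
        show "cos (\<theta> n x) = 0" if "x \<in> E" for x
          using N n that by (simp add: \<theta>_def)
      qed
    qed
  qed
  moreover have "M (\<lambda>F. f (p ` F)) = M f"
    if p: "bij_betw p U U" and e: "\<epsilon> \<longlonglongrightarrow> 0"
      and en: "\<And>n Q. finite Q \<Longrightarrow> Q \<subseteq> U \<Longrightarrow> (\<Sum>x\<in>Q. (a n (p x) - a n x)\<^sup>2) \<le> \<epsilon> n"
      and f: "bounded (f ` Fpow U)" for p \<epsilon> f
  proof -
    obtain B where B: "\<And>F. F \<in> Fpow U \<Longrightarrow> \<bar>f F\<bar> \<le> B"
      using f unfolding bounded_iff by auto
    define q where "q = inv_into U p"
    have qU: "q x \<in> U" and pq: "p (q x) = x" if "x \<in> U" for x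
      using that p unfolding q_def bij_betw_def by (auto intro: inv_into_into f_inv_into_f)
    have pU: "p x \<in> U" and qp: "q (p x) = x" if "x \<in> U" for x
      using that p unfolding q_def bij_betw_def by auto
    define u where "u n = bern (\<theta> n) (S n) (\<lambda>F. f (p ` F))" for n
    define v where "v n = bern (\<theta> n) (S n) f" for n
    have uv: "\<bar>u n - v n\<bar> \<le> B * pi * sqrt (\<epsilon> n)" for n
    proof -
      \<comment> \<open>A common set for both angle functions: \<open>S n\<close> supports the
        original angles and its image under \<open>p\<close> the moved ones.\<close>
      let ?Q = "S n \<union> p ` S n" and ?\<eta> = "\<lambda>x. \<theta> n (q x)"
      have Q: "finite ?Q" "?Q \<subseteq> U" using S pU by auto
      have inj: "inj_on p (S n)" using inj_on_subset[OF bij_betw_imp_inj_on[OF p] S(2)] .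
      have "u n = bern ?\<eta> (p ` S n) f"
        unfolding u_def by (rule bern_image[OF inj, symmetric]) (use qp subsetD[OF S(2)] in simp)
      also have "\<dots> = bern ?\<eta> ?Q f"
      proof (rule bern_extend[symmetric])
        fix x assume x: "x \<in> ?Q - p ` S n"
        then have "p (q x) \<notin> p ` S n" using pq[OF subsetD[OF Q(2), of x]] by auto
        then have "q x \<notin> S n" by blast
        then show "?\<eta> x = 0" by (simp add: S_def \<theta>_def)
      qed (use Q in auto)
      finally have u: "u n = bern ?\<eta> ?Q f" .
      have v: "v n = bern (\<theta> n) ?Q f"
        unfolding v_def by (rule bern_extend[symmetric]) (use Q in \<open>auto simp: S_def \<theta>_def\<close>)
      have "\<bar>u n - v n\<bar> \<le> 2 * B * sqrt (\<Sum>x\<in>?Q. (?\<eta> x - \<theta> n x)\<^sup>2)"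
        unfolding u v
      proof (rule bern_close[OF Q(1)])
        fix F assume "F \<subseteq> ?Q"
        then have "F \<in> Fpow U" using Q finite_subset[of F ?Q] unfolding Fpow_def by blast
        then show "\<bar>f F\<bar> \<le> B" by (rule B)
      qed
      also have "(\<Sum>x\<in>?Q. (?\<eta> x - \<theta> n x)\<^sup>2) = (pi / 2)\<^sup>2 * (\<Sum>x\<in>?Q. (a n (q x) - a n x)\<^sup>2)"
        by (simp add: \<theta>_def sum_distrib_left power_mult_distrib[symmetric] right_diff_distrib)
      \<comment> \<open>Substituting the point \<open>p y\<close> for \<open>x\<close> produces the
        energy of \<open>a n\<close> along \<open>p\<close>, which the hypothesis bounds.\<close>
      also have "(\<Sum>x\<in>?Q. (a n (q x) - a n x)\<^sup>2) = (\<Sum>x\<in>q ` ?Q. (a n (p x) - a n x)\<^sup>2)"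
      proof (rule sum.reindex_cong[symmetric, of q])
        show "inj_on q ?Q" by (rule inj_on_inverseI[of _ p]) (use pq Q in blast)
        show "(a n (p (q x)) - a n (q x))\<^sup>2 = (a n (q x) - a n x)\<^sup>2" if "x \<in> ?Q" for x
          using pq[of x] Q that by (auto simp: power2_commute)
      qed simp
      also have "2 * B * sqrt ((pi / 2)\<^sup>2 * (\<Sum>x\<in>q ` ?Q. (a n (p x) - a n x)\<^sup>2))
          \<le> 2 * B * sqrt ((pi / 2)\<^sup>2 * \<epsilon> n)"
        using B[of "{}"] Q qU unfolding Fpow_def by (intro mult_left_mono real_sqrt_le_mono en) auto
      finally show ?thesis by (simp add: real_sqrt_mult)
    qed
    have "(\<lambda>n. B * pi * sqrt (\<epsilon> n)) \<longlonglongrightarrow> B * pi * sqrt 0"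
      by (intro tendsto_intros e)
    then have lim: "(\<lambda>n. B * pi * sqrt (\<epsilon> n)) \<longlonglongrightarrow> 0" by simp
    have "(\<lambda>n. u n - v n) \<longlonglongrightarrow> 0"
      by (rule Lim_null_comparison[OF _ lim]) (simp add: uv)
    then have "L (\<lambda>n. u n - v n) = 0" by (rule generalized_limit_null[OF L])
    moreover have "L (\<lambda>n. u n - v n) = L u - L v"
    proof (rule mean_on_diff[OF L[of 0]])
      have k: "mean_on {F \<in> Fpow U. {} \<subseteq> F} (bern (\<theta> n) (S n))" for n
        by (rule mean_on_bern[OF S]) auto
      have "bounded ((\<lambda>F. f (p ` F)) ` Fpow U)"
        by (rule bounded_subset[OF f]) (use pU in \<open>auto simp: Fpow_def\<close>)
      then show "bounded (u ` {0..})" "bounded (v ` {0..})"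
        unfolding u_def v_def using f
        by (auto intro: bounded_image_mean[where k = "\<lambda>n. bern (\<theta> n) (S n)", OF k])
    qed
    ultimately show ?thesis by (simp add: M_def u_def[symmetric] v_def[symmetric])
  qed
  ultimately show thesis by (rule that)
qed

section \<open>Amenability from a finitely supported cocycle\<close>

text \<open>The list of points orders the iterated means, so that no Fubini property is needed.\<close>

primrec label_mean :: "(('v \<Rightarrow> real) \<Rightarrow> real) \<Rightarrow> 'x list \<Rightarrow> (('x \<times> 'v) list \<Rightarrow> real) \<Rightarrow> real" where
  "label_mean m [] f = f []"
| "label_mean m (x # xs) f = m (\<lambda>v. label_mean m xs (\<lambda>r. f ((x, v) # r)))"

lemma mean_on_label_mean:
  assumes m: "mean_on L m"
  shows "mean_on {y \<in> lists (UNIV \<times> L). map fst y = xs} (label_mean m xs)"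
proof (induction xs)
  case (Cons x xs)
  show ?case
    unfolding label_mean.simps
    by (rule mean_on_bind[OF m], rule mean_on_map[OF Cons]) auto
qed (auto intro: mean_onI)

text \<open>The means are nested in the order of the list, and left invariance is applied to each of
  them separately, for multiplication by \<open>\<beta> x\<close>; \<open>p\<close> carries the
  points along without changing the order.\<close>

lemma label_mean_shift:
  assumes m: "mean_inv V L m"
    and \<beta>: "\<And>x. x \<in> set xs \<Longrightarrow> \<beta> x \<in> L" "\<And>u v. u \<in> L \<Longrightarrow> v \<in> L \<Longrightarrow> u \<otimes>\<^bsub>V\<^esub> v \<in> L"
    and f: "bounded (f ` {y \<in> lists (UNIV \<times> L). map fst y = map p xs})"
  shows "label_mean m (map p xs) f =
    label_mean m xs (\<lambda>y. f (map (\<lambda>(x, v). (p x, \<beta> x \<otimes>\<^bsub>V\<^esub> v)) y))"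
  using \<beta>(1) f
proof (induction xs arbitrary: f)
  case (Cons x xs)
  have mm: "mean_on L m" using m by (simp add: mean_inv_def)
  let ?s = "map (\<lambda>(x, v). (p x, \<beta> x \<otimes>\<^bsub>V\<^esub> v))"
  define \<Phi> where "\<Phi> v = label_mean m (map p xs) (\<lambda>r. f ((p x, v) # r))" for v
  have k: "mean_on {y \<in> lists (UNIV \<times> L). map fst y = map p (x # xs)}
      (\<lambda>f. label_mean m (map p xs) (\<lambda>r. f ((p x, v) # r)))" if "v \<in> L" for v
    by (rule mean_on_map[OF mean_on_label_mean[OF mm]]) (use that in auto)
  have bd: "bounded (\<Phi> ` L)"
    unfolding \<Phi>_def
    by (rule bounded_image_mean[where k = "\<lambda>v f. label_mean m (map p xs) (\<lambda>r. f ((p x, v) # r))",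
          OF k Cons.prems(2)])
  have L: "\<beta> x \<otimes>\<^bsub>V\<^esub> v \<in> L" if "v \<in> L" for v
    using \<beta>(2) Cons.prems(1)[of x] that by simp
  have "label_mean m (x # xs) (\<lambda>y. f (?s y)) = m (\<lambda>v. \<Phi> (\<beta> x \<otimes>\<^bsub>V\<^esub> v))"
    unfolding label_mean.simps
  proof (rule mean_on_cong[OF mm])
    show "bounded ((\<lambda>v. \<Phi> (\<beta> x \<otimes>\<^bsub>V\<^esub> v)) ` L)"
      by (rule bounded_subset[OF bd]) (use L in auto)
    fix v assume v: "v \<in> L"
    have "bounded ((\<lambda>r. f ((p x, \<beta> x \<otimes>\<^bsub>V\<^esub> v) # r)) ` {y \<in> lists (UNIV \<times> L). map fst y = map p xs})"
      by (rule bounded_subset[OF Cons.prems(2)]) (use L[OF v] in \<open>auto intro!: imageI\<close>)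
    from Cons.IH[OF Cons.prems(1) this]
    show "label_mean m xs (\<lambda>r. f (?s ((x, v) # r))) = \<Phi> (\<beta> x \<otimes>\<^bsub>V\<^esub> v)"
      by (simp add: \<Phi>_def)
  qed
  also have "\<dots> = m \<Phi>" using m bd Cons.prems(1)[of x] by (simp add: mean_inv_def)
  finally show ?case by (simp add: \<Phi>_def[abs_def])
qed simp

text \<open>Iterated finitely additive means may depend on the order of the points. Averaging over
  all orderings of a finite set gives a construction that commutes with injective maps.\<close>

definition enums :: "'x set \<Rightarrow> 'x list set" where
  "enums F = {xs. set xs = F \<and> distinct xs}"

lemma enums_finite: "finite F \<Longrightarrow> finite (enums F)" "finite F \<Longrightarrow> enums F \<noteq> {}"
  using finite_subset_distinct[of F] finite_distinct_list[of F]
  by (auto simp: enums_def intro: finite_subset[rotated])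

lemma enums_image:
  assumes p: "inj_on p F"
  shows "enums (p ` F) = map p ` enums F"
proof
  show "enums (p ` F) \<subseteq> map p ` enums F"
  proof
    fix ys assume "ys \<in> enums (p ` F)"
    then have ys: "set ys = p ` F" "distinct ys" by (auto simp: enums_def)
    let ?q = "inv_into F p"
    have "map p (map ?q ys) = ys" using ys(1) by (intro map_idI[THEN trans[OF map_map[symmetric, THEN sym]]])
        (auto simp: f_inv_into_f)
    moreover have "map ?q ys \<in> enums F"
      using ys p by (auto simp: enums_def distinct_map inj_on_inv_into inv_into_f_f[OF p] image_image)
    ultimately show "ys \<in> map p ` enums F" by (metis image_eqI)
  qed
qed (use p in \<open>auto simp: enums_def distinct_map\<close>)

text \<open>\<open>A\<close> and \<open>L\<close> are subgroups of ambient groups because the kernel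
  of one cocycle becomes the acting group of another. The finite support of \<open>b g\<close> is
  what a mean concentrated on the supersets of each finite set can absorb.\<close>

locale cocycle_action = group G + V: group V
  for G :: "('g, 'm) monoid_scheme" (structure) and V :: "('v, 'n) monoid_scheme" +
  fixes A :: "'g set" and U :: "'x set" and \<alpha> :: "'g \<Rightarrow> 'x \<Rightarrow> 'x"
    and L :: "'v set" and b :: "'g \<Rightarrow> 'x \<Rightarrow> 'v"
  assumes A: "subgroup A G" and L: "subgroup L V"
    and act_closed: "g \<in> A \<Longrightarrow> x \<in> U \<Longrightarrow> \<alpha> g x \<in> U"
    and act_mult: "g \<in> A \<Longrightarrow> h \<in> A \<Longrightarrow> x \<in> U \<Longrightarrow> \<alpha> (g \<otimes> h) x = \<alpha> g (\<alpha> h x)"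
    and act_one: "x \<in> U \<Longrightarrow> \<alpha> \<one> x = x"
    and b_closed: "g \<in> A \<Longrightarrow> x \<in> U \<Longrightarrow> b g x \<in> L"
    and b_mult: "g \<in> A \<Longrightarrow> h \<in> A \<Longrightarrow> x \<in> U \<Longrightarrow> b (g \<otimes> h) x = b g (\<alpha> h x) \<otimes>\<^bsub>V\<^esub> b h x"
    and b_finite: "g \<in> A \<Longrightarrow> finite {x \<in> U. b g x \<noteq> \<one>\<^bsub>V\<^esub>}"
begin

lemmas A_simps [simp] = subgroup.m_closed[OF A] subgroup.one_closed[OF A] subgroup.m_inv_closed[OF A]
  subgroup.mem_carrier[OF A]

lemmas L_simps [simp] = subgroup.m_closed[OF L] subgroup.one_closed[OF L] subgroup.m_inv_closed[OF L]
  subgroup.mem_carrier[OF L]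

lemma act_inv: "g \<in> A \<Longrightarrow> x \<in> U \<Longrightarrow> \<alpha> (inv g) (\<alpha> g x) = x"
  "g \<in> A \<Longrightarrow> x \<in> U \<Longrightarrow> \<alpha> g (\<alpha> (inv g) x) = x"
  using act_mult[of "inv g" g x] act_mult[of g "inv g" x] by (simp_all add: act_one)

lemma act_bij: "g \<in> A \<Longrightarrow> bij_betw (\<alpha> g) U U"
  by (rule bij_betw_byWitness[of _ "\<alpha> (inv g)"]) (auto simp: act_inv act_closed)

lemma act_inj: "g \<in> A \<Longrightarrow> inj_on (\<alpha> g) U"
  using act_bij bij_betw_def by blast

lemma b_one: "x \<in> U \<Longrightarrow> b \<one> x = \<one>\<^bsub>V\<^esub>"
  using b_mult[of \<one> \<one> x] b_closed[of \<one> x] by (simp add: act_one)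

lemma b_inv: "g \<in> A \<Longrightarrow> x \<in> U \<Longrightarrow> b (inv g) (\<alpha> g x) \<otimes>\<^bsub>V\<^esub> b g x = \<one>\<^bsub>V\<^esub>"
  using b_mult[of "inv g" g x] by (simp add: b_one)

lemma kernel_subgroup: "subgroup {h \<in> A. \<forall>x\<in>U. b h x = \<one>\<^bsub>V\<^esub>} G"
proof (rule subgroupI)
  fix h assume h: "h \<in> {h \<in> A. \<forall>x\<in>U. b h x = \<one>\<^bsub>V\<^esub>}"
  have "b (inv h) x = \<one>\<^bsub>V\<^esub>" if x: "x \<in> U" for x
    using b_inv[of h "\<alpha> (inv h) x"] h x by (simp add: act_inv act_closed b_closed)
  then show "inv h \<in> {h \<in> A. \<forall>x\<in>U. b h x = \<one>\<^bsub>V\<^esub>}" using h by simp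
qed (auto simp: b_mult act_closed intro!: exI[of _ \<one>] b_one)

text \<open>The skew product action on labelled points; the cocycle identity makes it an
  action.\<close>

definition lift :: "'g \<Rightarrow> 'x \<times> 'v \<Rightarrow> 'x \<times> 'v" where
  "lift g = (\<lambda>(x, v). (\<alpha> g x, b g x \<otimes>\<^bsub>V\<^esub> v))"

lemma lift_closed: "g \<in> A \<Longrightarrow> y \<in> lists (U \<times> L) \<Longrightarrow> map (lift g) y \<in> lists (U \<times> L)"
  by (auto simp: lift_def act_closed b_closed in_lists_conv_set)

lemma lift_mult:
  assumes "g \<in> A" "h \<in> A" "y \<in> lists (U \<times> L)"
  shows "map (lift (g \<otimes> h)) y = map (lift g) (map (lift h) y)"
proof -
  have "lift (g \<otimes> h) z = lift g (lift h z)" if z: "z \<in> set y" for z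
  proof -
    obtain x v where "z = (x, v)" "x \<in> U" "v \<in> L" using z assms by (cases z) auto
    then show ?thesis
      using assms b_closed[of g "\<alpha> h x"] b_closed[of h x] act_closed[of h x]
      by (simp add: lift_def act_mult b_mult V.m_assoc)
  qed
  then show ?thesis by simp
qed

lemma lift_one: "y \<in> lists (U \<times> L) \<Longrightarrow> map (lift \<one>) y = y"
  by (rule map_idI) (auto simp: lift_def act_one b_one)

lemma points_lift: "fst ` set (map (lift g) y) = \<alpha> g ` fst ` set y"
  by (force simp: lift_def)

definition equi :: "('x \<times> 'v) list \<Rightarrow> ('x \<times> 'v) list \<Rightarrow> 'g \<Rightarrow> bool" where
  "equi y y' g \<longleftrightarrow> g \<in> A \<and> y' = map (lift g) y \<and> (\<forall>x \<in> U - fst ` set y. b g x = \<one>\<^bsub>V\<^esub>)"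

lemma points_subset: "y \<in> lists (U \<times> L) \<Longrightarrow> fst ` set y \<subseteq> U"
  by auto

lemma equi_trans:
  assumes y: "y \<in> lists (U \<times> L)" and g: "equi y y' g" and h: "equi y' y'' h"
  shows "equi y y'' (h \<otimes> g)"
proof -
  have gh: "g \<in> A" "h \<in> A" "y' = map (lift g) y" "y'' = map (lift h) y'"
    using g h by (auto simp: equi_def)
  have "b (h \<otimes> g) x = \<one>\<^bsub>V\<^esub>" if x: "x \<in> U - fst ` set y" for x
  proof -
    have "\<alpha> g x \<notin> \<alpha> g ` fst ` set y"
      using inj_on_image_mem_iff[OF act_inj[OF gh(1)] _ points_subset[OF y]] x by auto
    then have "\<alpha> g x \<in> U - fst ` set y'" using x gh by (simp only: points_lift) (simp add: act_closed)
    then show ?thesis using x g h gh by (simp add: equi_def b_mult)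
  qed
  then show ?thesis using gh y by (simp add: equi_def lift_mult del: map_map)
qed

lemma equi_sym:
  assumes y: "y \<in> lists (U \<times> L)" and g: "equi y y' g"
  shows "equi y' y (inv g)"
proof -
  have gh: "g \<in> A" "y' = map (lift g) y" using g by (auto simp: equi_def)
  have "b (inv g) x = \<one>\<^bsub>V\<^esub>" if x: "x \<in> U - fst ` set y'" for x
  proof -
    let ?z = "\<alpha> (inv g) x"
    have z: "?z \<in> U" "\<alpha> g ?z = x" using x gh by (auto simp: act_closed act_inv)
    have "?z \<notin> fst ` set y"
    proof
      assume "?z \<in> fst ` set y"
      then have "x \<in> \<alpha> g ` fst ` set y" using z(2) by (metis imageI)
      then show False using x gh(2) points_lift by auto
    qed
    then have "b g ?z = \<one>\<^bsub>V\<^esub>" using g z by (simp add: equi_def)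
    then show ?thesis using b_inv[OF gh(1) z(1)] z gh b_closed[of "inv g" x] x by simp
  qed
  moreover have "map (lift (inv g)) y' = y"
    using lift_mult[of "inv g" g y] gh y by (simp add: lift_one del: map_map)
  ultimately show ?thesis using gh by (simp add: equi_def)
qed

text \<open>Fixing a list fixes each of its entries, not merely the set of points. So at a listed
  point the label is unchanged and cancels in \<open>V\<close>; at the other points triviality is
  part of \<open>equi\<close>.\<close>

lemma equi_stabilizer:
  assumes y: "y \<in> lists (U \<times> L)" and g: "equi y y g"
  shows "g \<in> {h \<in> A. \<forall>x\<in>U. b h x = \<one>\<^bsub>V\<^esub>}"
proof -
  have "b g x = \<one>\<^bsub>V\<^esub>" if x: "x \<in> U" for x
  proof (cases "x \<in> fst ` set y")
    case True
    then obtain v where v: "(x, v) \<in> set y" by auto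
    have "map (lift g) y = y" using g by (simp add: equi_def)
    then have "lift g (x, v) = (x, v)" using v by (metis map_eq_conv map_idI id_apply list.map_id)
    then have "b g x \<otimes>\<^bsub>V\<^esub> v = v" by (simp add: lift_def)
    moreover have "v \<in> carrier V" "b g x \<in> carrier V"
      using v y b_closed[of g x] g x by (auto simp: equi_def)
    ultimately show ?thesis by (metis V.r_cancel_one)
  qed (use g x in \<open>simp add: equi_def\<close>)
  then show ?thesis using g by (simp add: equi_def)
qed

text \<open>
  Choose a representative of every \<open>equi\<close>-class of labelled lists. A labelled list \<open>y\<close> is then
  reached from its representative by a group element, unique up to the stabilizer, which lies in
  the kernel of the cocycle. So an invariant mean on labelled lists and one on the kernel combine.
\<close>

theorem mean_from_kernel:
  assumes mV: "mean_inv V L mV"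
    and supp: "\<And>n. finite {x. a n x \<noteq> 0}" "\<And>n. {x. a n x \<noteq> 0} \<subseteq> U"
    and one: "\<And>x. x \<in> U \<Longrightarrow> \<forall>\<^sub>F n in sequentially. a n x = (1 :: real)"
    and energy: "\<And>g. g \<in> A \<Longrightarrow> \<exists>\<epsilon>. \<epsilon> \<longlonglongrightarrow> 0 \<and>
       (\<forall>n Q. finite Q \<longrightarrow> Q \<subseteq> U \<longrightarrow> (\<Sum>x\<in>Q. (a n (\<alpha> g x) - a n x)\<^sup>2) \<le> \<epsilon> n)"
    and mH: "mean_inv G {h \<in> A. \<forall>x\<in>U. b h x = \<one>\<^bsub>V\<^esub>} mH"
  shows "\<exists>m. mean_inv G A m"
proof -
  let ?H = "{h \<in> A. \<forall>x\<in>U. b h x = \<one>\<^bsub>V\<^esub>}"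
  have mmV: "mean_on L mV" and mmH: "mean_on ?H mH" using mV mH by (auto simp: mean_inv_def)
  obtain M where M: "\<And>E. finite E \<Longrightarrow> E \<subseteq> U \<Longrightarrow> mean_on {F \<in> Fpow U. E \<subseteq> F} M"
    and Minv: "\<And>p \<epsilon> f. bij_betw p U U \<Longrightarrow> \<epsilon> \<longlonglongrightarrow> 0 \<Longrightarrow>
       (\<And>n Q. finite Q \<Longrightarrow> Q \<subseteq> U \<Longrightarrow> (\<Sum>x\<in>Q. (a n (p x) - a n x)\<^sup>2) \<le> \<epsilon> n) \<Longrightarrow>
       bounded (f ` Fpow U) \<Longrightarrow> M (\<lambda>F. f (p ` F)) = M f"
  proof (rule finite_subset_mean[OF supp one], goal_cases)
    case (2 M)
    show ?case by (rule that) (fact 2)+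
  qed
  \<comment> \<open>For every finite \<open>E\<close> contained in \<open>U\<close>, the mean
    \<open>mY\<close> built from orderings and labels is concentrated on \<open>Y E\<close>.\<close>
  define Y where "Y E = {y \<in> lists (U \<times> L). E \<subseteq> fst ` set y}" for E
  define k where "k F f = average (enums F) (\<lambda>xs. label_mean mV xs f)" for F :: "'x set" and f
  define mY where "mY f = M (\<lambda>F. k F f)" for f
  have lab: "mean_on {y \<in> lists (U \<times> L). map fst y = xs} (label_mean mV xs)" if "set xs \<subseteq> U" for xs
    by (rule mean_on_mono_set[OF mean_on_label_mean[OF mmV]]) (use that in force)
  have k: "mean_on (Y E) (k F)" if "F \<in> {F \<in> Fpow U. E \<subseteq> F}" for E F
    unfolding k_def
  proof (rule mean_on_bind[OF mean_on_average[OF _ _ subset_refl]])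
    show "finite (enums F)" "enums F \<noteq> {}" using that by (simp_all add: Fpow_def enums_finite)
    fix xs assume xs: "xs \<in> enums F"
    have "set xs \<subseteq> U" using that xs by (simp add: Fpow_def enums_def)
    then show "mean_on (Y E) (label_mean mV xs)"
    proof (rule mean_on_mono_set[OF lab], intro subsetI)
      fix y assume y: "y \<in> {y \<in> lists (U \<times> L). map fst y = xs}"
      then have "fst ` set y = F" using xs by (auto simp: enums_def simp flip: set_map)
      then show "y \<in> Y E" using y that by (simp add: Y_def)
    qed
  qed
  have mY: "mean_on (Y E) mY" if "finite E" "E \<subseteq> U" for E
    unfolding mY_def by (rule mean_on_bind[OF M[OF that] k])
  \<comment> \<open>The labels absorb the cocycle by invariance of \<open>mV\<close>, and the
    invariance of \<open>M\<close> takes care of the motion of the points.\<close>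
  have mY_inv: "mY (\<lambda>y. f (map (lift g) y)) = mY f" if g: "g \<in> A" and f: "bounded (f ` Y {})" for g f
  proof -
    have kf: "bounded ((\<lambda>F. k F f) ` Fpow U)"
      by (rule bounded_image_mean[OF _ f]) (rule k, simp)
    have img: "\<alpha> g ` F \<in> Fpow U" if "F \<in> Fpow U" for F
      using that g by (auto simp: Fpow_def act_closed)
    have "M (\<lambda>F. k F (\<lambda>y. f (map (lift g) y))) = M (\<lambda>F. k (\<alpha> g ` F) f)"
    proof (rule mean_on_cong[OF M[of "{}"]])
      show "bounded ((\<lambda>F. k (\<alpha> g ` F) f) ` {F \<in> Fpow U. {} \<subseteq> F})"
        by (rule bounded_subset[OF kf]) (use img in auto)
      fix F assume "F \<in> {F \<in> Fpow U. {} \<subseteq> F}"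
      then have F: "finite F" "F \<subseteq> U" by (auto simp: Fpow_def)
      have inj: "inj_on (\<alpha> g) F" using inj_on_subset[OF act_inj[OF g] F(2)] .
      then have inj': "inj_on (map (\<alpha> g)) (enums F)"
        by (auto simp: enums_def inj_on_def intro: map_inj_on)
      have "k (\<alpha> g ` F) f = average (enums F) (\<lambda>xs. label_mean mV (map (\<alpha> g) xs) f)"
        unfolding k_def enums_image[OF inj] by (rule average_reindex[OF inj'])
      also have "\<dots> = average (enums F) (\<lambda>xs. label_mean mV xs (\<lambda>y. f (map (lift g) y)))"
        unfolding average_def
      proof (rule arg_cong2[where f = "(/)"], rule sum.cong[OF refl])
        fix xs assume "xs \<in> enums F"
        then have xs: "set xs \<subseteq> U" using F by (simp add: enums_def)
        show "label_mean mV (map (\<alpha> g) xs) f = label_mean mV xs (\<lambda>y. f (map (lift g) y))"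
          unfolding lift_def
        proof (rule label_mean_shift[OF mV])
          have "{y \<in> lists (UNIV \<times> L). map fst y = map (\<alpha> g) xs} \<subseteq> Y {}"
          proof
            fix y assume y: "y \<in> {y \<in> lists (UNIV \<times> L). map fst y = map (\<alpha> g) xs}"
            then have "fst ` set y = \<alpha> g ` set xs" by (metis (mono_tags) mem_Collect_eq set_map)
            then have "fst ` set y \<subseteq> U" using xs g by (auto simp: act_closed)
            then show "y \<in> Y {}" using y by (auto simp: Y_def in_lists_conv_set)
          qed
          then show "bounded (f ` {y \<in> lists (UNIV \<times> L). map fst y = map (\<alpha> g) xs})"
            by (rule bounded_subset[OF f image_mono])
        qed (use xs g b_closed in auto)
      qed simp
      finally show "k F (\<lambda>y. f (map (lift g) y)) = k (\<alpha> g ` F) f" by (simp add: k_def)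
    qed auto
    also have "\<dots> = M (\<lambda>F. k F f)"
    proof -
      obtain \<epsilon> where "\<epsilon> \<longlonglongrightarrow> 0"
        "\<And>n Q. finite Q \<Longrightarrow> Q \<subseteq> U \<Longrightarrow> (\<Sum>x\<in>Q. (a n (\<alpha> g x) - a n x)\<^sup>2) \<le> \<epsilon> n"
        using energy[OF g] by blast
      then show ?thesis by (rule Minv[OF act_bij[OF g] _ _ kf])
    qed
    finally show ?thesis by (simp add: mY_def)
  qed
  define rep where "rep y = (SOME z. z \<in> lists (U \<times> L) \<and> (\<exists>g. equi z y g))" for y
  define t where "t y = (SOME g. equi (rep y) y g)" for y
  have rep: "rep y \<in> lists (U \<times> L)" "equi (rep y) y (t y)" if y: "y \<in> lists (U \<times> L)" for y
  proof -
    have "equi y y \<one>" using y by (auto simp: equi_def lift_one b_one)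
    then have "\<exists>z. z \<in> lists (U \<times> L) \<and> (\<exists>g. equi z y g)" using y by blast
    from someI_ex[OF this] have r: "rep y \<in> lists (U \<times> L)" "\<exists>g. equi (rep y) y g"
      by (auto simp: rep_def)
    then show "rep y \<in> lists (U \<times> L)" "equi (rep y) y (t y)"
      unfolding t_def by (auto intro: someI_ex)
  qed
  have rep_eq: "rep y = rep y'" if y: "y \<in> lists (U \<times> L)" and e: "equi y y' g" for y y' g
  proof -
    have y': "y' \<in> lists (U \<times> L)" using y e lift_closed by (simp add: equi_def)
    have eq: "(\<exists>g. equi z y g) \<longleftrightarrow> (\<exists>g. equi z y' g)" if "z \<in> lists (U \<times> L)" for z
    proof (intro iffI; elim exE)
      fix h assume "equi z y h"
      from equi_trans[OF that this e] show "\<exists>g. equi z y' g" by (rule exI)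
    next
      fix h assume "equi z y' h"
      from equi_trans[OF that this equi_sym[OF y e]] show "\<exists>g. equi z y g" by (rule exI)
    qed
    \<comment> \<open>The choice operator sees \<open>y\<close> only through this predicate, so
      equivalent lists get the same representative.\<close>
    have "(\<lambda>z. z \<in> lists (U \<times> L) \<and> (\<exists>g. equi z y g)) =
        (\<lambda>z. z \<in> lists (U \<times> L) \<and> (\<exists>g. equi z y' g))"
      by (intro ext conj_cong refl eq)
    then show ?thesis by (simp only: rep_def)
  qed
  have tA: "t y \<in> A" if "y \<in> lists (U \<times> L)" for y using rep[OF that] by (simp add: equi_def)
  \<comment> \<open>The average of \<open>f\<close> over the coset of the kernel through
    \<open>t y\<close>; by invariance of \<open>mH\<close> the choice of \<open>t y\<close> within
    this coset does not affect it on bounded functions.\<close>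
  define \<Psi> where "\<Psi> f y = mH (\<lambda>h. f (t y \<otimes> h))" for f :: "'g \<Rightarrow> real" and y
  have \<Psi>: "mean_on A (\<lambda>f. \<Psi> f y)" if "y \<in> Y E" for y E
    unfolding \<Psi>_def by (rule mean_on_map[OF mmH]) (use that tA in \<open>auto simp: Y_def\<close>)
  define m where "m f = mY (\<Psi> f)" for f
  have "mean_on A m"
    unfolding m_def using mean_on_bind[OF mY[of "{}"] \<Psi>] by simp
  moreover have "m (\<lambda>x. f (s \<otimes> x)) = m f" if s: "s \<in> A" and f: "bounded (f ` A)" for s f
  proof -
    \<comment> \<open>Concentration on supersets enters here: only lists containing the support of
      \<open>b s\<close> count, and for these \<open>s\<close> is an arrow from \<open>y\<close> to
      its image.\<close>
    let ?E = "{x \<in> U. b s x \<noteq> \<one>\<^bsub>V\<^esub>}"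
    have b\<Psi>: "bounded (\<Psi> f ` Y {})"
      by (rule bounded_image_mean[where k = "\<lambda>y f. \<Psi> f y", OF \<Psi> f])
    have "mY (\<Psi> (\<lambda>x. f (s \<otimes> x))) = mY (\<lambda>y. \<Psi> f (map (lift s) y))"
    proof (rule mean_on_cong[OF mY[of ?E]])
      show "bounded ((\<lambda>y. \<Psi> f (map (lift s) y)) ` Y ?E)"
        by (rule bounded_subset[OF b\<Psi>]) (use lift_closed[OF s] in \<open>auto simp: Y_def\<close>)
      fix y assume "y \<in> Y ?E"
      then have y: "y \<in> lists (U \<times> L)" and Ey: "?E \<subseteq> fst ` set y" by (auto simp: Y_def)
      let ?z = "map (lift s) y"
      have z: "?z \<in> lists (U \<times> L)" using lift_closed[OF s y] .
      have e: "equi y ?z s" using s Ey by (auto simp: equi_def)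
      \<comment> \<open>The defect of \<open>t\<close> along \<open>s\<close>. It stabilizes the
        common representative, hence lies in the kernel and is absorbed by
        \<open>mH\<close>.\<close>
      let ?u = "inv (t ?z) \<otimes> (s \<otimes> t y)"
      note r = rep[OF y] rep[OF z]
      have "equi (rep y) (rep y) ?u"
        using equi_trans[OF r(1) equi_trans[OF r(1) r(2) e] equi_sym[OF r(3) r(4), unfolded rep_eq[OF y e, symmetric]]]
          rep_eq[OF y e] by simp
      then have u: "?u \<in> ?H" by (rule equi_stabilizer[OF r(1)])
      have tc: "t y \<in> A" "t ?z \<in> A" using tA y z by auto
      have bd: "bounded ((\<lambda>h. f (t ?z \<otimes> h)) ` ?H)"
        by (rule bounded_subset[OF f]) (use tc in auto)
      have "\<Psi> (\<lambda>x. f (s \<otimes> x)) y = mH (\<lambda>h. f (t ?z \<otimes> (?u \<otimes> h)))"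
        unfolding \<Psi>_def
      proof (rule mean_on_cong[OF mmH])
        show "bounded ((\<lambda>h. f (t ?z \<otimes> (?u \<otimes> h))) ` ?H)"
          by (rule bounded_subset[OF f]) (use tc s in auto)
        fix h assume "h \<in> ?H"
        then show "f (s \<otimes> (t y \<otimes> h)) = f (t ?z \<otimes> (?u \<otimes> h))"
          using tc s by (simp add: m_assoc[symmetric])
      qed
      also have "\<dots> = \<Psi> f ?z"
        unfolding \<Psi>_def by (rule mH[unfolded mean_inv_def, THEN conjunct2, rule_format, OF u bd])
      finally show "\<Psi> (\<lambda>x. f (s \<otimes> x)) y = \<Psi> f ?z" .
    qed (use b_finite[OF s] in auto)
    also have "\<dots> = mY (\<Psi> f)" by (rule mY_inv[OF s b\<Psi>])
    finally show ?thesis by (simp add: m_def)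
  qed
  ultimately show ?thesis unfolding mean_inv_def by blast
qed

end

section \<open>The action on infinite words\<close>

text \<open>The prefix is given by an infinite word of which the first \<open>n\<close> letters are
  used, so that a point can serve as its own prefix.\<close>

definition pre :: "(nat \<Rightarrow> nat) \<Rightarrow> nat \<Rightarrow> (nat \<Rightarrow> nat) \<Rightarrow> nat \<Rightarrow> nat" where
  "pre x n y = (\<lambda>k. if k < n then x k else y (k - n))"

lemma pre_0 [simp]: "pre x 0 y = y"
  by (simp add: pre_def)

lemma pre_Suc: "pre x (Suc n) y = case_nat (x 0) (pre (\<lambda>k. x (Suc k)) n y)"
  by (auto simp: pre_def fun_eq_iff split: nat.splits)

lemma pre_case_nat: "pre w k (case_nat z y) = pre (\<lambda>j. if j < k then w j else z) (Suc k) y"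
proof
  fix n
  consider "n < k" | "n = k" | m where "n = Suc (k + m)"
    using less_imp_Suc_add[of k n] by (metis nat_neq_iff)
  then show "pre w k (case_nat z y) n = pre (\<lambda>j. if j < k then w j else z) (Suc k) y n"
    by cases (auto simp: pre_def)
qed

lemma pre_cong: "(\<And>k. k < n \<Longrightarrow> x k = x' k) \<Longrightarrow> pre x n y = pre x' n y"
  by (auto simp: pre_def)

lemma pre_pre: "pre (pre x n y) (n + m) z = pre x n (pre y m z)"
  by (auto simp: pre_def fun_eq_iff)

lemma pre_tail: "pre x n (\<lambda>k. x (k + n)) = x"
  by (auto simp: pre_def)

lemma pre_inject: "pre x n y = pre x' n y' \<Longrightarrow> y = y'"
  by (auto simp: pre_def fun_eq_iff) (metis add_diff_cancel_right' not_add_less2)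

text \<open>\<open>gen i\<close> with \<open>i < d\<close> acts on the rest of a word exactly when
  the image letter is \<open>d - i\<close>. This identifies the only input letter for which that
  happens, namely \<open>d - i - 1\<close>.\<close>

lemma cycle_upt:
  "cycle_of_list [0..<Suc (Suc a)] z = Suc a \<longleftrightarrow> z = a"
proof -
  let ?c = "[0..<Suc (Suc a)]"
  have "map (cycle_of_list ?c) ?c ! a = rotate1 ?c ! a"
    using cyclic_rotation[of ?c 1] by (simp del: upt_Suc)
  then have "cycle_of_list ?c a = Suc a"
    by (simp add: nth_rotate1 del: upt_Suc)
  moreover have "inj (cycle_of_list ?c)"
    using cycle_permutes permutes_inj by blast
  ultimately show ?thesis by (metis injD)
qed

locale mother =
  fixes d :: nat
  assumes d: "2 \<le> d"
begin

abbreviation "W \<equiv> tree_words d"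
abbreviation "T_aut \<equiv> Aut_tree d"
abbreviation "gen \<equiv> mother_gen d"
definition "\<Sigma> = {x :: nat \<Rightarrow> nat. \<forall>n. x n < d}"

text \<open>The letter at position \<open>n\<close> is read off the image of the prefix of length
  \<open>n + 1\<close>; this is consistent because automorphisms preserve lengths and prefixes
  (\<open>aut_prefix\<close>).\<close>

definition act :: "(nat list \<Rightarrow> nat list) \<Rightarrow> (nat \<Rightarrow> nat) \<Rightarrow> nat \<Rightarrow> nat" where
  "act f x n = f (map x [0..<Suc n]) ! n"

sublocale group T_aut by (rule group_Aut_tree)

lemma word_mem: "x \<in> \<Sigma> \<Longrightarrow> map x [0..<n] \<in> W"
  by (auto simp: \<Sigma>_def tree_words_def)

lemma aut_closed: "f \<in> carrier T_aut \<Longrightarrow> u \<in> W \<Longrightarrow> f u \<in> W"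
  using Bij_imp_funcset by (fastforce simp: Aut_tree_def tree_auts_def)

lemma aut_inj: "f \<in> carrier T_aut \<Longrightarrow> u \<in> W \<Longrightarrow> v \<in> W \<Longrightarrow> f u = f v \<Longrightarrow> u = v"
  by (auto simp: Aut_tree_def tree_auts_def Bij_def bij_betw_def inj_on_def)

lemma aut_adj: "f \<in> carrier T_aut \<Longrightarrow> u \<in> W \<Longrightarrow> v \<in> W \<Longrightarrow>
    tree_adj d (f u) (f v) \<longleftrightarrow> tree_adj d u v"
  by (auto simp: Aut_tree_def tree_auts_def)

lemma aut_Nil: "f \<in> carrier T_aut \<Longrightarrow> f [] = []"
  by (auto simp: Aut_tree_def tree_auts_def)

text \<open>The image of a child is adjacent to the image of its parent. It cannot lie above it,
  since the vertex there is already the image of the grandparent.\<close>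

lemma aut_snoc:
  assumes f: "f \<in> carrier T_aut" and u: "u @ [k] \<in> W"
  shows "\<exists>k'. f (u @ [k]) = f u @ [k']"
  using u
proof (induction u arbitrary: k rule: rev_induct)
  case Nil
  have "tree_adj d (f [k]) (f [])"
    using Nil by (subst aut_adj[OF f]) (auto simp: tree_adj_def)
  then show ?case by (auto simp: tree_adj_def aut_Nil[OF f])
next
  case (snoc l u)
  obtain l' where l': "f (u @ [l]) = f u @ [l']" using snoc by fastforce
  have "tree_adj d (u @ [l]) (u @ [l, k])"
    using snoc.prems by (auto simp: tree_adj_def)
  then have "tree_adj d (f (u @ [l])) (f (u @ [l, k]))"
    using snoc.prems by (subst aut_adj[OF f]) auto
  moreover have "f (u @ [l, k]) \<noteq> f u"
    using aut_inj[OF f, of "u @ [l, k]" u] snoc.prems by auto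
  ultimately show ?case using l' by (auto simp: tree_adj_def)
qed

lemma aut_length: "f \<in> carrier T_aut \<Longrightarrow> u \<in> W \<Longrightarrow> length (f u) = length u"
proof (induction u rule: rev_induct)
  case Nil
  then show ?case by (simp add: Aut_tree_def tree_auts_def)
next
  case (snoc k u)
  then show ?case using aut_snoc[of f u k] by auto
qed

lemma aut_prefix:
  assumes f: "f \<in> carrier T_aut" and x: "x \<in> \<Sigma>"
  shows "f (map x [0..<n]) = map (act f x) [0..<n]"
proof (induction n)
  case 0
  then show ?case using f by (simp add: Aut_tree_def tree_auts_def)
next
  case (Suc n)
  obtain k where k: "f (map x [0..<Suc n]) = f (map x [0..<n]) @ [k]"
    using aut_snoc[OF f, of "map x [0..<n]" "x n"] word_mem[OF x, of "Suc n"] by auto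
  have "k = act f x n"
    unfolding act_def k using aut_length[OF f word_mem[OF x], of n] by (simp add: nth_append)
  then show ?case using k Suc by simp
qed

lemma act_closed:
  assumes f: "f \<in> carrier T_aut" and x: "x \<in> \<Sigma>"
  shows "act f x \<in> \<Sigma>"
proof -
  have "map (act f x) [0..<Suc n] \<in> W" for n
    using aut_closed[OF f word_mem[OF x, of "Suc n"]] aut_prefix[OF f x, of "Suc n"] by simp
  then show ?thesis by (simp add: \<Sigma>_def)
qed

lemma mult_apply: "f \<in> carrier T_aut \<Longrightarrow> g \<in> carrier T_aut \<Longrightarrow> u \<in> W \<Longrightarrow>
    (f \<otimes>\<^bsub>T_aut\<^esub> g) u = f (g u)"
  by (simp add: Aut_tree_def BijGroup_def tree_auts_def compose_eq)

lemma act_mult: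
  assumes "f \<in> carrier T_aut" "g \<in> carrier T_aut" "x \<in> \<Sigma>"
  shows "act (f \<otimes>\<^bsub>T_aut\<^esub> g) x = act f (act g x)"
proof
  fix n
  have "act (f \<otimes>\<^bsub>T_aut\<^esub> g) x n = f (g (map x [0..<Suc n])) ! n"
    unfolding act_def using assms word_mem[of x "Suc n"] by (subst mult_apply) auto
  then show "act (f \<otimes>\<^bsub>T_aut\<^esub> g) x n = act f (act g x) n"
    using aut_prefix[OF assms(2,3), of "Suc n"] by (simp only: act_def[of f])
qed

lemma act_one: "x \<in> \<Sigma> \<Longrightarrow> act \<one>\<^bsub>T_aut\<^esub> x = x"
  using word_mem[of x] by (auto simp: act_def Aut_tree_def BijGroup_def nth_append simp del: upt_Suc)

lemma act_inv:
  assumes "f \<in> carrier T_aut" "x \<in> \<Sigma>"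
  shows "act (inv\<^bsub>T_aut\<^esub> f) (act f x) = x" "act f (act (inv\<^bsub>T_aut\<^esub> f) x) = x"
  using act_mult[of "inv\<^bsub>T_aut\<^esub> f" f x] act_mult[of f "inv\<^bsub>T_aut\<^esub> f" x] assms
  by (simp_all add: act_one)

lemma act_faithful:
  assumes fg: "f \<in> carrier T_aut" "g \<in> carrier T_aut" and eq: "\<And>x. x \<in> \<Sigma> \<Longrightarrow> act f x = act g x"
  shows "f = g"
proof -
  have "f \<in> extensional W" "g \<in> extensional W"
    using fg by (auto simp: Aut_tree_def tree_auts_def Bij_def)
  then show ?thesis
  proof (rule extensionalityI)
    fix u assume u: "u \<in> W"
    define x where "x k = (if k < length u then u ! k else 0)" for k
    have x: "x \<in> \<Sigma>"
      using u d by (auto simp: x_def \<Sigma>_def tree_words_def in_lists_conv_set)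
    have "u = map x [0..<length u]" by (rule nth_equalityI) (auto simp: x_def)
    then show "f u = g u" using aut_prefix[OF fg(1) x] aut_prefix[OF fg(2) x] eq[OF x] by metis
  qed
qed

lemma case_nat_mem [simp]: "case_nat z y \<in> \<Sigma> \<longleftrightarrow> z < d \<and> y \<in> \<Sigma>"
  by (auto simp: \<Sigma>_def split: nat.splits)

lemma pre_mem: "x \<in> \<Sigma> \<Longrightarrow> y \<in> \<Sigma> \<Longrightarrow> pre x n y \<in> \<Sigma>"
  by (auto simp: \<Sigma>_def pre_def)

lemma const_mem [simp]: "(\<lambda>_. a) \<in> \<Sigma> \<longleftrightarrow> a < d"
  by (auto simp: \<Sigma>_def)

lemma gen_mem: "1 \<le> i \<Longrightarrow> i \<le> d \<Longrightarrow> gen i \<in> carrier T_aut"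
  using mother_gen_in_Aut_tree by auto

lemma act_gen: "x \<in> \<Sigma> \<Longrightarrow> act (gen i) x n = mother_act d i (map x [0..<Suc n]) ! n"
  unfolding act_def mother_gen_def using word_mem[of x "Suc n"] by simp

lemma map_case_nat: "map (case_nat z y) [0..<Suc n] = z # map y [0..<n]"
  by (simp add: upt_conv_Cons map_Suc_upt[symmetric] del: upt_Suc)

lemma act_gen_Cons:
  assumes "i < d" "z < d" "y \<in> \<Sigma>"
  shows "act (gen i) (case_nat z y) = case_nat (cycle_of_list [0..<Suc (d - i)] z)
    (if cycle_of_list [0..<Suc (d - i)] z = d - i then act (gen i) y else y)"
proof
  fix n
  show "act (gen i) (case_nat z y) n = case_nat (cycle_of_list [0..<Suc (d - i)] z)
    (if cycle_of_list [0..<Suc (d - i)] z = d - i then act (gen i) y else y) n"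
    using assms by (cases n) (auto simp: act_gen map_case_nat Let_def simp del: upt_Suc)
qed

lemma act_last_Cons:
  assumes "z < d" "y \<in> \<Sigma>"
  shows "act (gen d) (case_nat z y) = case_nat z (act (gen (Suc z)) y)"
proof
  fix n
  show "act (gen d) (case_nat z y) n = case_nat z (act (gen (Suc z)) y) n"
    using assms by (cases n) (auto simp: act_gen map_case_nat simp del: upt_Suc)
qed

text \<open>\<open>Suc a + i = d\<close> encodes \<open>a = d - i - 1\<close> without truncated
  subtraction. On a run of this letter the recursion of \<open>gen i\<close> never stops.\<close>

lemma act_gen_run:
  assumes i: "Suc a + i = d" "1 \<le> i" and y: "y \<in> \<Sigma>"
  shows "act (gen i) (pre (\<lambda>_. a) k y) = pre (\<lambda>_. Suc a) k (act (gen i) y)"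
proof (induction k)
  case (Suc k)
  have c: "cycle_of_list [0..<Suc (d - i)] a = d - i"
    using cycle_upt[of a a] i by (simp flip: i(1) del: upt_Suc)
  have "pre (\<lambda>_. a) k y \<in> \<Sigma>" using i y by (intro pre_mem) auto
  then show ?case
    unfolding pre_Suc using i c Suc by (subst act_gen_Cons) auto
qed simp

text \<open>The coordinate of \<open>gen d\<close> at the letter \<open>d - 1\<close> is
  \<open>gen d\<close> itself.\<close>

lemma act_last_run:
  assumes y: "y \<in> \<Sigma>"
  shows "act (gen d) (pre (\<lambda>_. d - 1) k y) = pre (\<lambda>_. d - 1) k (act (gen d) y)"
proof (induction k)
  case (Suc k)
  have "pre (\<lambda>_. d - 1) k y \<in> \<Sigma>" using d y by (intro pre_mem) auto
  then show ?case unfolding pre_Suc using d Suc by (subst act_last_Cons) auto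
qed simp

lemma act_gen_const:
  assumes i: "Suc a + i = d" "1 \<le> i"
  shows "act (gen i) (\<lambda>_. a) = (\<lambda>_. Suc a)"
proof
  fix n
  have "pre (\<lambda>_. a) (Suc n) (\<lambda>_. a) = (\<lambda>_. a)" by (simp add: pre_def)
  then show "act (gen i) (\<lambda>_. a) n = Suc a"
    using act_gen_run[OF i, of "\<lambda>_. a" "Suc n"] i by (simp add: pre_def fun_eq_iff)
qed

lemma act_last_const: "act (gen d) (\<lambda>_. d - 1) = (\<lambda>_. d - 1)"
proof
  fix n
  have "pre (\<lambda>_. d - 1) (Suc n) (\<lambda>_. d - 1) = (\<lambda>_. d - 1)" by (simp add: pre_def)
  then show "act (gen d) (\<lambda>_. d - 1) n = d - 1"
    using act_last_run[of "\<lambda>_. d - 1" "Suc n"] d by (simp add: pre_def fun_eq_iff)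
qed

text \<open>The first letter other than \<open>a\<close> stops the recursion. As \<open>z'\<close>
  is chosen before \<open>k\<close> and the remaining word, \<open>gen i\<close> has trivial germs
  at such words.\<close>

lemma act_gen_break:
  assumes i: "Suc a + i = d" "1 \<le> i" and z: "z < d" "z \<noteq> a" and y: "y \<in> \<Sigma>"
  obtains z' where "z' < d" "z' \<noteq> Suc a"
    "\<And>k y. y \<in> \<Sigma> \<Longrightarrow> act (gen i) (pre (\<lambda>_. a) k (case_nat z y)) = pre (\<lambda>_. Suc a) k (case_nat z' y)"
proof
  let ?z = "cycle_of_list [0..<Suc (d - i)] z"
  have di: "d - i = Suc a" using i by simp
  show ne: "?z \<noteq> Suc a" using cycle_upt[of a z] z di by (simp del: upt_Suc)
  show "?z < d" using cycle_lt[of "Suc (d - i)" d z] i z by simp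
  show "act (gen i) (pre (\<lambda>_. a) k (case_nat z y)) = pre (\<lambda>_. Suc a) k (case_nat ?z y)"
    if "y \<in> \<Sigma>" for k y
    using act_gen_run[OF i, of "case_nat z y"] act_gen_Cons[of i z y] ne di i z that by (simp del: upt_Suc)
qed

lemma act_last_break:
  assumes z: "z < d" and y: "y \<in> \<Sigma>"
  shows "act (gen d) (pre (\<lambda>_. d - 1) k (case_nat z y)) =
    pre (\<lambda>_. d - 1) k (case_nat z (act (gen (Suc z)) y))"
  using act_last_run[of "case_nat z y"] act_last_Cons[OF z y] z y by simp

lemma first_break:
  assumes x: "x \<in> \<Sigma>" "x \<noteq> (\<lambda>_. a)"
  obtains k z y where "z < d" "z \<noteq> a" "y \<in> \<Sigma>" "x = pre (\<lambda>_. a) k (case_nat z y)"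
proof -
  obtain n where "x n \<noteq> a" using x by auto
  define k where "k = (LEAST n. x n \<noteq> a)"
  have k: "x k \<noteq> a" unfolding k_def by (rule LeastI) fact
  have l: "x j = a" if "j < k" for j using not_less_Least[of j "\<lambda>n. x n \<noteq> a"] that by (auto simp: k_def)
  have "x = pre (\<lambda>_. a) k (case_nat (x k) (\<lambda>j. x (Suc (j + k))))"
  proof
    fix j show "x j = pre (\<lambda>_. a) k (case_nat (x k) (\<lambda>j. x (Suc (j + k)))) j"
      using l[of j] by (cases "j - k") (auto simp: pre_def intro!: arg_cong[where f = x])
  qed
  moreover have "(\<lambda>j. x (Suc (j + k))) \<in> \<Sigma>" "x k < d" using x by (auto simp: \<Sigma>_def)
  ultimately show thesis using that k by blast
qed

end

section \<open>Germs\<close>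

definition tail_const :: "(nat \<Rightarrow> nat) \<Rightarrow> nat \<Rightarrow> bool" where
  "tail_const x j \<longleftrightarrow> (\<forall>\<^sub>F k in sequentially. x k = j)"

lemma tail_const_unique: "tail_const x i \<Longrightarrow> tail_const x j \<Longrightarrow> i = j"
  using eventually_happens[OF eventually_conj] unfolding tail_const_def by fastforce

lemma tail_const_pre [simp]: "tail_const (pre w n y) = tail_const y"
proof
  fix j
  have "tail_const (pre w n y) j \<longleftrightarrow> (\<forall>\<^sub>F k in sequentially. pre w n y (k + n) = j)"
    unfolding tail_const_def using eventually_sequentially_seg[of "\<lambda>k. pre w n y k = j" n] by simp
  then show "tail_const (pre w n y) j \<longleftrightarrow> tail_const y j" by (simp add: pre_def tail_const_def)
qed

lemma tail_const_const [simp]: "tail_const (\<lambda>_. i) = (=) i"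
  by (simp add: tail_const_def fun_eq_iff)

lemma tail_const_case_nat [simp]: "tail_const (case_nat z y) = tail_const y"
  using tail_const_pre[of "\<lambda>_. z" "Suc 0" y] pre_case_nat[of undefined 0 z y] by simp

text \<open>The junk value \<open>0\<close> at words without a constant tail makes \<open>path (tail x)\<close> trivial there.\<close>

definition tail :: "(nat \<Rightarrow> nat) \<Rightarrow> nat" where
  "tail x = (if \<exists>j. tail_const x j then THE j. tail_const x j else 0)"

lemma tail_pre [simp]: "tail (pre w n y) = tail y"
  by (simp add: tail_def)

lemma tail_case_nat [simp]: "tail (case_nat z y) = tail y"
  by (simp add: tail_def)

lemma tail_eq: "tail_const x j \<Longrightarrow> tail x = j"
  unfolding tail_def by (auto intro: the_equality tail_const_unique)

lemma tail_const [simp]: "tail (\<lambda>_. j) = j"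
  by (simp add: tail_eq)

context mother
begin

definition "C = {x \<in> \<Sigma>. \<exists>j. tail_const x j}"

lemma C_tail: "x \<in> C \<Longrightarrow> tail_const x (tail x)"
  using tail_eq by (auto simp: C_def)

lemma tail_less: assumes "x \<in> \<Sigma>" shows "tail x < d"
proof (cases "\<exists>j. tail_const x j")
  case True
  then have "tail_const x (tail x)" using C_tail assms by (simp add: C_def)
  then obtain k where "x k = tail x" unfolding tail_const_def eventually_sequentially by blast
  then show ?thesis using assms by (auto simp: \<Sigma>_def) (metis)
qed (use d in \<open>simp add: tail_def\<close>)

text \<open>In the language of self-similar groups, \<open>s\<close> is the section of
  \<open>g\<close> at the prefix of length \<open>n\<close> of \<open>x\<close>.\<close>

definition germ_at :: "(nat list \<Rightarrow> nat list) \<Rightarrow> (nat list \<Rightarrow> nat list) \<Rightarrow> (nat \<Rightarrow> nat) \<Rightarrow> nat \<Rightarrow> bool" where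
  "germ_at g s x n \<longleftrightarrow> (\<forall>y\<in>\<Sigma>. act g (pre x n y) = pre (act g x) n (act s y))"

text \<open>A germ is represented by a section that no longer changes along
  \<open>x\<close>.\<close>

definition germ :: "(nat list \<Rightarrow> nat list) \<Rightarrow> (nat list \<Rightarrow> nat list) \<Rightarrow> (nat \<Rightarrow> nat) \<Rightarrow> bool" where
  "germ g s x \<longleftrightarrow> (\<forall>\<^sub>F n in sequentially. germ_at g s x n)"

lemma germ_unique:
  assumes "germ g s x" "germ g r x" "s \<in> carrier T_aut" "r \<in> carrier T_aut"
  shows "s = r"
proof -
  obtain n where n: "germ_at g s x n" "germ_at g r x n"
    using eventually_happens[OF eventually_conj[OF assms(1,2)[unfolded germ_def]]] by auto
  show ?thesis
  proof (rule act_faithful[OF assms(3,4)])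
    fix y assume "y \<in> \<Sigma>"
    then have "pre (act g x) n (act s y) = pre (act g x) n (act r y)"
      using n by (simp add: germ_at_def)
    then show "act s y = act r y" by (rule pre_inject)
  qed
qed

lemma germ_mult:
  assumes c: "g \<in> carrier T_aut" "h \<in> carrier T_aut" "r \<in> carrier T_aut" "s \<in> carrier T_aut" "x \<in> \<Sigma>"
    and h: "germ h s x" and g: "germ g r (act h x)"
  shows "germ (g \<otimes>\<^bsub>T_aut\<^esub> h) (r \<otimes>\<^bsub>T_aut\<^esub> s) x"
  unfolding germ_def
proof (rule eventually_mono[OF eventually_conj[OF h[unfolded germ_def] g[unfolded germ_def]]])
  fix n assume "germ_at h s x n \<and> germ_at g r (act h x) n"
  then show "germ_at (g \<otimes>\<^bsub>T_aut\<^esub> h) (r \<otimes>\<^bsub>T_aut\<^esub> s) x n"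
    using c by (simp add: germ_at_def act_mult pre_mem act_closed)
qed

lemma germ_inv:
  assumes c: "g \<in> carrier T_aut" "s \<in> carrier T_aut" "x \<in> \<Sigma>" and g: "germ g s x"
  shows "germ (inv\<^bsub>T_aut\<^esub> g) (inv\<^bsub>T_aut\<^esub> s) (act g x)"
  unfolding germ_def
proof (rule eventually_mono[OF g[unfolded germ_def]])
  fix n assume n: "germ_at g s x n"
  show "germ_at (inv\<^bsub>T_aut\<^esub> g) (inv\<^bsub>T_aut\<^esub> s) (act g x) n"
    unfolding germ_at_def
  proof
    fix y assume y: "y \<in> \<Sigma>"
    let ?y = "act (inv\<^bsub>T_aut\<^esub> s) y"
    have y': "?y \<in> \<Sigma>" using c y by (simp add: act_closed)
    then have "act g (pre x n ?y) = pre (act g x) n y"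
      using n c y by (simp add: germ_at_def act_inv)
    then show "act (inv\<^bsub>T_aut\<^esub> g) (pre (act g x) n y) = pre (act (inv\<^bsub>T_aut\<^esub> g) (act g x)) n ?y"
      using act_inv(1)[OF c(1) pre_mem[OF c(3) y', of n]] c by (simp add: act_inv)
  qed
qed

lemma germ_one: "x \<in> \<Sigma> \<Longrightarrow> germ \<one>\<^bsub>T_aut\<^esub> \<one>\<^bsub>T_aut\<^esub> x"
  by (simp add: germ_def germ_at_def act_one pre_mem)

lemma germ_pre:
  assumes y: "y \<in> \<Sigma>" and g: "\<And>z. z \<in> \<Sigma> \<Longrightarrow> act g (pre w k z) = pre w' k (act s z)" and s: "germ s t y"
  shows "germ g t (pre w k y)"
proof -
  have "germ_at g t (pre w k y) (k + n)" if "germ_at s t y n" for n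
    using that y g by (simp add: germ_at_def pre_pre pre_mem)
  then have "\<forall>\<^sub>F n in sequentially. germ_at g t (pre w k y) (n + k)"
    by (intro eventually_mono[OF s[unfolded germ_def]]) (simp add: add.commute)
  then show ?thesis
    unfolding germ_def using eventually_sequentially_seg[of "germ_at g t (pre w k y)" k] by simp
qed

text \<open>The product \<open>path j\<close> has germs leading from the tail \<open>000\<dots>\<close> to the tail \<open>jjj\<dots>\<close>.\<close>

primrec path :: "nat \<Rightarrow> nat list \<Rightarrow> nat list" where
  "path 0 = \<one>\<^bsub>T_aut\<^esub>"
| "path (Suc a) = gen (d - Suc a) \<otimes>\<^bsub>T_aut\<^esub> path a"

lemma path_mem: "a < d \<Longrightarrow> path a \<in> carrier T_aut"
  by (induction a) (auto simp: gen_mem)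

text \<open>\<open>gen d\<close> fixes the constant word \<open>d - 1\<close>; conjugation by
  \<open>path (d - 1)\<close> moves this loop of germs to the base point
  \<open>000...\<close>.\<close>

definition "loop = inv\<^bsub>T_aut\<^esub> (path (d - 1)) \<otimes>\<^bsub>T_aut\<^esub> gen d \<otimes>\<^bsub>T_aut\<^esub> path (d - 1)"

lemma loop_mem: "loop \<in> carrier T_aut"
  using d by (simp add: loop_def path_mem gen_mem)

abbreviation "loops \<equiv> generate T_aut {loop}"

lemma loops_subgroup: "subgroup loops T_aut"
  by (rule generate_is_subgroup) (simp add: loop_mem)

text \<open>The germ from the tail of \<open>x\<close> to the tail of \<open>y\<close> that winds along \<open>c\<close> at \<open>000\<dots>\<close>.\<close>

definition tr :: "(nat list \<Rightarrow> nat list) \<Rightarrow> (nat \<Rightarrow> nat) \<Rightarrow> (nat \<Rightarrow> nat) \<Rightarrow> nat list \<Rightarrow> nat list" where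
  "tr c y x = path (tail y) \<otimes>\<^bsub>T_aut\<^esub> c \<otimes>\<^bsub>T_aut\<^esub> inv\<^bsub>T_aut\<^esub> (path (tail x))"

text \<open>\<open>S\<close> collects the points at which the loop may be nontrivial. The condition
  ranges over all of \<open>\<Sigma>\<close>, although the cocycles live on \<open>C\<close>,
  because the compactness arguments below produce points of \<open>\<Sigma>\<close> that need not be
  eventually constant.\<close>

definition tame :: "(nat list \<Rightarrow> nat list) \<Rightarrow> (nat \<Rightarrow> nat) set \<Rightarrow> bool" where
  "tame g S \<longleftrightarrow> g \<in> carrier T_aut \<and> finite S \<and> S \<subseteq> C \<and> (\<forall>x\<in>\<Sigma>. (act g x \<in> C \<longleftrightarrow> x \<in> C) \<and>
     (\<exists>c\<in>loops. germ g (tr c (act g x) x) x \<and> (x \<notin> S \<longrightarrow> c = \<one>\<^bsub>T_aut\<^esub>)))"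

lemma loops_simps [simp]: "c \<in> loops \<Longrightarrow> c \<in> carrier T_aut" "c \<in> loops \<Longrightarrow> c' \<in> loops \<Longrightarrow> c \<otimes>\<^bsub>T_aut\<^esub> c' \<in> loops"
  "c \<in> loops \<Longrightarrow> inv\<^bsub>T_aut\<^esub> c \<in> loops" "\<one>\<^bsub>T_aut\<^esub> \<in> loops"
  using loops_subgroup by (auto simp: subgroup.m_closed subgroup.mem_carrier subgroup.m_inv_closed subgroup.one_closed)

lemma tr_mem: "c \<in> loops \<Longrightarrow> x \<in> \<Sigma> \<Longrightarrow> y \<in> \<Sigma> \<Longrightarrow> tr c y x \<in> carrier T_aut"
  by (simp add: tr_def path_mem tail_less)

lemma tr_mult:
  assumes "c \<in> loops" "c' \<in> loops" "x \<in> \<Sigma>" "y \<in> \<Sigma>" "z \<in> \<Sigma>"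
  shows "tr c z y \<otimes>\<^bsub>T_aut\<^esub> tr c' y x = tr (c \<otimes>\<^bsub>T_aut\<^esub> c') z x"
proof -
  have P: "path (tail x) \<in> carrier T_aut" "path (tail y) \<in> carrier T_aut" "path (tail z) \<in> carrier T_aut"
    using assms by (auto intro: path_mem tail_less)
  have "inv\<^bsub>T_aut\<^esub> (path (tail y)) \<otimes>\<^bsub>T_aut\<^esub> (path (tail y) \<otimes>\<^bsub>T_aut\<^esub> r) = r" if "r \<in> carrier T_aut" for r
    using that P by (simp add: m_assoc[symmetric])
  then show ?thesis using assms P by (simp add: tr_def m_assoc)
qed

lemma tr_inv:
  assumes "c \<in> loops" "x \<in> \<Sigma>" "y \<in> \<Sigma>"
  shows "inv\<^bsub>T_aut\<^esub> (tr c y x) = tr (inv\<^bsub>T_aut\<^esub> c) x y"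
  using assms by (simp add: tr_def inv_mult_group path_mem tail_less m_assoc)

lemma tr_one: "x \<in> \<Sigma> \<Longrightarrow> tail y = tail x \<Longrightarrow> tr \<one>\<^bsub>T_aut\<^esub> y x = \<one>\<^bsub>T_aut\<^esub>"
  by (simp add: tr_def path_mem tail_less)

lemma tame_one: "tame \<one>\<^bsub>T_aut\<^esub> {}"
  unfolding tame_def by (auto simp: act_one tr_one germ_one intro!: bexI[of _ "\<one>\<^bsub>T_aut\<^esub>"])

lemma tame_mult:
  assumes g: "tame g S" and h: "tame h R"
  shows "\<exists>Q. tame (g \<otimes>\<^bsub>T_aut\<^esub> h) Q"
proof -
  have gc: "g \<in> carrier T_aut" and hc: "h \<in> carrier T_aut" using g h by (auto simp: tame_def)
  \<comment> \<open>A nontrivial loop of the product at \<open>x\<close> comes from \<open>h\<close>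
    at \<open>x\<close> or from \<open>g\<close> at \<open>act h x\<close>.\<close>
  let ?Q = "R \<union> act (inv\<^bsub>T_aut\<^esub> h) ` S"
  have "S \<subseteq> C" using g by (simp add: tame_def)
  have "act (inv\<^bsub>T_aut\<^esub> h) y \<in> C" if "y \<in> S" for y
  proof -
    have "y \<in> C" "y \<in> \<Sigma>" using that \<open>S \<subseteq> C\<close> by (auto simp: C_def)
    then show ?thesis using h hc by (simp add: tame_def act_closed act_inv)
        (metis act_closed act_inv(2) inv_closed)
  qed
  then have "finite ?Q" "?Q \<subseteq> C" using g h by (auto simp: tame_def)
  moreover have "(act (g \<otimes>\<^bsub>T_aut\<^esub> h) x \<in> C \<longleftrightarrow> x \<in> C) \<and>
     (\<exists>c\<in>loops. germ (g \<otimes>\<^bsub>T_aut\<^esub> h) (tr c (act (g \<otimes>\<^bsub>T_aut\<^esub> h) x) x) x \<and> (x \<notin> ?Q \<longrightarrow> c = \<one>\<^bsub>T_aut\<^esub>))"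
    if x: "x \<in> \<Sigma>" for x
  proof -
    have hx: "act h x \<in> \<Sigma>" "act g (act h x) \<in> \<Sigma>" using x hc gc by (simp_all add: act_closed)
    obtain c where c: "c \<in> loops" "germ h (tr c (act h x) x) x" "x \<notin> R \<longrightarrow> c = \<one>\<^bsub>T_aut\<^esub>"
      using h x unfolding tame_def by blast
    obtain c' where c': "c' \<in> loops" "germ g (tr c' (act g (act h x)) (act h x)) (act h x)"
      "act h x \<notin> S \<longrightarrow> c' = \<one>\<^bsub>T_aut\<^esub>"
      using g hx unfolding tame_def by blast
    have "germ (g \<otimes>\<^bsub>T_aut\<^esub> h) (tr (c' \<otimes>\<^bsub>T_aut\<^esub> c) (act g (act h x)) x) x"
      using germ_mult[OF gc hc _ _ x c(2) c'(2)] c c' x hx by (simp add: tr_mem tr_mult)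
    moreover have "act h x \<notin> S" if "x \<notin> ?Q"
      using that act_inv(1)[OF hc x] by (metis UnCI imageI)
    ultimately show ?thesis
      using c c' g h x hx gc hc by (auto simp: act_mult tame_def intro!: bexI[of _ "c' \<otimes>\<^bsub>T_aut\<^esub> c"])
  qed
  ultimately have "tame (g \<otimes>\<^bsub>T_aut\<^esub> h) ?Q" using gc hc by (simp add: tame_def)
  then show ?thesis ..
qed

lemma tame_inv:
  assumes g: "tame g S"
  shows "\<exists>Q. tame (inv\<^bsub>T_aut\<^esub> g) Q"
proof -
  have gc: "g \<in> carrier T_aut" using g by (auto simp: tame_def)
  have "S \<subseteq> C" using g by (simp add: tame_def)
  then have "finite (act g ` S)" "act g ` S \<subseteq> C" using g by (auto simp: tame_def C_def)
  moreover have "(act (inv\<^bsub>T_aut\<^esub> g) x \<in> C \<longleftrightarrow> x \<in> C) \<and>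
     (\<exists>c\<in>loops. germ (inv\<^bsub>T_aut\<^esub> g) (tr c (act (inv\<^bsub>T_aut\<^esub> g) x) x) x \<and> (x \<notin> act g ` S \<longrightarrow> c = \<one>\<^bsub>T_aut\<^esub>))"
    if x: "x \<in> \<Sigma>" for x
  proof -
    let ?y = "act (inv\<^bsub>T_aut\<^esub> g) x"
    have y: "?y \<in> \<Sigma>" "act g ?y = x" using x gc by (simp_all add: act_closed act_inv)
    obtain c where c: "c \<in> loops" "germ g (tr c (act g ?y) ?y) ?y" "?y \<notin> S \<longrightarrow> c = \<one>\<^bsub>T_aut\<^esub>"
      using g y(1) unfolding tame_def by blast
    have "germ (inv\<^bsub>T_aut\<^esub> g) (tr (inv\<^bsub>T_aut\<^esub> c) ?y x) x"
      using germ_inv[OF gc _ y(1) c(2)] c x y by (simp add: tr_mem tr_inv)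
    moreover have "?y \<notin> S" if "x \<notin> act g ` S" using that y by (metis imageI)
    moreover have "?y \<in> C \<longleftrightarrow> x \<in> C" using g y by (metis tame_def)
    ultimately show ?thesis using c by (auto intro!: bexI[of _ "inv\<^bsub>T_aut\<^esub> c"])
  qed
  ultimately have "tame (inv\<^bsub>T_aut\<^esub> g) (act g ` S)" using gc by (simp add: tame_def)
  then show ?thesis ..
qed

text \<open>At the word \<open>a a a ...\<close> the section is \<open>gen i\<close>, which is the
  step from \<open>path a\<close> to \<open>path (Suc a)\<close>, so the loop is trivial. Everywhere
  else only a finite prefix changes: the section is 1 and the tail is kept.\<close>

lemma tame_gen:
  assumes i: "1 \<le> i" "i < d"
  shows "tame (gen i) {}"
proof -
  obtain a where a: "Suc a + i = d" using i by (metis Suc_diff_Suc add.commute le_add_diff_inverse less_imp_le add_Suc)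
  have gc: "gen i \<in> carrier T_aut" using i by (simp add: gen_mem)
  have "(act (gen i) x \<in> C \<longleftrightarrow> x \<in> C) \<and> germ (gen i) (tr \<one>\<^bsub>T_aut\<^esub> (act (gen i) x) x) x"
    if x: "x \<in> \<Sigma>" for x
  proof (cases "x = (\<lambda>_. a)")
    case True
    have "(\<lambda>_. a) \<in> \<Sigma>" "(\<lambda>_. Suc a) \<in> \<Sigma>" using a i by auto
    have "d - Suc a = i" using a by simp
    then have "tr \<one>\<^bsub>T_aut\<^esub> (act (gen i) x) x = gen i"
      using a i gc by (simp add: True act_gen_const[OF a i(1)] tr_def path_mem m_assoc)
    moreover have "germ (gen i) (gen i) x"
      unfolding germ_def germ_at_def True act_gen_const[OF a i(1)]
      using act_gen_run[OF a i(1)] by simp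
    ultimately show ?thesis
      using True a i by (simp add: act_gen_const[OF a i(1)] C_def)
  next
    case False
    then obtain k z y where z: "z < d" "z \<noteq> a" "y \<in> \<Sigma>" and xe: "x = pre (\<lambda>_. a) k (case_nat z y)"
      by (rule first_break[OF x])
    obtain z' where z': "z' < d"
      "\<And>k y. y \<in> \<Sigma> \<Longrightarrow> act (gen i) (pre (\<lambda>_. a) k (case_nat z y)) = pre (\<lambda>_. Suc a) k (case_nat z' y)"
      using act_gen_break[OF a i(1) z] by metis
    have "germ (gen i) \<one>\<^bsub>T_aut\<^esub> x"
      unfolding xe pre_case_nat
    proof (rule germ_pre[OF z(3) _ germ_one[OF z(3)]])
      show "act (gen i) (pre (\<lambda>j. if j < k then a else z) (Suc k) y) =
          pre (\<lambda>j. if j < k then Suc a else z') (Suc k) (act \<one>\<^bsub>T_aut\<^esub> y)" if "y \<in> \<Sigma>" for y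
        using z'(2)[OF that, of k] that by (simp add: pre_case_nat act_one)
    qed
    moreover have "act (gen i) x = pre (\<lambda>_. Suc a) k (case_nat z' y)" using z' z xe by simp
    moreover have "act (gen i) x \<in> \<Sigma>" using gc x by (rule act_closed)
    ultimately show ?thesis using x z' z xe by (simp add: tr_one C_def)
  qed
  then show ?thesis
    unfolding tame_def using gc by (auto intro!: bexI[of _ "\<one>\<^bsub>T_aut\<^esub>"])
qed

lemma conjugate_back:
  assumes "a \<in> carrier T_aut" "b \<in> carrier T_aut"
  shows "a \<otimes>\<^bsub>T_aut\<^esub> (inv\<^bsub>T_aut\<^esub> a \<otimes>\<^bsub>T_aut\<^esub> b \<otimes>\<^bsub>T_aut\<^esub> a) \<otimes>\<^bsub>T_aut\<^esub> inv\<^bsub>T_aut\<^esub> a = b"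
proof -
  have "a \<otimes>\<^bsub>T_aut\<^esub> (inv\<^bsub>T_aut\<^esub> a \<otimes>\<^bsub>T_aut\<^esub> b \<otimes>\<^bsub>T_aut\<^esub> a) \<otimes>\<^bsub>T_aut\<^esub> inv\<^bsub>T_aut\<^esub> a =
      (a \<otimes>\<^bsub>T_aut\<^esub> inv\<^bsub>T_aut\<^esub> a) \<otimes>\<^bsub>T_aut\<^esub> b \<otimes>\<^bsub>T_aut\<^esub> (a \<otimes>\<^bsub>T_aut\<^esub> inv\<^bsub>T_aut\<^esub> a)"
    using assms by (simp only: m_assoc inv_closed m_closed)
  then show ?thesis using assms by simp
qed

text \<open>At the constant word \<open>d - 1\<close> the section is \<open>gen d\<close>, which is
  \<open>loop\<close> conjugated back. At any other word a letter \<open>z < d - 1\<close> ends the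
  run, and the germ is that of \<open>gen (Suc z)\<close> at the remaining word, which is covered by
  \<open>tame_gen\<close>.\<close>

lemma tame_last: "tame (gen d) {\<lambda>_. d - 1}"
proof -
  have gc: "gen d \<in> carrier T_aut" using d by (simp add: gen_mem)
  have cC: "(\<lambda>_. d - 1) \<in> C" using d by (simp add: C_def)
  have "(act (gen d) x \<in> C \<longleftrightarrow> x \<in> C) \<and>
     (\<exists>c\<in>loops. germ (gen d) (tr c (act (gen d) x) x) x \<and> (x \<noteq> (\<lambda>_. d - 1) \<longrightarrow> c = \<one>\<^bsub>T_aut\<^esub>))"
    if x: "x \<in> \<Sigma>" for x
  proof (cases "x = (\<lambda>_. d - 1)")
    case True
    let ?p = "path (d - 1)"
    have p: "?p \<in> carrier T_aut" using d by (simp add: path_mem)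
    have "tr loop (act (gen d) x) x = ?p \<otimes>\<^bsub>T_aut\<^esub> loop \<otimes>\<^bsub>T_aut\<^esub> inv\<^bsub>T_aut\<^esub> ?p"
      unfolding True act_last_const tr_def tail_const ..
    then have t: "tr loop (act (gen d) x) x = gen d"
      using conjugate_back[OF p gc] by (simp only: loop_def)
    have g: "germ (gen d) (gen d) x"
      unfolding germ_def germ_at_def True act_last_const using act_last_run by simp
    have "\<exists>c\<in>loops. germ (gen d) (tr c (act (gen d) x) x) x"
      by (rule bexI[of _ loop]) (simp_all add: t g generate.incl)
    then show ?thesis using cC True act_last_const by simp
  next
    case False
    then obtain k z y where z: "z < d" "z \<noteq> d - 1" "y \<in> \<Sigma>" and xe: "x = pre (\<lambda>_. d - 1) k (case_nat z y)"
      by (rule first_break[OF x])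
    let ?m = "gen (Suc z)"
    have t: "tame ?m {}" using z by (intro tame_gen) auto
    then have mc: "?m \<in> carrier T_aut" by (simp add: tame_def)
    have ae: "act (gen d) (pre (\<lambda>_. d - 1) k (case_nat z y)) = pre (\<lambda>_. d - 1) k (case_nat z (act ?m y))"
      if "y \<in> \<Sigma>" for y using act_last_break[OF z(1) that] .
    have g: "germ ?m (tr \<one>\<^bsub>T_aut\<^esub> (act ?m y) y) y" "act ?m y \<in> C \<longleftrightarrow> y \<in> C"
      using t z(3) by (auto simp: tame_def)
    have "germ (gen d) (tr \<one>\<^bsub>T_aut\<^esub> (act ?m y) y) x"
      unfolding xe pre_case_nat
    proof (rule germ_pre[OF z(3) _ g(1)])
      show "act (gen d) (pre (\<lambda>j. if j < k then d - 1 else z) (Suc k) y) =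
          pre (\<lambda>j. if j < k then d - 1 else z) (Suc k) (act ?m y)" if "y \<in> \<Sigma>" for y
        using ae[OF that] unfolding pre_case_nat .
    qed
    moreover have "tr \<one>\<^bsub>T_aut\<^esub> (act ?m y) y = tr \<one>\<^bsub>T_aut\<^esub> (act (gen d) x) x"
      using ae[OF z(3)] by (simp add: tr_def xe)
    moreover have "act (gen d) x \<in> C \<longleftrightarrow> x \<in> C"
      using g(2) x act_closed[OF gc x] act_closed[OF mc z(3)] z ae[OF z(3)] by (simp add: C_def xe)
    ultimately show ?thesis by (auto intro!: bexI[of _ "\<one>\<^bsub>T_aut\<^esub>"])
  qed
  then show ?thesis unfolding tame_def using gc cC by auto
qed

abbreviation "M \<equiv> carrier (mother_group d)"

lemma M_subgroup: "subgroup M T_aut"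
  unfolding mother_group_def by (simp, rule generate_is_subgroup) (use gen_mem in auto)

lemma M_induct [consumes 1, case_names one gen mult inv]:
  assumes g: "g \<in> M" and one: "P \<one>\<^bsub>T_aut\<^esub>"
    and gen: "\<And>i. 1 \<le> i \<Longrightarrow> i \<le> d \<Longrightarrow> P (gen i)"
    and mult: "\<And>g h. g \<in> carrier T_aut \<Longrightarrow> h \<in> carrier T_aut \<Longrightarrow> P g \<Longrightarrow> P h \<Longrightarrow> P (g \<otimes>\<^bsub>T_aut\<^esub> h)"
    and inv: "\<And>g. g \<in> carrier T_aut \<Longrightarrow> P g \<Longrightarrow> P (inv\<^bsub>T_aut\<^esub> g)"
  shows "P g"
proof -
  have "g \<in> generate T_aut (gen ` {1..d})" using g by (simp add: mother_group_def)
  then have "g \<in> carrier T_aut \<and> P g"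
  proof induction
    case one then show ?case using assms(2) by simp
  next
    case (incl h) then show ?case using assms(3) gen_mem by auto
  next
    case (inv h) then show ?case using assms(3,5) gen_mem by auto
  next
    case (eng g h) then show ?case using assms(4) by auto
  qed
  then show ?thesis ..
qed

lemma M_tame: "g \<in> M \<Longrightarrow> \<exists>S. tame g S"
proof (induction rule: M_induct)
  case (gen i)
  then show ?case using tame_gen[of i] tame_last by (cases "i = d") auto
qed (use tame_one tame_mult tame_inv in blast)+

end

section \<open>Functions of small energy\<close>

lemma int_mean:
  obtains m :: "(int \<Rightarrow> real) \<Rightarrow> real" where "mean_on UNIV m"
    "\<And>f j. bounded (range f) \<Longrightarrow> m (\<lambda>k. f (j + k)) = m f"
proof -
  obtain L :: "(nat \<Rightarrow> real) \<Rightarrow> real" where L: "\<And>N. mean_on {N..} L" using generalized_limit by blast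
  define av where "av N f = average {..<N} (\<lambda>k. f (int k))" for N and f :: "int \<Rightarrow> real"
  \<comment> \<open>The average over the empty set is 0 for every function, hence no mean; so the
    limit starts at \<open>N = 1\<close>.\<close>
  have av: "mean_on UNIV (av N)" if "N \<in> {1..}" for N
    unfolding av_def by (rule mean_on_map[OF mean_on_average]) (use that in \<open>auto simp: lessThan_empty_iff\<close>)
  define m where "m f = L (\<lambda>N. av N f)" for f
  have m: "mean_on UNIV m"
    unfolding m_def by (rule mean_on_bind[OF L[of 1]]) (rule av)
  have one: "m (\<lambda>k. f (1 + k)) = m f" if f: "bounded (range f)" for f
  proof -
    obtain B where B: "\<And>k. \<bar>f k\<bar> \<le> B" using f unfolding bounded_iff by auto
    have f': "bounded (range (\<lambda>k. f (1 + k)))" by (rule bounded_subset[OF f]) auto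
    \<comment> \<open>Shifting by 1 alters the sum only at its two ends.\<close>
    have d: "av N (\<lambda>k. f (1 + k)) - av N f = (f (int N) - f 0) / N" for N
      using sum_lessThan_telescope[of "\<lambda>k. f (int k)" N]
      by (simp add: av_def average_def diff_divide_distrib[symmetric] sum_subtractf add.commute)
    have "L (\<lambda>N. av N (\<lambda>k. f (1 + k)) - av N f) = 0"
    proof (rule generalized_limit_null[OF L], unfold d)
      have "(\<lambda>N. 2 * B * inverse (real N)) \<longlonglongrightarrow> 2 * B * 0"
        by (intro tendsto_intros lim_inverse_n)
      then have lim: "(\<lambda>N. 2 * B * inverse (real N)) \<longlonglongrightarrow> 0" by simp
      have "norm ((f (int N) - f 0) / real N) \<le> 2 * B * inverse (real N)" for N
        using B[of "int N"] B[of 0] by (auto simp: divide_inverse abs_mult intro!: mult_right_mono)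
      then show "(\<lambda>N. (f (int N) - f 0) / real N) \<longlonglongrightarrow> 0"
        by (intro Lim_null_comparison[OF _ lim] always_eventually allI)
    qed
    moreover have "L (\<lambda>N. av N (\<lambda>k. f (1 + k)) - av N f) = m (\<lambda>k. f (1 + k)) - m f"
      unfolding m_def by (rule mean_on_diff[OF L[of 1]])
        (rule bounded_image_mean[where k = av and A = "{1..}" and B = UNIV, OF av], assumption, rule f f')+
    ultimately show ?thesis by simp
  qed
  have "m (\<lambda>k. f (j + k)) = m f" if f: "bounded (range f)" for f j
  proof (induction j rule: int_induct[where k = 0])
    case (step1 i)
    have "bounded (range (\<lambda>k. f (i + k)))" by (rule bounded_subset[OF f]) auto
    from one[OF this] show ?case using step1 by (simp add: add_ac)
  next
    case (step2 i)
    have "bounded (range (\<lambda>k. f (i - 1 + k)))" by (rule bounded_subset[OF f]) auto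
    from one[OF this] show ?case using step2 by (simp add: add_ac)
  qed simp
  with m show thesis by (rule that)
qed

text \<open>The mean on the integers is pushed forward along the powers of \<open>a\<close>, which
  treats finite and infinite order alike.\<close>

lemma (in group) mean_cyclic:
  assumes a: "a \<in> carrier G"
  obtains m where "mean_inv G (generate G {a}) m"
proof -
  obtain mz :: "(int \<Rightarrow> real) \<Rightarrow> real" where mz: "mean_on UNIV mz"
    "\<And>f j. bounded (range f) \<Longrightarrow> mz (\<lambda>k. f (j + k)) = mz f"
    using int_mean by metis
  have gen: "generate G {a} = range (\<lambda>k :: int. a [^] k)"
    using generate_pow[OF a] by auto
  define m where "m f = mz (\<lambda>k. f (a [^] k))" for f
  have "mean_on (generate G {a}) m"
    unfolding m_def by (rule mean_on_map[OF mz(1)]) (simp add: gen)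
  moreover have "m (\<lambda>x. f (g \<otimes> x)) = m f"
    if g: "g \<in> generate G {a}" and f: "bounded (f ` generate G {a})" for f g
  proof -
    obtain j :: int where j: "g = a [^] j" using g gen by auto
    have "m (\<lambda>x. f (g \<otimes> x)) = mz (\<lambda>k. f (a [^] (j + k)))"
      using a by (simp add: m_def j int_pow_mult)
    also have "\<dots> = mz (\<lambda>k. f (a [^] k))"
      by (rule mz(2)) (rule bounded_subset[OF f], auto simp: gen)
    finally show ?thesis by (simp add: m_def)
  qed
  ultimately show thesis using that unfolding mean_inv_def by blast
qed

text \<open>
  Since the weight \<open>k + 1\<close> in \<open>cutoff_sum\<close> is compensated by the increments of the harmonic
  numbers, the sum telescopes.
\<close>

definition cutoff :: "nat \<Rightarrow> nat \<Rightarrow> real" where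
  "cutoff n k = max 0 (min 1 (2 - harm k / real (Suc n)))"

lemma cutoff_range: "0 \<le> cutoff n k" "cutoff n k \<le> 1"
  by (auto simp: cutoff_def)

lemma cutoff_antimono: "k \<le> l \<Longrightarrow> cutoff n l \<le> cutoff n k"
  unfolding cutoff_def using harm_mono[of k l, where 'a = real]
  by (intro max.mono min.mono order_refl diff_mono divide_right_mono) auto

text \<open>Two steps, because a generator moves the depth within a window
  \<open>{k..k + 2}\<close>. Truncation to the unit interval can only shrink differences.\<close>

lemma cutoff_drop: "cutoff n k - cutoff n (k + 2) \<le> 2 / (real (Suc k) * real (Suc n))"
proof -
  let ?x = "2 - harm k / real (Suc n)" and ?y = "2 - harm (k + 2) / real (Suc n)"
  have h: "harm (k + 2) - harm k = inverse (real (Suc k)) + inverse (real (Suc (Suc k)))"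
    by (simp add: harm_Suc)
  also have "\<dots> \<le> inverse (real (Suc k)) + inverse (real (Suc k))"
    by (intro add_left_mono le_imp_inverse_le) auto
  also have "\<dots> = 2 / real (Suc k)" by (simp add: divide_inverse)
  finally have "(harm (k + 2) - harm k) / real (Suc n) \<le> 2 / real (Suc k) / real (Suc n)"
    by (rule divide_right_mono) simp
  then have "?x - ?y \<le> 2 / (real (Suc k) * real (Suc n))" by (simp add: diff_divide_distrib)
  moreover have "0 \<le> ?x - ?y" using h by (simp add: diff_divide_distrib[symmetric])
  moreover have "max 0 (min 1 x) - max 0 (min 1 y) \<le> x - y" if "0 \<le> x - y" for x y :: real
    using that by (auto simp: max_def min_def)
  ultimately show ?thesis unfolding cutoff_def by (meson order_trans)
qed

lemma cutoff_sum:
  "(\<Sum>k<m. real (Suc k) * (cutoff n k - cutoff n (k + 2))\<^sup>2) \<le> 4 / real (Suc n)"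
proof -
  have tel: "(\<Sum>k<m. cutoff n k - cutoff n (k + 2)) = cutoff n 0 + cutoff n 1 - cutoff n m - cutoff n (Suc m)"
    by (induction m) auto
  have "(\<Sum>k<m. real (Suc k) * (cutoff n k - cutoff n (k + 2))\<^sup>2) \<le>
      (\<Sum>k<m. 2 / real (Suc n) * (cutoff n k - cutoff n (k + 2)))"
  proof (rule sum_mono)
    fix k
    let ?o = "cutoff n k - cutoff n (k + 2)"
    \<comment> \<open>One factor of the square absorbs the weight; the other factor is left to
      telescope, with total at most 2.\<close>
    have "real (Suc k) * ?o \<le> 2 / real (Suc n)"
      using mult_left_mono[OF cutoff_drop[of n k], of "real (Suc k)"] by (simp del: of_nat_Suc)
    then show "real (Suc k) * ?o\<^sup>2 \<le> 2 / real (Suc n) * ?o"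
      using mult_right_mono[of "real (Suc k) * ?o" "2 / real (Suc n)" ?o] cutoff_antimono[of k "k + 2" n]
      by (simp add: power2_eq_square mult.assoc)
  qed
  also have "\<dots> = 2 / real (Suc n) * (cutoff n 0 + cutoff n 1 - cutoff n m - cutoff n (Suc m))"
    unfolding sum_distrib_left[symmetric] tel ..
  also have "\<dots> \<le> 2 / real (Suc n) * 2"
    using cutoff_range[of n] by (intro mult_left_mono) (auto intro!: add_mono diff_mono, smt (verit))
  finally show ?thesis by simp
qed

section \<open>The length of the preperiod and its change under the generators\<close>

definition depth :: "(nat \<Rightarrow> nat) \<Rightarrow> nat" where
  "depth x = (LEAST n. \<forall>k\<ge>n. x k = tail x)"

lemma depth_le: "(\<And>k. n \<le> k \<Longrightarrow> x k = tail x) \<Longrightarrow> depth x \<le> n"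
  unfolding depth_def by (rule Least_le) blast

context mother
begin

lemma depth_tail:
  assumes "x \<in> C" "depth x \<le> k"
  shows "x k = tail x"
proof -
  have "\<exists>n. \<forall>k\<ge>n. x k = tail x"
    using C_tail[OF assms(1)] by (simp add: tail_const_def eventually_sequentially)
  from LeastI_ex[OF this] show ?thesis using assms(2) unfolding depth_def by blast
qed

lemma depth_gt: "x \<in> C \<Longrightarrow> x n \<noteq> tail x \<Longrightarrow> n < depth x"
  using depth_tail not_le by blast

lemma depth_0: "x \<in> C \<Longrightarrow> depth x = 0 \<Longrightarrow> x = (\<lambda>_. tail x)"
  by (rule ext) (simp add: depth_tail)

lemma depth_pos:
  assumes x: "x \<in> C" "0 < depth x"
  shows "x (depth x - 1) \<noteq> tail x"
proof
  assume *: "x (depth x - 1) = tail x"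
  have "depth x \<le> depth x - 1"
  proof (rule depth_le)
    fix k assume "depth x - 1 \<le> k"
    then show "x k = tail x" using * depth_tail[OF x(1), of k] by (cases "k = depth x - 1") auto
  qed
  then show False using x by simp
qed

lemma depth_pre:
  assumes y: "y \<in> C" "0 < depth y" and p: "pre w n y \<in> C"
  shows "depth (pre w n y) = n + depth y"
proof (rule antisym)
  show "depth (pre w n y) \<le> n + depth y"
    by (rule depth_le) (use depth_tail[OF y(1)] in \<open>simp add: pre_def[of _ _ y] flip: tail_pre[of w n y]\<close>)
  have "pre w n y (n + (depth y - 1)) \<noteq> tail (pre w n y)"
    using depth_pos[OF y] by (simp add: pre_def[of _ _ y] del: tail_pre) (simp add: tail_pre[unfolded pre_def])
  from depth_gt[OF p this] show "n + depth y \<le> depth (pre w n y)" using y(2) by simp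
qed

text \<open>The ambiguity arises when \<open>y\<close> is constant. If \<open>z\<close> differs from
  its letter, the depth is \<open>k + 1\<close>; if \<open>z\<close> prolongs the tail, the last
  deviating letter is the \<open>a\<close> before it, if any, and the depth is
  \<open>k\<close>.\<close>

lemma depth_break:
  assumes y: "y \<in> C" and p: "pre (\<lambda>_. a) k (case_nat z y) \<in> C" (is "?x \<in> C") and z: "z \<noteq> a"
  shows "k + depth y \<le> depth ?x" "depth ?x \<le> Suc (k + depth y)"
    "0 < depth y \<Longrightarrow> depth ?x = Suc (k + depth y)"
proof -
  have pos: "depth ?x = Suc (k + depth y)" if "0 < depth y"
    using depth_pre[OF y that, of "\<lambda>j. if j < k then a else z" "Suc k"] p by (simp add: pre_case_nat)
  show "0 < depth y \<Longrightarrow> depth ?x = Suc (k + depth y)" by (rule pos)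
  have "k \<le> depth ?x \<and> depth ?x \<le> Suc k" if d0: "depth y = 0"
  proof
    obtain j where j: "y = (\<lambda>_. j)" using depth_0[OF y d0] by metis
    show "depth ?x \<le> Suc k"
      by (rule depth_le) (simp add: j, auto simp: pre_def split: nat.splits)
    show "k \<le> depth ?x"
    proof (cases "j = z")
      case True
      show ?thesis
      proof (cases k)
        case (Suc k')
        have "?x k' \<noteq> tail ?x" using z True Suc by (simp add: j) (simp add: pre_def)
        from depth_gt[OF p this] show ?thesis using Suc by simp
      qed simp
    next
      case False
      then have "?x k \<noteq> tail ?x" by (simp add: j) (simp add: pre_def)
      from depth_gt[OF p this] show ?thesis by simp
    qed
  qed
  then show "k + depth y \<le> depth ?x" "depth ?x \<le> Suc (k + depth y)"
    using pos by (cases "depth y = 0"; simp)+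
qed

lemma C_mem: "x \<in> C \<Longrightarrow> x \<in> \<Sigma>"
  by (simp add: C_def)

lemma break_C: "z < d \<Longrightarrow> a < d \<Longrightarrow> y \<in> C \<Longrightarrow> pre (\<lambda>_. a) k (case_nat z y) \<in> C"
  by (simp add: C_def pre_mem)

lemma break_C_D: "y \<in> \<Sigma> \<Longrightarrow> pre w k (case_nat z y) \<in> C \<Longrightarrow> y \<in> C"
  by (simp add: C_def)

lemma depth_const: "depth (\<lambda>_. a) = 0"
  using depth_le[of 0 "\<lambda>_. a"] by simp

text \<open>If the part \<open>y\<close> after the break is not constant, the depth is
  \<open>k + 1 + depth y\<close> before and after. So a change forces \<open>y\<close> to be
  constant, which leaves at most \<open>d * d\<close> words for each \<open>k\<close>.\<close>

lemma depth_gen: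
  assumes a: "Suc a + i = d" "1 \<le> i" and x: "x \<in> C" and ne: "depth (act (gen i) x) \<noteq> depth x"
  shows "\<exists>k z j. z < d \<and> j < d \<and> x = pre (\<lambda>_. a) k (case_nat z (\<lambda>_. j)) \<and>
    {depth x, depth (act (gen i) x)} \<subseteq> {k..Suc k}"
proof -
  have "x \<noteq> (\<lambda>_. a)" using ne act_gen_const[OF a] by (auto simp: depth_const)
  then obtain k z y where z: "z < d" "z \<noteq> a" "y \<in> \<Sigma>" and xe: "x = pre (\<lambda>_. a) k (case_nat z y)"
    by (rule first_break[OF C_mem[OF x]])
  have y: "y \<in> C" using break_C_D[OF z(3)] x xe by simp
  obtain z' where z': "z' < d" "z' \<noteq> Suc a"
    "\<And>k y. y \<in> \<Sigma> \<Longrightarrow> act (gen i) (pre (\<lambda>_. a) k (case_nat z y)) = pre (\<lambda>_. Suc a) k (case_nat z' y)"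
    using act_gen_break[OF a z] by metis
  have ae: "act (gen i) x = pre (\<lambda>_. Suc a) k (case_nat z' y)" using z'(3)[OF z(3)] xe by simp
  have ax: "act (gen i) x \<in> C" unfolding ae using a z' y by (intro break_C) auto
  note D = depth_break[OF y x[unfolded xe] z(2), folded xe]
    depth_break[OF y ax[unfolded ae] z'(2), folded ae]
  have "depth y = 0" using D ne by (cases "depth y = 0") auto
  then have "y = (\<lambda>_. tail y)" by (rule depth_0[OF y])
  moreover have "tail y < d" using z(3) by (rule tail_less)
  ultimately show ?thesis
    using z(1) xe D \<open>depth y = 0\<close> by (intro exI[of _ k] exI[of _ z] exI[of _ "tail y"]) auto
qed

text \<open>After a run of \<open>d - 1\<close> of length \<open>k\<close> and a letter
  \<open>z\<close>, the generator acts as \<open>gen (Suc z)\<close>, whose own run has the letter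
  \<open>d - Suc (Suc z)\<close> and length \<open>p\<close>. The two lengths with a given sum
  \<open>k + p\<close> account for the linear growth.\<close>

lemma depth_last:
  assumes x: "x \<in> C" and ne: "depth (act (gen d) x) \<noteq> depth x"
  shows "\<exists>k p z z' j. z < d \<and> z' < d \<and> j < d \<and>
    x = pre (\<lambda>_. d - 1) k (case_nat z (pre (\<lambda>_. d - Suc (Suc z)) p (case_nat z' (\<lambda>_. j)))) \<and>
    {depth x, depth (act (gen d) x)} \<subseteq> {k + p..k + p + 2}"
proof -
  have "x \<noteq> (\<lambda>_. d - 1)" using ne act_last_const by (auto simp: depth_const)
  then obtain k z y where z: "z < d" "z \<noteq> d - 1" "y \<in> \<Sigma>" and xe: "x = pre (\<lambda>_. d - 1) k (case_nat z y)"
    by (rule first_break[OF C_mem[OF x]])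
  let ?a = "d - Suc (Suc z)" and ?y = "act (gen (Suc z)) y"
  have a: "Suc ?a + Suc z = d" "1 \<le> Suc z" using z by auto
  have y: "y \<in> C" using break_C_D[OF z(3)] x xe by simp
  have t: "tame (gen (Suc z)) {}" using z by (intro tame_gen) auto
  then have y': "?y \<in> C" using y z(3) by (simp add: tame_def)
  have ae: "act (gen d) x = pre (\<lambda>_. d - 1) k (case_nat z ?y)"
    unfolding xe by (rule act_last_break[OF z(1) z(3)])
  have ax: "act (gen d) x \<in> C" unfolding ae using d z y' by (intro break_C) auto
  note D = depth_break[OF y x[unfolded xe] z(2), folded xe]
    depth_break[OF y' ax[unfolded ae] z(2), folded ae]
  show ?thesis
  proof (cases "depth ?y = depth y")
    case True
    then have "depth y = 0" using D ne by (cases "depth y = 0") auto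
    then obtain j where j: "y = (\<lambda>_. j)" using depth_0[OF y] by metis
    \<comment> \<open>A constant word also has the required form, with an empty second run and
      \<open>z' = j\<close>.\<close>
    then have ye: "y = pre (\<lambda>_. ?a) 0 (case_nat j (\<lambda>_. j))"
      by (auto simp: fun_eq_iff split: nat.split)
    have "x = pre (\<lambda>_. d - 1) k (case_nat z (pre (\<lambda>_. ?a) 0 (case_nat j (\<lambda>_. j))))"
      unfolding ye[symmetric] by (rule xe)
    moreover have "j < d" using z(3) j by simp
    moreover have "{depth x, depth (act (gen d) x)} \<subseteq> {k + 0..k + 0 + 2}"
      using D True \<open>depth y = 0\<close> by auto
    ultimately show ?thesis using z(1) by blast
  next
    case False
    obtain p z' j where "z' < d" "j < d" and ye: "y = pre (\<lambda>_. ?a) p (case_nat z' (\<lambda>_. j))"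
      and p: "{depth y, depth ?y} \<subseteq> {p..Suc p}"
      using depth_gen[OF a y False] by blast
    moreover have "{depth x, depth (act (gen d) x)} \<subseteq> {k + p..k + p + 2}"
      using D p by auto
    ultimately show ?thesis using z(1) xe by blast
  qed
qed

section \<open>Finitely supported test functions on the eventually constant words\<close>

definition bump :: "nat \<Rightarrow> (nat \<Rightarrow> nat) \<Rightarrow> real" where
  "bump n x = (if x \<in> C then cutoff n (depth x) else 0)"

text \<open>\<open>cutoff n k\<close> is 1 as long as \<open>harm k \<le> n + 1\<close>.\<close>

lemma bump_one:
  assumes "x \<in> C"
  shows "\<forall>\<^sub>F n in sequentially. bump n x = 1"
proof -
  obtain N where N: "harm (depth x) \<le> real N" using real_arch_simple by blast
  have "bump n x = 1" if "N \<le> n" for n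
  proof -
    have "harm (depth x) / real (Suc n) \<le> 1" using N that by (simp add: divide_le_eq)
    then show ?thesis using assms by (simp add: bump_def cutoff_def)
  qed
  then show ?thesis unfolding eventually_sequentially by blast
qed

lemma finite_depth: "finite {x \<in> C. depth x \<le> N}"
proof (rule finite_subset)
  let ?P = "{u. set u \<subseteq> {..<d} \<and> length u = N} \<times> {..<d}"
  show "finite ((\<lambda>(u, j). pre (\<lambda>k. u ! k) N (\<lambda>_. j)) ` ?P)"
    by (intro finite_imageI finite_cartesian_product finite_lists_length_eq) auto
  show "{x \<in> C. depth x \<le> N} \<subseteq> (\<lambda>(u, j). pre (\<lambda>k. u ! k) N (\<lambda>_. j)) ` ?P"
  proof
    fix x assume x: "x \<in> {x \<in> C. depth x \<le> N}"
    have 1: "x = pre (\<lambda>k. map x [0..<N] ! k) N (\<lambda>_. tail x)"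
      using x depth_tail by (auto simp: pre_def fun_eq_iff)
    have 2: "(map x [0..<N], tail x) \<in> ?P"
      using x tail_less C_mem by (auto simp: \<Sigma>_def)
    show "x \<in> (\<lambda>(u, j). pre (\<lambda>k. u ! k) N (\<lambda>_. j)) ` ?P"
      by (rule image_eqI[OF _ 2]) (simp only: prod.case, rule 1)
  qed
qed

text \<open>\<open>cutoff n k\<close> vanishes once \<open>harm k \<ge> 2 * (n + 1)\<close>, which
  happens because the harmonic series diverges; and only finitely many words have bounded
  depth.\<close>

lemma bump_support: "finite {x. bump n x \<noteq> 0}" "{x. bump n x \<noteq> 0} \<subseteq> C"
proof -
  show "{x. bump n x \<noteq> 0} \<subseteq> C" by (auto simp: bump_def)
  have "filterlim (harm :: nat \<Rightarrow> real) at_top sequentially" by (rule harm_at_top)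
  then obtain N where N: "\<And>k. N \<le> k \<Longrightarrow> 2 * real (Suc n) \<le> harm k"
    unfolding filterlim_at_top eventually_sequentially by metis
  have "{x. bump n x \<noteq> 0} \<subseteq> {x \<in> C. depth x \<le> N}"
  proof
    fix x assume "x \<in> {x. bump n x \<noteq> 0}"
    then have x: "x \<in> C" "cutoff n (depth x) \<noteq> 0" by (auto simp: bump_def split: if_splits)
    have "\<not> N \<le> depth x"
    proof
      assume "N \<le> depth x"
      from N[OF this] have "2 \<le> harm (depth x) / real (Suc n)" by (simp add: le_divide_eq)
      then show False using x by (simp add: cutoff_def)
    qed
    then show "x \<in> {x \<in> C. depth x \<le> N}" using x by simp
  qed
  then show "finite {x. bump n x \<noteq> 0}" using finite_depth finite_subset by blast
qed

text \<open>Words are grouped by the window \<open>{k..k + 2}\<close> that holds both depths. A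
  group has at most \<open>D * Suc k\<close> members, each contributing at most the squared drop of
  the cutoff across the window; this is the sum in \<open>cutoff_sum\<close>.\<close>

lemma energy_bound:
  assumes fin: "\<And>k. finite (E k)" and card: "\<And>k. card (E k) \<le> D * Suc k"
    and inv: "\<And>x. x \<in> C \<Longrightarrow> act g x \<in> C"
    and E: "\<And>x. x \<in> C \<Longrightarrow> depth (act g x) \<noteq> depth x \<Longrightarrow>
      \<exists>k. x \<in> E k \<and> {depth x, depth (act g x)} \<subseteq> {k..k + 2}"
    and Q: "finite Q" "Q \<subseteq> C"
  shows "(\<Sum>x\<in>Q. (bump n (act g x) - bump n x)\<^sup>2) \<le> 4 * real D / real (Suc n)"
proof -
  define Q' where "Q' = {x \<in> Q. depth (act g x) \<noteq> depth x}"
  have "\<forall>x\<in>Q'. \<exists>k. x \<in> E k \<and> {depth x, depth (act g x)} \<subseteq> {k..k + 2}"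
    using E Q by (auto simp: Q'_def)
  then obtain \<kappa> where \<kappa>: "\<And>x. x \<in> Q' \<Longrightarrow> x \<in> E (\<kappa> x)"
    "\<And>x. x \<in> Q' \<Longrightarrow> {depth x, depth (act g x)} \<subseteq> {\<kappa> x..\<kappa> x + 2}" by metis
  have fQ': "finite Q'" using Q by (simp add: Q'_def)
  then obtain m where m: "\<kappa> ` Q' \<subseteq> {..<m}" using finite_nat_iff_bounded[of "\<kappa> ` Q'"] by auto
  let ?o = "\<lambda>k. cutoff n k - cutoff n (k + 2)"
  have "(\<Sum>x\<in>Q. (bump n (act g x) - bump n x)\<^sup>2) = (\<Sum>x\<in>Q'. (bump n (act g x) - bump n x)\<^sup>2)"
    by (rule sum.mono_neutral_right) (use Q inv in \<open>auto simp: Q'_def bump_def\<close>)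
  also have "\<dots> \<le> (\<Sum>x\<in>Q'. (?o (\<kappa> x))\<^sup>2)"
  proof (rule sum_mono)
    fix x assume x: "x \<in> Q'"
    then have xC: "x \<in> C" "act g x \<in> C" using Q inv by (auto simp: Q'_def)
    have "cutoff n (\<kappa> x + 2) \<le> bump n y \<and> bump n y \<le> cutoff n (\<kappa> x)" if "y = x \<or> y = act g x" for y
      using that xC \<kappa>(2)[OF x] by (auto simp: bump_def intro!: cutoff_antimono)
    from this[of x] this[of "act g x"] have "\<bar>bump n (act g x) - bump n x\<bar> \<le> \<bar>?o (\<kappa> x)\<bar>"
      by (auto simp: abs_if)
    then show "(bump n (act g x) - bump n x)\<^sup>2 \<le> (?o (\<kappa> x))\<^sup>2" by (simp add: abs_le_square_iff)
  qed
  also have "\<dots> = (\<Sum>k<m. \<Sum>x\<in>{x \<in> Q'. \<kappa> x = k}. (?o (\<kappa> x))\<^sup>2)"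
    by (rule sum.group[symmetric]) (use fQ' m in auto)
  also have "\<dots> \<le> (\<Sum>k<m. real D * (real (Suc k) * (?o k)\<^sup>2))"
  proof (rule sum_mono)
    fix k
    have "card {x \<in> Q'. \<kappa> x = k} \<le> card (E k)" using \<kappa> by (intro card_mono fin) auto
    also have "\<dots> \<le> D * Suc k" by (rule card)
    finally have "real (card {x \<in> Q'. \<kappa> x = k}) \<le> real D * real (Suc k)"
      by (metis of_nat_le_iff of_nat_mult)
    then have "real (card {x \<in> Q'. \<kappa> x = k}) * (?o k)\<^sup>2 \<le> real D * real (Suc k) * (?o k)\<^sup>2"
      by (rule mult_right_mono) simp
    then show "(\<Sum>x\<in>{x \<in> Q'. \<kappa> x = k}. (?o (\<kappa> x))\<^sup>2) \<le> real D * (real (Suc k) * (?o k)\<^sup>2)"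
      by (simp add: mult.assoc)
  qed
  also have "\<dots> \<le> real D * (4 / real (Suc n))"
    unfolding sum_distrib_left[symmetric] by (intro mult_left_mono cutoff_sum) simp
  finally show ?thesis by (simp add: mult.commute)
qed

definition low_energy :: "(nat list \<Rightarrow> nat list) \<Rightarrow> bool" where
  "low_energy g \<longleftrightarrow> (\<exists>K. \<forall>n Q. finite Q \<longrightarrow> Q \<subseteq> C \<longrightarrow>
     (\<Sum>x\<in>Q. (bump n (act g x) - bump n x)\<^sup>2) \<le> K / real (Suc n))"

lemma low_energyI:
  assumes "\<And>n Q. finite Q \<Longrightarrow> Q \<subseteq> C \<Longrightarrow>
    (\<Sum>x\<in>Q. (bump n (act g x) - bump n x)\<^sup>2) \<le> K / real (Suc n)"
  shows "low_energy g"
  unfolding low_energy_def using assms by (intro exI[of _ K]) simp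

lemma low_energy_gen:
  assumes i: "1 \<le> i" "i < d"
  shows "low_energy (gen i)"
proof -
  define a where "a = d - Suc i"
  have a: "Suc a + i = d" using i by (simp add: a_def)
  define E where "E k = (\<lambda>(z, j). pre (\<lambda>_. a) k (case_nat z (\<lambda>_. j))) ` ({..<d} \<times> {..<d})" for k
  have fin: "finite (E k)" for k by (simp add: E_def)
  have "card (E k) \<le> d * d * Suc k" for k
    using card_image_le[of "{..<d} \<times> {..<d}" "\<lambda>(z, j). pre (\<lambda>_. a) k (case_nat z (\<lambda>_. j))"]
    by (simp add: E_def)
  moreover have "act (gen i) x \<in> C" if "x \<in> C" for x
    using tame_gen[OF i] that C_mem by (auto simp: tame_def)
  moreover have "\<exists>k. x \<in> E k \<and> {depth x, depth (act (gen i) x)} \<subseteq> {k..k + 2}"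
    if "x \<in> C" "depth (act (gen i) x) \<noteq> depth x" for x
    using depth_gen[OF a i(1) that] by (fastforce simp: E_def)
  ultimately show ?thesis
    by (intro low_energyI[where K = "4 * real (d * d)"] energy_bound[of E "d * d" "gen i", OF fin])
qed

lemma low_energy_last: "low_energy (gen d)"
proof -
  let ?f = "\<lambda>(k, z, z', j) p. pre (\<lambda>_. d - 1) k (case_nat z (pre (\<lambda>_. d - Suc (Suc z)) p (case_nat z' (\<lambda>_. j))))"
  \<comment> \<open>The run lengths satisfy \<open>k + p = l\<close>, so \<open>k\<close> ranges
    over \<open>{..l}\<close> and determines \<open>p\<close>.\<close>
  define E where "E l = (\<lambda>t. ?f t (l - fst t)) ` ({..l} \<times> {..<d} \<times> {..<d} \<times> {..<d})" for l
  have fin: "finite (E k)" for k by (simp add: E_def)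
  have "card (E l) \<le> d * d * d * Suc l" for l
    using card_image_le[of "{..l} \<times> {..<d} \<times> {..<d} \<times> {..<d}" "\<lambda>t. ?f t (l - fst t)"]
    by (simp add: E_def mult_ac)
  moreover have "act (gen d) x \<in> C" if "x \<in> C" for x
    using tame_last that C_mem by (auto simp: tame_def)
  moreover have "\<exists>k. x \<in> E k \<and> {depth x, depth (act (gen d) x)} \<subseteq> {k..k + 2}"
    if x: "x \<in> C" "depth (act (gen d) x) \<noteq> depth x" for x
  proof -
    obtain k p z z' j where *: "z < d" "z' < d" "j < d" "x = ?f (k, z, z', j) p"
      "{depth x, depth (act (gen d) x)} \<subseteq> {k + p..k + p + 2}"
      using depth_last[OF x] by auto
    have "x \<in> E (k + p)"
      unfolding E_def by (rule image_eqI[of _ _ "(k, z, z', j)"]) (use * in auto)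
    then show ?thesis using *(5) by blast
  qed
  ultimately show ?thesis
    by (intro low_energyI[where K = "4 * real (d * d * d)"] energy_bound[of E "d * d * d" "gen d", OF fin])
qed

lemma M_C: "g \<in> M \<Longrightarrow> x \<in> C \<Longrightarrow> act g x \<in> C"
  using M_tame[of g] C_mem by (auto simp: tame_def)

lemma M_mem: "g \<in> M \<Longrightarrow> g \<in> carrier T_aut"
  using M_subgroup by (rule subgroup.mem_carrier)

lemma M_low_energy:
  assumes "g \<in> M"
  shows "low_energy g"
proof -
  \<comment> \<open>The induction rule only knows that the factors are automorphisms, so
    preservation of \<open>C\<close> in both directions is carried along.\<close>
  from assms have "(\<forall>x\<in>C. act g x \<in> C \<and> act (inv\<^bsub>T_aut\<^esub> g) x \<in> C) \<and> low_energy g"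
  proof (induction rule: M_induct)
    case one
    have "low_energy \<one>\<^bsub>T_aut\<^esub>"
      unfolding low_energy_def
      by (rule exI[of _ 0]) (auto simp: act_one C_mem subset_iff intro!: sum_nonpos)
    then show ?case by (simp add: act_one C_mem)
  next
    case (gen i)
    have iM: "gen i \<in> M" using gen by (auto simp: mother_group_def intro: generate.incl)
    then have "inv\<^bsub>T_aut\<^esub> (gen i) \<in> M" using M_subgroup by (rule subgroup.m_inv_closed[rotated])
    then show ?case
      using M_C iM low_energy_gen[of i] low_energy_last gen by (cases "i = d") auto
  next
    case (mult g h)
    have lg: "low_energy g" and lh: "low_energy h" using mult by simp_all
    obtain K where "\<forall>n Q. finite Q \<longrightarrow> Q \<subseteq> C \<longrightarrow>
      (\<Sum>x\<in>Q. (bump n (act g x) - bump n x)\<^sup>2) \<le> K / real (Suc n)"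
      using lg unfolding low_energy_def ..
    note K = this[rule_format]
    obtain K' where "\<forall>n Q. finite Q \<longrightarrow> Q \<subseteq> C \<longrightarrow>
      (\<Sum>x\<in>Q. (bump n (act h x) - bump n x)\<^sup>2) \<le> K' / real (Suc n)"
      using lh unfolding low_energy_def ..
    note K' = this[rule_format]
    have "(\<Sum>x\<in>Q. (bump n (act (g \<otimes>\<^bsub>T_aut\<^esub> h) x) - bump n x)\<^sup>2) \<le> (2 * K + 2 * K') / real (Suc n)"
      if Q: "finite Q" "Q \<subseteq> C" for n Q
    proof -
      have sq: "(p - r)\<^sup>2 \<le> 2 * (p - q)\<^sup>2 + 2 * (q - r)\<^sup>2" for p q r :: real
        using zero_le_power2[of "(p - q) - (q - r)"] by (simp add: power2_eq_square algebra_simps)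
      have inj: "inj_on (act h) Q"
        by (rule inj_on_inverseI[of _ "act (inv\<^bsub>T_aut\<^esub> h)"]) (use act_inv(1)[OF mult(2)] Q C_mem in auto)
      have "(\<Sum>x\<in>Q. (bump n (act (g \<otimes>\<^bsub>T_aut\<^esub> h) x) - bump n x)\<^sup>2) \<le>
          (\<Sum>x\<in>Q. 2 * (bump n (act g (act h x)) - bump n (act h x))\<^sup>2 + 2 * (bump n (act h x) - bump n x)\<^sup>2)"
        by (rule sum_mono) (use Q C_mem mult act_mult sq in auto)
      also have "\<dots> = 2 * (\<Sum>x\<in>act h ` Q. (bump n (act g x) - bump n x)\<^sup>2) +
          2 * (\<Sum>x\<in>Q. (bump n (act h x) - bump n x)\<^sup>2)"
        by (simp add: sum.distrib sum_distrib_left sum.reindex[OF inj])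
      also have "\<dots> \<le> 2 * (K / real (Suc n)) + 2 * (K' / real (Suc n))"
        by (intro add_mono mult_left_mono K K') (use Q mult in auto)
      finally show ?thesis by (simp add: add_divide_distrib)
    qed
    moreover have "\<forall>x\<in>C. act (g \<otimes>\<^bsub>T_aut\<^esub> h) x \<in> C \<and> act (inv\<^bsub>T_aut\<^esub> (g \<otimes>\<^bsub>T_aut\<^esub> h)) x \<in> C"
      using mult C_mem by (simp add: act_mult inv_mult_group)
    ultimately show ?case by (intro conjI low_energyI)
  next
    case (inv g)
    have lg: "low_energy g" using inv by simp
    obtain K where "\<forall>n Q. finite Q \<longrightarrow> Q \<subseteq> C \<longrightarrow>
      (\<Sum>x\<in>Q. (bump n (act g x) - bump n x)\<^sup>2) \<le> K / real (Suc n)"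
      using lg unfolding low_energy_def ..
    note K = this[rule_format]
    have "(\<Sum>x\<in>Q. (bump n (act (inv\<^bsub>T_aut\<^esub> g) x) - bump n x)\<^sup>2) \<le> K / real (Suc n)"
      if Q: "finite Q" "Q \<subseteq> C" for n Q
    proof -
      let ?i = "act (inv\<^bsub>T_aut\<^esub> g)"
      have inj: "inj_on ?i Q"
        by (rule inj_on_inverseI[of _ "act g"]) (use act_inv(2)[OF inv(1)] Q C_mem in auto)
      have "(\<Sum>x\<in>Q. (bump n (?i x) - bump n x)\<^sup>2) = (\<Sum>x\<in>Q. (bump n (act g (?i x)) - bump n (?i x))\<^sup>2)"
        by (rule sum.cong) (use Q C_mem act_inv(2)[OF inv(1)] in \<open>auto simp: power2_commute subset_iff\<close>)
      also have "\<dots> = (\<Sum>x\<in>?i ` Q. (bump n (act g x) - bump n x)\<^sup>2)"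
        by (simp add: sum.reindex[OF inj])
      also have "\<dots> \<le> K / real (Suc n)" by (rule K) (use Q inv in auto)
      finally show ?thesis .
    qed
    then have "low_energy (inv\<^bsub>T_aut\<^esub> g)" by (rule low_energyI)
    then show ?case using inv by simp
  qed
  then show ?thesis ..
qed

end

section \<open>The two cocycles\<close>

context mother
begin

definition loop_of :: "(nat list \<Rightarrow> nat list) \<Rightarrow> (nat \<Rightarrow> nat) \<Rightarrow> nat list \<Rightarrow> nat list" where
  "loop_of g x = (THE c. c \<in> loops \<and> germ g (tr c (act g x) x) x)"

lemma tr_inject:
  assumes "c \<in> loops" "c' \<in> loops" "x \<in> \<Sigma>" "y \<in> \<Sigma>" "tr c y x = tr c' y x"
  shows "c = c'"
  using assms by (simp add: tr_def path_mem tail_less)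

text \<open>The germ determines its section, as automorphisms act faithfully, and the section
  determines the loop once the two tails are fixed.\<close>

lemma loop_of_eq:
  assumes "g \<in> carrier T_aut" "x \<in> \<Sigma>" "c \<in> loops" "germ g (tr c (act g x) x) x"
  shows "loop_of g x = c"
  unfolding loop_of_def
proof (rule the_equality)
  fix c' assume "c' \<in> loops \<and> germ g (tr c' (act g x) x) x"
  then show "c' = c"
    using germ_unique[of g _ x] assms tr_mem act_closed tr_inject by metis
qed (use assms in simp)

lemma loop_of:
  assumes g: "g \<in> M" and x: "x \<in> \<Sigma>"
  shows "loop_of g x \<in> loops" "germ g (tr (loop_of g x) (act g x) x) x"
    "x \<notin> C \<Longrightarrow> loop_of g x = \<one>\<^bsub>T_aut\<^esub>"
proof -
  obtain S where S: "tame g S" using M_tame[OF g] ..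
  then obtain c where c: "c \<in> loops" "germ g (tr c (act g x) x) x" "x \<notin> S \<Longrightarrow> c = \<one>\<^bsub>T_aut\<^esub>"
    using x unfolding tame_def by blast
  have eq: "loop_of g x = c" using loop_of_eq[OF M_mem[OF g] x c(1,2)] .
  show "loop_of g x \<in> loops" "germ g (tr (loop_of g x) (act g x) x) x" using c eq by simp_all
  show "loop_of g x = \<one>\<^bsub>T_aut\<^esub>" if "x \<notin> C" using that c(3) eq S unfolding tame_def by blast
qed

lemma loop_of_finite:
  assumes g: "g \<in> M"
  shows "finite {x \<in> C. loop_of g x \<noteq> \<one>\<^bsub>T_aut\<^esub>}"
proof -
  obtain S where S: "tame g S" using M_tame[OF g] ..
  have "{x \<in> C. loop_of g x \<noteq> \<one>\<^bsub>T_aut\<^esub>} \<subseteq> S"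
  proof
    fix x assume x: "x \<in> {x \<in> C. loop_of g x \<noteq> \<one>\<^bsub>T_aut\<^esub>}"
    then have "x \<in> \<Sigma>" by (simp add: C_mem)
    then obtain c where c: "c \<in> loops" "germ g (tr c (act g x) x) x" "x \<notin> S \<longrightarrow> c = \<one>\<^bsub>T_aut\<^esub>"
      using S unfolding tame_def by blast
    then show "x \<in> S" using loop_of_eq[OF M_mem[OF g] \<open>x \<in> \<Sigma>\<close> c(1,2)] x by auto
  qed
  then show ?thesis using S finite_subset by (auto simp: tame_def)
qed

text \<open>Germs compose, and the path to the intermediate tail cancels against its
  inverse.\<close>

lemma loop_of_mult:
  assumes g: "g \<in> M" and h: "h \<in> M" and x: "x \<in> \<Sigma>"
  shows "loop_of (g \<otimes>\<^bsub>T_aut\<^esub> h) x = loop_of g (act h x) \<otimes>\<^bsub>T_aut\<^esub> loop_of h x"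
proof -
  have c: "g \<in> carrier T_aut" "h \<in> carrier T_aut" using g h by (simp_all add: M_mem)
  have hx: "act h x \<in> \<Sigma>" "act g (act h x) \<in> \<Sigma>" using x c by (simp_all add: act_closed)
  note l = loop_of[OF h x] loop_of[OF g hx(1)]
  show ?thesis
  proof (rule loop_of_eq[OF _ x])
    show "germ (g \<otimes>\<^bsub>T_aut\<^esub> h) (tr (loop_of g (act h x) \<otimes>\<^bsub>T_aut\<^esub> loop_of h x) (act (g \<otimes>\<^bsub>T_aut\<^esub> h) x) x) x"
      using germ_mult[OF c _ _ x l(2) l(5)] l hx x c by (simp add: tr_mem tr_mult act_mult)
  qed (use c l in auto)
qed

sublocale loops: cocycle_action T_aut T_aut M C act loops loop_of
proof (intro cocycle_action.intro cocycle_action_axioms.intro)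
  show "subgroup M T_aut" by (rule M_subgroup)
  show "subgroup loops T_aut" by (rule loops_subgroup)
qed (auto simp: M_C M_mem C_mem act_mult act_one loop_of loop_of_mult loop_of_finite is_group)

definition "H0 = {h \<in> M. \<forall>x\<in>C. loop_of h x = \<one>\<^bsub>T_aut\<^esub>}"

lemma H0_subgroup: "subgroup H0 T_aut"
  unfolding H0_def by (rule loops.kernel_subgroup)

lemma H0_M: "h \<in> H0 \<Longrightarrow> h \<in> M"
  by (simp add: H0_def)

lemma H0_germ:
  assumes h: "h \<in> H0" and x: "x \<in> \<Sigma>"
  shows "germ h (tr \<one>\<^bsub>T_aut\<^esub> (act h x) x) x"
proof -
  have "loop_of h x = \<one>\<^bsub>T_aut\<^esub>"
    using h loop_of(3)[OF H0_M[OF h] x] by (cases "x \<in> C") (auto simp: H0_def)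
  then show ?thesis using loop_of(2)[OF H0_M[OF h] x] by simp
qed

section \<open>Finitely many changes of tail on the first kernel\<close>

definition shifts :: "(nat list \<Rightarrow> nat list) \<Rightarrow> (nat \<Rightarrow> nat) set" where
  "shifts g = {x \<in> C. tail (act g x) \<noteq> tail x}"

lemma shifts_mult:
  assumes g: "g \<in> M" "finite (shifts g)" and h: "h \<in> M" "finite (shifts h)"
  shows "finite (shifts (g \<otimes>\<^bsub>T_aut\<^esub> h))"
proof (rule finite_subset)
  show "shifts (g \<otimes>\<^bsub>T_aut\<^esub> h) \<subseteq> shifts h \<union> act (inv\<^bsub>T_aut\<^esub> h) ` shifts g"
  proof
    fix x assume x: "x \<in> shifts (g \<otimes>\<^bsub>T_aut\<^esub> h)"
    then have xC: "x \<in> C" "act h x \<in> C" using M_C[OF h(1)] by (auto simp: shifts_def)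
    have "x \<in> shifts h \<or> act h x \<in> shifts g"
      using x xC g h by (auto simp: shifts_def act_mult M_mem C_mem)
    moreover have "act (inv\<^bsub>T_aut\<^esub> h) (act h x) = x" using h xC by (simp add: act_inv M_mem C_mem)
    ultimately show "x \<in> shifts h \<union> act (inv\<^bsub>T_aut\<^esub> h) ` shifts g" by (metis UnCI imageI)
  qed
qed (use g h in auto)

lemma shifts_inv:
  assumes g: "g \<in> M" "finite (shifts g)"
  shows "finite (shifts (inv\<^bsub>T_aut\<^esub> g))"
proof (rule finite_subset)
  show "shifts (inv\<^bsub>T_aut\<^esub> g) \<subseteq> act g ` shifts g"
  proof
    fix x assume x: "x \<in> shifts (inv\<^bsub>T_aut\<^esub> g)"
    let ?y = "act (inv\<^bsub>T_aut\<^esub> g) x"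
    have y: "act g ?y = x" "?y \<in> C"
      using x g M_C[OF subgroup.m_inv_closed[OF M_subgroup g(1)], of x]
      by (auto simp: shifts_def act_inv M_mem C_mem)
    then have "?y \<in> shifts g" using x by (auto simp: shifts_def)
    then show "x \<in> act g ` shifts g" using y by (metis imageI)
  qed
qed (use g in auto)

text \<open>Apart from the word \<open>a a a ...\<close>, a generator of index below
  \<open>d\<close> changes only a finite prefix and so keeps the tail.\<close>

lemma path_shifts: "a < d \<Longrightarrow> path a \<in> M \<and> finite (shifts (path a))"
proof (induction a)
  case 0
  have "shifts \<one>\<^bsub>T_aut\<^esub> = {}" by (auto simp: shifts_def act_one C_mem)
  then show ?case using subgroup.one_closed[OF M_subgroup] by simp
next
  case (Suc a)
  let ?i = "d - Suc a"
  have i: "Suc a + ?i = d" "1 \<le> ?i" "?i < d" using Suc.prems by auto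
  have m: "gen ?i \<in> M" using i(2,3) by (auto simp: mother_group_def intro: generate.incl)
  have "shifts (gen ?i) \<subseteq> {\<lambda>_. a}"
  proof
    fix x assume x: "x \<in> shifts (gen ?i)"
    show "x \<in> {\<lambda>_. a}"
    proof (rule ccontr)
      assume "x \<notin> {\<lambda>_. a}"
      then have "x \<noteq> (\<lambda>_. a)" by simp
      moreover have xS: "x \<in> \<Sigma>" using x by (simp add: shifts_def C_mem)
      ultimately obtain k z y where z: "z < d" "z \<noteq> a" "y \<in> \<Sigma>" and xe: "x = pre (\<lambda>_. a) k (case_nat z y)"
        using first_break by metis
      obtain z' where "act (gen ?i) (pre (\<lambda>_. a) k (case_nat z y)) = pre (\<lambda>_. Suc a) k (case_nat z' y)"
        using act_gen_break[OF i(1,2) z] z(3) by metis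
      then show False using x by (simp add: shifts_def xe)
    qed
  qed
  then have "finite (shifts (gen ?i))" by (rule finite_subset) simp
  then show ?case
    using Suc m shifts_mult[OF m] subgroup.m_closed[OF M_subgroup m] by simp
qed

lemma tr_shifts:
  assumes "x \<in> \<Sigma>" "y \<in> \<Sigma>"
  shows "finite (shifts (tr \<one>\<^bsub>T_aut\<^esub> y x))"
proof -
  have p: "path (tail x) \<in> M" "finite (shifts (path (tail x)))"
    "path (tail y) \<in> M" "finite (shifts (path (tail y)))"
    using path_shifts tail_less assms by auto
  show ?thesis
    using shifts_mult[OF p(3,4) subgroup.m_inv_closed[OF M_subgroup p(1)] shifts_inv[OF p(1,2)]] p
    by (simp add: tr_def M_mem)
qed

text \<open>Compactness of \<open>\<Sigma>\<close>, for arguments by contradiction: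
  \<open>B v\<close> says that a finiteness or boundedness claim fails on the cylinder of
  \<open>v\<close>, and the branch is a point at which it fails on all cylinders.\<close>

lemma koenig:
  assumes "B []" and step: "\<And>v. v \<in> W \<Longrightarrow> B v \<Longrightarrow> \<exists>z<d. B (v @ [z])"
  obtains x where "x \<in> \<Sigma>" "\<And>n. B (map x [0..<n])"
proof -
  obtain nx where nx: "\<And>v. v \<in> W \<Longrightarrow> B v \<Longrightarrow> nx v < d \<and> B (v @ [nx v])"
    using step by metis
  define v where "v = rec_nat [] (\<lambda>_ v. v @ [nx v])"
  have v: "v 0 = []" "v (Suc n) = v n @ [nx (v n)]" for n by (simp_all add: v_def)
  have vB: "v n \<in> W \<and> B (v n)" for n
    by (induction n) (use assms(1) nx v in auto)
  have "map (\<lambda>n. nx (v n)) [0..<n] = v n" for n by (induction n) (simp_all add: v)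
  then have "B (map (\<lambda>n. nx (v n)) [0..<n])" for n using vB[of n] by simp
  moreover have "(\<lambda>n. nx (v n)) \<in> \<Sigma>" using vB nx by (simp add: \<Sigma>_def)
  ultimately show thesis by (rule that[rotated])
qed

definition cyl :: "nat list \<Rightarrow> (nat \<Rightarrow> nat) set" where
  "cyl v = {y \<in> \<Sigma>. map y [0..<length v] = v}"

lemma cyl_split: "cyl v = (\<Union>z<d. cyl (v @ [z]))"
  by (auto simp: cyl_def \<Sigma>_def)

lemma cyl_pre:
  assumes "y \<in> cyl (map x [0..<n])"
  obtains y' where "y' \<in> \<Sigma>" "y = pre x n y'"
proof
  have y: "y \<in> \<Sigma>" "\<And>k. k < n \<Longrightarrow> y k = x k" using assms by (auto simp: cyl_def)
  show "(\<lambda>k. y (k + n)) \<in> \<Sigma>" using y by (simp add: \<Sigma>_def)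
  show "y = pre x n (\<lambda>k. y (k + n))" using y(2) by (auto simp: pre_def)
qed

text \<open>Infinitely many changes of tail would accumulate at some \<open>x\<close>. But on a
  cylinder around \<open>x\<close> the element acts, after a change of prefix, as a product of paths
  and their inverses, which changes only finitely many tails.\<close>

lemma H0_shifts:
  assumes h: "h \<in> H0"
  shows "finite (shifts h)"
proof (rule ccontr)
  assume inf: "infinite (shifts h)"
  define B where "B v \<longleftrightarrow> infinite (shifts h \<inter> cyl v)" for v
  have "shifts h \<inter> cyl [] = shifts h" by (auto simp: shifts_def cyl_def C_mem)
  then have "B []" using inf by (simp add: B_def)
  moreover have "\<exists>z<d. B (v @ [z])" if "B v" for v
  proof (rule ccontr)
    assume "\<not> (\<exists>z<d. B (v @ [z]))"
    then have "finite (\<Union>z<d. shifts h \<inter> cyl (v @ [z]))"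
      by (intro finite_UN_I) (auto simp: B_def)
    moreover have "shifts h \<inter> cyl v = (\<Union>z<d. shifts h \<inter> cyl (v @ [z]))"
      using cyl_split[of v] by auto
    ultimately have "finite (shifts h \<inter> cyl v)" by (simp only:)
    then show False using that by (simp add: B_def)
  qed
  ultimately obtain x where x: "x \<in> \<Sigma>" "\<And>n. B (map x [0..<n])"
    using koenig[of B] by blast
  let ?s = "tr \<one>\<^bsub>T_aut\<^esub> (act h x) x"
  obtain n where n: "germ_at h ?s x n"
    using eventually_happens[OF H0_germ[OF h x(1), unfolded germ_def]] by auto
  have "shifts h \<inter> cyl (map x [0..<n]) \<subseteq> pre x n ` shifts ?s"
  proof
    fix y assume y: "y \<in> shifts h \<inter> cyl (map x [0..<n])"
    then obtain y' where y': "y' \<in> \<Sigma>" "y = pre x n y'" by (auto elim: cyl_pre)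
    then have "y' \<in> shifts ?s"
      using y n by (auto simp: shifts_def germ_at_def C_def)
    then show "y \<in> pre x n ` shifts ?s" using y' by blast
  qed
  moreover have "act h x \<in> \<Sigma>" using h x by (simp add: act_closed M_mem H0_M)
  ultimately have "finite (shifts h \<inter> cyl (map x [0..<n]))"
    using tr_shifts[OF x(1)] finite_subset finite_imageI by metis
  then show False using x(2) by (simp add: B_def)
qed

text \<open>The coboundary of \<open>tail\<close>, taken in the integers so that
  \<open>int_mean\<close> supplies the invariant mean on its values.\<close>

definition tail_diff :: "(nat list \<Rightarrow> nat list) \<Rightarrow> (nat \<Rightarrow> nat) \<Rightarrow> int" where
  "tail_diff g x = int (tail (act g x)) - int (tail x)"

sublocale tails: cocycle_action T_aut integer_group H0 C act UNIV tail_diff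
proof (intro cocycle_action.intro cocycle_action_axioms.intro)
  show "subgroup H0 T_aut" by (rule H0_subgroup)
  show "subgroup UNIV integer_group" using group.subgroup_self[OF group_integer_group] by simp
  show "finite {x \<in> C. tail_diff g x \<noteq> \<one>\<^bsub>integer_group\<^esub>}" if "g \<in> H0" for g
    using H0_shifts[OF that] by (simp add: tail_diff_def shifts_def)
qed (auto simp: M_C M_mem C_mem act_mult act_one H0_M tail_diff_def is_group)

definition "H1 = {h \<in> H0. \<forall>x\<in>C. tail_diff h x = 0}"

lemma H1_subgroup: "subgroup H1 T_aut"
  using tails.kernel_subgroup by (simp add: H1_def)

lemma H1_H0: "h \<in> H1 \<Longrightarrow> h \<in> H0"
  by (simp add: H1_def)

lemma H1_mem: "h \<in> H1 \<Longrightarrow> h \<in> carrier T_aut"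
  by (simp add: H1_H0 H0_M M_mem)

text \<open>The tails of \<open>x\<close> and its image agree, on \<open>C\<close> by the second
  cocycle and off \<open>C\<close> because both have the default value; so the connecting germ is
  1.\<close>

lemma H1_germ:
  assumes h: "h \<in> H1" and x: "x \<in> \<Sigma>"
  shows "germ h \<one>\<^bsub>T_aut\<^esub> x"
proof -
  have hx: "act h x \<in> \<Sigma>" using h x by (simp add: act_closed H1_mem)
  have "tail (act h x) = tail x"
  proof (cases "x \<in> C")
    case True
    then show ?thesis using h by (simp add: H1_def tail_diff_def)
  next
    case False
    have "act h x \<in> C \<longleftrightarrow> x \<in> C"
      using M_tame[OF H0_M[OF H1_H0[OF h]]] x by (auto simp: tame_def)
    then have "\<not> (\<exists>j. tail_const (act h x) j)" "\<not> (\<exists>j. tail_const x j)"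
      using False x hx by (auto simp: C_def)
    then show ?thesis by (simp only: tail_def if_False)
  qed
  then show ?thesis using H0_germ[OF H1_H0[OF h] x] x by (simp add: tr_one)
qed

section \<open>Local finiteness of the second kernel\<close>

definition "level N = {h \<in> H1. \<forall>x\<in>\<Sigma>. germ_at h \<one>\<^bsub>T_aut\<^esub> x N}"

lemma germ_at_mono:
  assumes h: "germ_at h \<one>\<^bsub>T_aut\<^esub> x n" and x: "x \<in> \<Sigma>"
  shows "germ_at h \<one>\<^bsub>T_aut\<^esub> x (n + m)"
  unfolding germ_at_def
proof
  fix y assume y: "y \<in> \<Sigma>"
  let ?x = "\<lambda>k. x (k + n)"
  have x': "?x \<in> \<Sigma>" using x by (simp add: \<Sigma>_def)
  have "act h x = act h (pre x n ?x)" by (simp add: pre_tail)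
  also have "\<dots> = pre (act h x) n ?x" using h x' by (simp add: germ_at_def act_one)
  finally have hx: "act h x = pre (act h x) n ?x" .
  have "act h (pre x (n + m) y) = act h (pre x n (pre ?x m y))"
    by (metis pre_pre pre_tail)
  also have "\<dots> = pre (act h x) n (pre ?x m y)"
    using h x' y by (simp add: germ_at_def act_one pre_mem)
  also have "\<dots> = pre (act h x) (n + m) y" by (metis pre_pre hx)
  finally show "act h (pre x (n + m) y) = pre (act h x) (n + m) (act \<one>\<^bsub>T_aut\<^esub> y)"
    using y by (simp add: act_one)
qed

lemma level_mono: "N \<le> N' \<Longrightarrow> level N \<subseteq> level N'"
  using germ_at_mono[where m = "N' - N" and n = N] by (auto simp: level_def)

text \<open>Each point has a prefix beyond which the element acts trivially; compactness makes the
  length of this prefix uniform.\<close>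

lemma H1_level:
  assumes h: "h \<in> H1"
  shows "\<exists>N. h \<in> level N"
proof (rule ccontr)
  assume no: "\<not> (\<exists>N. h \<in> level N)"
  define B where "B v \<longleftrightarrow> \<not> (\<exists>N. \<forall>x\<in>cyl v. germ_at h \<one>\<^bsub>T_aut\<^esub> x N)" for v
  have "cyl [] = \<Sigma>" by (auto simp: cyl_def)
  then have "B []" using no h by (auto simp: B_def level_def)
  moreover have "\<exists>z<d. B (v @ [z])" if "B v" for v
  proof (rule ccontr)
    assume "\<not> (\<exists>z<d. B (v @ [z]))"
    then obtain N where N: "\<And>z x. z < d \<Longrightarrow> x \<in> cyl (v @ [z]) \<Longrightarrow> germ_at h \<one>\<^bsub>T_aut\<^esub> x (N z)"
      unfolding B_def by metis
    define K where "K = Max (N ` {..<d})"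
    have "germ_at h \<one>\<^bsub>T_aut\<^esub> x K" if x: "x \<in> cyl v" for x
    proof -
      obtain z where z: "z < d" "x \<in> cyl (v @ [z])" using x cyl_split[of v] by auto
      have "N z \<le> K" unfolding K_def using z by (intro Max_ge) auto
      moreover have "x \<in> \<Sigma>" using x by (simp add: cyl_def)
      ultimately show ?thesis using germ_at_mono[OF N[OF z], of "K - N z"] by simp
    qed
    then show False using that by (auto simp: B_def)
  qed
  ultimately obtain x where x: "x \<in> \<Sigma>" "\<And>n. B (map x [0..<n])"
    using koenig[of B] by blast
  obtain n where n: "germ_at h \<one>\<^bsub>T_aut\<^esub> x n"
    using eventually_happens[OF H1_germ[OF h x(1), unfolded germ_def]] by auto
  \<comment> \<open>The condition at \<open>x\<close> concerns the whole cylinder of its prefix, so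
    it carries over to every word in it.\<close>
  have "germ_at h \<one>\<^bsub>T_aut\<^esub> y n" if y: "y \<in> cyl (map x [0..<n])" for y
  proof -
    obtain y' where y': "y' \<in> \<Sigma>" "y = pre x n y'" using cyl_pre[OF y] by metis
    have "pre (pre w n u) n z = pre w n z" for w u z :: "nat \<Rightarrow> nat" by (rule pre_cong) (simp add: pre_def)
    then show ?thesis using n y' by (simp add: germ_at_def act_one)
  qed
  then show False using x(2) by (auto simp: B_def)
qed

text \<open>Everything after the first \<open>N\<close> letters is left unchanged, so an element is
  determined by its action on the finitely many words of length \<open>N\<close>.\<close>

lemma level_finite: "finite (level N)"
proof -
  let ?W = "{u \<in> W. length u = N}"
  have fin: "finite ?W"
    by (rule finite_subset[OF _ finite_lists_length_eq[of "{..<d}" N]]) (auto simp: tree_words_def)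
  let ?r = "\<lambda>h. restrict h ?W"
  have "inj_on ?r (level N)"
  proof (rule inj_onI)
    fix g h assume g: "g \<in> level N" and h: "h \<in> level N" and eq: "?r g = ?r h"
    have c: "g \<in> carrier T_aut" "h \<in> carrier T_aut" using g h by (auto simp: level_def H1_mem)
    show "g = h"
    proof (rule act_faithful[OF c])
      fix x assume x: "x \<in> \<Sigma>"
      let ?x = "\<lambda>k. x (k + N)"
      have x': "?x \<in> \<Sigma>" using x by (simp add: \<Sigma>_def)
      have *: "act f x = pre (act f x) N ?x" if "f \<in> level N" for f
      proof -
        have "act f x = act f (pre x N ?x)" by (simp add: pre_tail)
        also have "\<dots> = pre (act f x) N ?x" using that x x' by (simp add: level_def germ_at_def act_one)
        finally show ?thesis .
      qed
      have "map x [0..<N] \<in> ?W" using word_mem[OF x] by simp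
      then have "g (map x [0..<N]) = h (map x [0..<N])" using fun_cong[OF eq, of "map x [0..<N]"] by simp
      then have "map (act g x) [0..<N] = map (act h x) [0..<N]" using aut_prefix c x by simp
      then have "pre (act g x) N ?x = pre (act h x) N ?x" by (intro pre_cong) simp
      then show "act g x = act h x" using *[OF g] *[OF h] by simp
    qed
  qed
  moreover have "?r ` level N \<subseteq> PiE ?W (\<lambda>_. ?W)"
    using aut_closed aut_length H1_mem
    by (intro image_subsetI) (auto simp: level_def restrict_PiE_iff simp del: PiE_iff)
  then have "finite (?r ` level N)" by (rule finite_subset) (intro finite_PiE fin)
  ultimately show ?thesis by (rule finite_imageD[rotated])
qed

lemma level_mult:
  assumes "g \<in> level N" "h \<in> level N"
  shows "g \<otimes>\<^bsub>T_aut\<^esub> h \<in> level N"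
proof -
  have c: "g \<in> carrier T_aut" "h \<in> carrier T_aut" using assms by (auto simp: level_def H1_mem)
  have "germ_at (g \<otimes>\<^bsub>T_aut\<^esub> h) \<one>\<^bsub>T_aut\<^esub> x N" if "x \<in> \<Sigma>" for x
    using assms c that by (simp add: level_def germ_at_def act_mult act_one pre_mem act_closed)
  then show ?thesis using assms subgroup.m_closed[OF H1_subgroup] by (simp add: level_def)
qed

lemma level_one: "\<one>\<^bsub>T_aut\<^esub> \<in> level N"
  using subgroup.one_closed[OF H1_subgroup] by (simp add: level_def germ_at_def act_one pre_mem)

text \<open>\<open>H1\<close> is the increasing union of the finite sets \<open>level N\<close>.
  From a level containing \<open>g\<close> on, left multiplication by \<open>g\<close> permutes each
  level and so preserves its average.\<close>

lemma mean_H1: "\<exists>m. mean_inv T_aut H1 m"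
proof -
  obtain L :: "(nat \<Rightarrow> real) \<Rightarrow> real" where L: "\<And>N. mean_on {N..} L" using generalized_limit by blast
  define m where "m f = L (\<lambda>N. average (level N) f)" for f
  have av: "mean_on H1 (average (level N))" for N
    by (rule mean_on_average[OF level_finite]) (use level_one in \<open>auto simp: level_def\<close>)
  have "mean_on H1 m"
    unfolding m_def by (rule mean_on_bind[OF L[of 0]]) (rule av)
  moreover have "m (\<lambda>x. f (g \<otimes>\<^bsub>T_aut\<^esub> x)) = m f" if g: "g \<in> H1" and f: "bounded (f ` H1)" for f g
  proof -
    obtain K where K: "g \<in> level K" using H1_level[OF g] ..
    show ?thesis
      unfolding m_def
    proof (rule mean_on_cong[OF L[of K]])
      show "bounded ((\<lambda>N. average (level N) f) ` {K..})"
        by (rule bounded_image_mean[where k = "\<lambda>N. average (level N)", OF av f])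
      fix N assume "N \<in> {K..}"
      then have gN: "g \<in> level N" using K level_mono by auto
      have inj: "inj_on ((\<otimes>\<^bsub>T_aut\<^esub>) g) (level N)"
        using g by (auto simp: inj_on_def level_def H1_mem)
      \<comment> \<open>An injective map of a finite set into itself is onto.\<close>
      have "(\<otimes>\<^bsub>T_aut\<^esub>) g ` level N = level N"
        using level_mult[OF gN] by (intro endo_inj_surj[OF level_finite _ inj]) auto
      then show "average (level N) (\<lambda>x. f (g \<otimes>\<^bsub>T_aut\<^esub> x)) = average (level N) f"
        using average_reindex[OF inj, of f] by simp
    qed
  qed
  ultimately show ?thesis unfolding mean_inv_def by blast
qed

lemma bump_energy:
  assumes "g \<in> M"
  shows "\<exists>\<epsilon>. \<epsilon> \<longlonglongrightarrow> 0 \<and> (\<forall>n Q. finite Q \<longrightarrow> Q \<subseteq> C \<longrightarrow>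
    (\<Sum>x\<in>Q. (bump n (act g x) - bump n x)\<^sup>2) \<le> \<epsilon> n)"
proof -
  obtain K where K: "\<forall>n Q. finite Q \<longrightarrow> Q \<subseteq> C \<longrightarrow>
     (\<Sum>x\<in>Q. (bump n (act g x) - bump n x)\<^sup>2) \<le> K / real (Suc n)"
    using M_low_energy[OF assms] unfolding low_energy_def by blast
  have "(\<lambda>n. K / real (Suc n)) \<longlonglongrightarrow> 0"
    by (rule LIMSEQ_Suc) (rule lim_const_over_n)
  with K show ?thesis by blast
qed

text \<open>The mean climbs from \<open>H1\<close> to \<open>H0\<close> with integer labels, then
  from \<open>H0\<close> to \<open>M\<close> with labels in the cyclic group \<open>loops\<close>;
  the functions \<open>bump\<close> serve both times.\<close>

lemma amenable_mother_group: "amenable (mother_group d)"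
proof -
  obtain mz :: "(int \<Rightarrow> real) \<Rightarrow> real" where mz: "mean_on UNIV mz"
    "\<And>f j. bounded (range f) \<Longrightarrow> mz (\<lambda>k. f (j + k)) = mz f"
    using int_mean by metis
  have mz': "mean_inv integer_group UNIV mz" using mz by (simp add: mean_inv_def)
  obtain m1 where m1: "mean_inv T_aut H1 m1" using mean_H1 ..
  have "\<exists>m. mean_inv T_aut H0 m"
    by (rule tails.mean_from_kernel[OF mz' bump_support bump_one bump_energy[OF H0_M]])
      (use m1 in \<open>simp_all add: H1_def\<close>)
  then obtain m0 where m0: "mean_inv T_aut H0 m0" ..
  obtain ml where ml: "mean_inv T_aut loops ml" using mean_cyclic[OF loop_mem] by metis
  have "\<exists>m. mean_inv T_aut M m"
    by (rule loops.mean_from_kernel[OF ml bump_support bump_one bump_energy])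
      (use m0 in \<open>simp_all add: H0_def\<close>)
  then obtain m where "mean_inv T_aut M m" ..
  then have "mean_inv (mother_group d) M m" by (simp add: mean_inv_def mother_group_def)
  then show ?thesis by (rule amenable_if_mean[OF group_mother_group])
qed

end

theorem theorem6p2:
  fixes d :: nat
  assumes "d \<ge> 2"
  shows "amenable (mother_group d)"
  by (rule mother.amenable_mother_group[OF mother.intro[OF assms]])

end
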